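(* Let $D$ be the unit ball in $\mathbb{R}^3$. Assume that $n>0$ and $\eta>0$ are constants, where $\sqrt n$ is not an integer or a reciprocal of an integer. Then there exist infinitely many complex-valued (i.e. non-real) interior transmission eigenvalues for $D$, provided that $\eta$ is sufficiently small (depending on $n$).
   Context: For a domain $D$ with unit outward normal $\nu$ and constants $n,\eta$, a number $k\in\mathbb{C}$ is an interior transmission eigenvalue (with conductive boundary condition) if there is a nontrivial pair $(w,v)\in L^2(D)\times L^2(D)$ with $w-v\in H^2(D)\cap H^1_0(D)$ such that $$\Delta w+k^2nw=0,\quad \Delta v+k^2v=0\ \text{ in }D,\qquad w-v=0,\quad \partial_\nu w-\partial_\nu v=\eta v\ \text{ on }\partial D.$$ *)

theory Defs
  imports "HOL-Analysis.Analysis"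
begin

text \<open>
  Function spaces are rendered as sets of functions; identification up to null sets is
  expressed with \<open>AE\<close> where it matters. All functions take complex values.
\<close>

definition L2 :: "'a measure \<Rightarrow> ('a \<Rightarrow> complex) set" where
  "L2 M = {f \<in> borel_measurable M. integrable M (\<lambda>x. (cmod (f x))\<^sup>2)}"

definition L2_tendsto :: "'a measure \<Rightarrow> (nat \<Rightarrow> 'a \<Rightarrow> complex) \<Rightarrow> ('a \<Rightarrow> complex) \<Rightarrow> bool" where
  "L2_tendsto M F f \<longleftrightarrow> (\<forall>j. F j \<in> L2 M) \<and> f \<in> L2 M \<and>
     (\<lambda>j. \<integral>x. (cmod (F j x - f x))\<^sup>2 \<partial>M) \<longlonglongrightarrow> 0"

definition pd :: "'n \<Rightarrow> (real^'n \<Rightarrow> complex) \<Rightarrow> real^'n::finite \<Rightarrow> complex" where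
  "pd i f x = frechet_derivative f (at x) (axis i 1)"

primrec Ck :: "nat \<Rightarrow> (real^'n::finite \<Rightarrow> complex) \<Rightarrow> bool" where
  "Ck 0 f \<longleftrightarrow> continuous_on UNIV f"
| "Ck (Suc m) f \<longleftrightarrow> f differentiable_on UNIV \<and> (\<forall>i. Ck m (pd i f))"

definition smooth :: "(real^'n::finite \<Rightarrow> complex) \<Rightarrow> bool" where
  "smooth f \<longleftrightarrow> (\<forall>m. Ck m f)"

definition laplacian :: "(real^'n::finite \<Rightarrow> complex) \<Rightarrow> real^'n \<Rightarrow> complex" where
  "laplacian f x = (\<Sum>i\<in>UNIV. pd i (pd i f) x)"

definition test_fun :: "(real^'n::finite) set \<Rightarrow> (real^'n \<Rightarrow> complex) \<Rightarrow> bool" where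
  "test_fun D \<phi> \<longleftrightarrow> smooth \<phi> \<and>
     compact (closure {x. \<phi> x \<noteq> 0}) \<and> closure {x. \<phi> x \<noteq> 0} \<subseteq> D"

definition weak_pd ::
  "(real^'n::finite) set \<Rightarrow> 'n \<Rightarrow> (real^'n \<Rightarrow> complex) \<Rightarrow> (real^'n \<Rightarrow> complex) \<Rightarrow> bool" where
  "weak_pd D i f g \<longleftrightarrow> (\<forall>\<phi>. test_fun D \<phi> \<longrightarrow>
     (\<integral>x. f x * pd i \<phi> x \<partial>lebesgue_on D) = - (\<integral>x. g x * \<phi> x \<partial>lebesgue_on D))"

definition weak_laplacian ::
  "(real^'n::finite) set \<Rightarrow> (real^'n \<Rightarrow> complex) \<Rightarrow> (real^'n \<Rightarrow> complex) \<Rightarrow> bool" where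
  "weak_laplacian D f g \<longleftrightarrow> (\<forall>\<phi>. test_fun D \<phi> \<longrightarrow>
     (\<integral>x. f x * laplacian \<phi> x \<partial>lebesgue_on D) = (\<integral>x. g x * \<phi> x \<partial>lebesgue_on D))"

definition H1 :: "(real^'n::finite) set \<Rightarrow> (real^'n \<Rightarrow> complex) set" where
  "H1 D = {f \<in> L2 (lebesgue_on D). \<forall>i. \<exists>g \<in> L2 (lebesgue_on D). weak_pd D i f g}"

definition H2 :: "(real^'n::finite) set \<Rightarrow> (real^'n \<Rightarrow> complex) set" where
  "H2 D = {f \<in> L2 (lebesgue_on D). \<forall>i. \<exists>g \<in> H1 D. weak_pd D i f g}"

text \<open>Convergence in the norm of \<open>H1 D\<close>, for sequences of classically differentiable functions.\<close>

definition H1_tendsto ::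
  "(real^'n::finite) set \<Rightarrow> (nat \<Rightarrow> real^'n \<Rightarrow> complex) \<Rightarrow> (real^'n \<Rightarrow> complex) \<Rightarrow> bool" where
  "H1_tendsto D F f \<longleftrightarrow> L2_tendsto (lebesgue_on D) F f \<and>
     (\<forall>i. \<exists>g. weak_pd D i f g \<and> L2_tendsto (lebesgue_on D) (\<lambda>j. pd i (F j)) g)"

definition H10 :: "(real^'n::finite) set \<Rightarrow> (real^'n \<Rightarrow> complex) set" where
  "H10 D = {f \<in> H1 D. \<exists>F. (\<forall>j. test_fun D (F j)) \<and> H1_tendsto D F f}"

text \<open>
  In the following, \<open>\<sigma>\<close> is the surface measure on the boundary of \<open>D\<close> and \<open>\<nu>\<close> the unit outward
  normal. \<open>has_trace D \<sigma> f g\<close> says that \<open>g\<close> is the Sobolev trace of \<open>f \<in> H1 D\<close>, i.e. the value of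
  the continuous extension of the restriction map from functions smooth up to the boundary.
\<close>

definition has_trace ::
  "(real^'n::finite) set \<Rightarrow> (real^'n) measure \<Rightarrow> (real^'n \<Rightarrow> complex) \<Rightarrow> (real^'n \<Rightarrow> complex) \<Rightarrow> bool"
  where
  "has_trace D \<sigma> f g \<longleftrightarrow> (\<exists>F. (\<forall>j. smooth (F j)) \<and> H1_tendsto D F f \<and> L2_tendsto \<sigma> F g)"

text \<open>\<open>g\<close> is the normal derivative \<open>\<nu> \<bullet> \<nabla>u\<close> on the boundary, for \<open>u \<in> H2 D\<close>.\<close>

definition has_normal_derivative ::
  "(real^'n::finite) set \<Rightarrow> (real^'n) measure \<Rightarrow> (real^'n \<Rightarrow> real^'n) \<Rightarrow>
   (real^'n \<Rightarrow> complex) \<Rightarrow> (real^'n \<Rightarrow> complex) \<Rightarrow> bool" where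
  "has_normal_derivative D \<sigma> \<nu> u g \<longleftrightarrow> g \<in> L2 \<sigma> \<and>
     (\<exists>G T. (\<forall>i. weak_pd D i u (G i) \<and> has_trace D \<sigma> (G i) (T i)) \<and>
       (AE x in \<sigma>. g x = (\<Sum>i\<in>UNIV. of_real (\<nu> x $ i) * T i x)))"

text \<open>
  A function \<open>v \<in> L2\<close> with \<open>\<Delta>v \<in> L2\<close> has a boundary trace only in the dual space \<open>H\<^sup>-\<^sup>1\<^sup>/\<^sup>2\<close>, which is
  defined by Green's second identity
  \<open>\<langle>v, \<partial>\<^sub>\<nu>\<phi>\<rangle> = \<integral>\<^sub>D (v \<Delta>\<phi> - \<phi> \<Delta>v)\<close> for all \<open>\<phi> \<in> H2 D \<inter> H10 D\<close>.
  The predicate says that this trace is (represented by) the function \<open>g\<close>.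
\<close>

definition has_weak_trace ::
  "(real^'n::finite) set \<Rightarrow> (real^'n) measure \<Rightarrow> (real^'n \<Rightarrow> real^'n) \<Rightarrow>
   (real^'n \<Rightarrow> complex) \<Rightarrow> (real^'n \<Rightarrow> complex) \<Rightarrow> bool" where
  "has_weak_trace D \<sigma> \<nu> v g \<longleftrightarrow> v \<in> L2 (lebesgue_on D) \<and> g \<in> L2 \<sigma> \<and>
     (\<exists>f \<in> L2 (lebesgue_on D). weak_laplacian D v f \<and>
       (\<forall>\<phi> \<in> H2 D \<inter> H10 D. \<forall>q \<in> L2 (lebesgue_on D). \<forall>h.
          weak_laplacian D \<phi> q \<and> has_normal_derivative D \<sigma> \<nu> \<phi> h \<longrightarrow>
          (\<integral>x. g x * h x \<partial>\<sigma>) = (\<integral>x. v x * q x - \<phi> x * f x \<partial>lebesgue_on D)))"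

definition transmission_eigenvalue ::
  "(real^'n::finite) set \<Rightarrow> (real^'n) measure \<Rightarrow> (real^'n \<Rightarrow> real^'n) \<Rightarrow>
   real \<Rightarrow> real \<Rightarrow> complex \<Rightarrow> bool" where
  "transmission_eigenvalue D \<sigma> \<nu> n \<eta> k \<longleftrightarrow>
     (\<exists>w \<in> L2 (lebesgue_on D). \<exists>v \<in> L2 (lebesgue_on D).
        \<not> (AE x in lebesgue_on D. w x = 0 \<and> v x = 0) \<and>
        (\<lambda>x. w x - v x) \<in> H2 D \<inter> H10 D \<and>
        weak_laplacian D w (\<lambda>x. - (k\<^sup>2 * of_real n * w x)) \<and>
        weak_laplacian D v (\<lambda>x. - (k\<^sup>2 * v x)) \<and>
        has_trace D \<sigma> (\<lambda>x. w x - v x) (\<lambda>x. 0) \<and>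
        (\<exists>g. has_normal_derivative D \<sigma> \<nu> (\<lambda>x. w x - v x) g \<and>
             has_weak_trace D \<sigma> \<nu> (\<lambda>x. of_real \<eta> * v x) g))"

text \<open>
  Surface measure of the unit sphere via polar coordinates: the measure of \<open>A\<close> is the dimension
  times the Lebesgue measure of the cone \<open>{r *\<^sub>R a | r a. 0 < r \<and> r < 1 \<and> a \<in> A}\<close>.
\<close>

definition sphere_measure :: "(real^'n::finite) measure" where
  "sphere_measure = scale_measure (of_nat CARD('n))
     (distr (lebesgue_on (ball 0 1 - {0})) (restrict_space borel (sphere 0 1)) sgn)"

end

theory Submission
  imports Defs "HOL-Complex_Analysis.Complex_Analysis" "HOL-Real_Asymp.Real_Asymp"
begin

text \<open>
  Write \<open>a = \<surd>n\<close>. The radial functions \<open>w = sin k \<cdot> sin (a k r) / r\<close> and \<open>v = sin (a k) \<cdot> sin (k r) / r\<close>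
  are eigenfunctions as soon as \<open>k g(k) = \<eta> sin k sin (a k)\<close>, where
  \<open>g(z) = a sin z cos (a z) - cos z sin (a z)\<close>.

  The function \<open>g\<close> has a non-real zero. Otherwise, for \<open>s > 0\<close> and \<open>a > 1\<close>, the quotient
  \<open>g(z - \<i> s) / g(z + \<i> s)\<close> is bounded in the upper half plane (almost periodicity and Hurwitz) and
  unimodular on the real line, so by Phragmen-Lindeloef \<open>|g(x)| \<le> |g(x + \<i> y)|\<close> for all \<open>y > 0\<close>. This
  fails at \<open>x = \<pi>\<close>, since \<open>g'(\<pi>) = 0\<close> and \<open>g(\<pi>) g''(\<pi>) = (a\<^sup>2 - 1) sin\<^sup>2 (a \<pi>) > 0\<close>. The case
  \<open>a < 1\<close> follows by exchanging \<open>a\<close> and \<open>1 / a\<close>. Along translations \<open>T \<rightarrow> \<infinity>\<close> that almost preserve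
  \<open>g\<close>, the term \<open>\<eta> sin k sin (a k) / k\<close> tends to 0, so by Hurwitz each non-real zero of \<open>g\<close> is
  accompanied by infinitely many non-real solutions \<open>k\<close>.

  The Sobolev conditions reduce to Green's identity on the ball for a smooth \<open>v\<close> and
  \<open>\<phi> \<in> H\<^sup>2 \<inter> H\<^sup>1\<^sub>0\<close>. Smooth cutoffs and the scaling behaviour of Lebesgue measure yield the divergence
  theorem for the cone measure on the sphere, and approximation in \<open>L\<^sup>2\<close> does the rest.
\<close>

section \<open>Non-real zeros\<close>

text \<open>The amplitudes \<open>sin k\<close> and \<open>sin (a k)\<close> are crossed so that
  \<open>w\<close> and \<open>v\<close> agree at \<open>r = 1\<close>; only the flux condition
  remains, and \<open>g\<close> is what is left of \<open>w' - v'\<close> once the two products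
  \<open>sin k sin (a k)\<close> cancel. No explicit non-real zero of \<open>g\<close> is at hand,
  hence the indirect route. The shift by \<open>s\<close> is forced by the real zeros of
  \<open>g\<close>: at height at least \<open>s\<close> the denominator is bounded below by a
  multiple of \<open>exp ((a + 1) Im z)\<close>, while on the axis it may vanish. Numerator and
  denominator have the same exponential type, so the quotient is bounded and the elementary form of
  Phragmen-Lindeloef suffices. The arithmetic of \<open>a\<close> enters through
  \<open>sin (a \<pi>)\<close>: for an integer \<open>a\<close> it vanishes, and with it
  \<open>g(\<pi>)\<close>, so nothing can be compared there. On the Sobolev side the obstacle is
  that \<open>v\<close> does not vanish on the sphere, whereas weak identities are tested with
  compact support. Multiplying by a cutoff restores them, at the price of a boundary layer term of
  size \<open>j\<close>. That term either dies against a factor vanishing linearly at the sphere or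
  survives as the surface integral.\<close>

definition disp :: "real \<Rightarrow> complex \<Rightarrow> complex" where
  "disp a z = of_real a * sin z * cos (of_real a * z) - cos z * sin (of_real a * z)"

text \<open>
  \<open>osc a A B\<close> with \<open>|A| = |B| = 1\<close> parametrises the real translates of \<open>4 \<i> disp a\<close> and their
  limits, so compactness of the torus replaces a normal family argument.
\<close>

definition osc :: "real \<Rightarrow> complex \<Rightarrow> complex \<Rightarrow> complex \<Rightarrow> complex" where
  "osc a A B z =
     of_real (a - 1) * (A * exp (\<i> * of_real (a + 1) * z) - cnj A * exp (- (\<i> * of_real (a + 1) * z)))
   - of_real (a + 1) * (B * exp (\<i> * of_real (a - 1) * z) - cnj B * exp (- (\<i> * of_real (a - 1) * z)))"

text \<open>Product-to-sum formulas: \<open>2 * disp a z\<close> equals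
  \<open>(a - 1) sin ((a + 1) z) - (a + 1) sin ((a - 1) z)\<close>. The two frequencies are the two
  torus coordinates, and for \<open>a > 1\<close> the higher one dominates far from the real
  line.\<close>

lemma disp_eq_exp:
  "4 * \<i> * disp a z =
     of_real (a - 1) * (exp (\<i> * of_real (a + 1) * z) - exp (- (\<i> * of_real (a + 1) * z)))
   - of_real (a + 1) * (exp (\<i> * of_real (a - 1) * z) - exp (- (\<i> * of_real (a - 1) * z)))"
proof -
  define p where "p = exp (\<i> * z)"
  define q where "q = exp (\<i> * (of_real a * z))"
  have nz: "p \<noteq> 0" "q \<noteq> 0" by (auto simp: p_def q_def)
  have s: "sin z = (p - 1/p) / (2*\<i>)" "cos z = (p + 1/p) / 2"
    "sin (of_real a * z) = (q - 1/q) / (2*\<i>)" "cos (of_real a * z) = (q + 1/q) / 2"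
    unfolding sin_exp_eq cos_exp_eq p_def q_def by (simp_all add: exp_minus field_simps)
  have e: "exp (\<i> * of_real (a + 1) * z) = q * p" "exp (- (\<i> * of_real (a + 1) * z)) = 1/q * (1/p)"
     "exp (\<i> * of_real (a - 1) * z) = q * (1/p)" "exp (- (\<i> * of_real (a - 1) * z)) = 1/q * p"
    unfolding p_def q_def by (simp_all add: exp_add[symmetric] exp_diff[symmetric] exp_minus[symmetric] algebra_simps divide_simps) 
  show ?thesis
    unfolding disp_def s e using nz
    by (simp add: divide_simps) (simp add: algebra_simps)
qed

text \<open>A real shift only rotates the phases, and the reciprocal of a unit phase is its
  conjugate; this is why \<open>osc\<close> carries \<open>cnj A\<close> and
  \<open>cnj B\<close>.\<close>

lemma osc_translate:
  fixes x :: real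
  shows "osc a (exp (\<i> * of_real ((a + 1) * x))) (exp (\<i> * of_real ((a - 1) * x))) z
    = 4 * \<i> * disp a (z + of_real x)"
  unfolding disp_eq_exp osc_def exp_cnj
  by (simp add: exp_add[symmetric] algebra_simps)

text \<open>The cosine products cancel, so for \<open>a > 0\<close>, \<open>a \<noteq> 1\<close> all
  critical points are real. This rules out constancy on an open set that contains a non-real
  point.\<close>

lemma deriv_disp:
  "(disp a has_field_derivative (of_real (1 - a\<^sup>2) * sin (of_real a * z) * sin z)) (at z)"
  unfolding disp_def[abs_def]
  by (auto intro!: derivative_eq_intros simp: algebra_simps power2_eq_square)

lemma holomorphic_disp [holomorphic_intros]: "disp a holomorphic_on S"
  unfolding disp_def[abs_def] by (intro holomorphic_intros)

lemma holomorphic_osc: "osc a A B holomorphic_on S"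
  unfolding osc_def[abs_def] by (intro holomorphic_intros)

lemma complex_sin_eq_0_imp_real: "sin (z :: complex) = 0 \<Longrightarrow> z \<in> \<real>"
  by (auto simp: sin_eq_0)

lemma disp_not_constant:
  assumes "a > 0" "a \<noteq> 1" "open S" "z \<in> S" "z \<notin> \<real>"
  shows "\<not> disp a constant_on S"
proof
  assume "disp a constant_on S"
  then obtain c where c: "\<And>w. w \<in> S \<Longrightarrow> disp a w = c" by (auto simp: constant_on_def)
  have "(disp a has_field_derivative 0) (at z)"
    by (rule has_field_derivative_transform_within_open[of "\<lambda>_. c" _ _ S]) (use assms c in auto)
  with deriv_disp have "of_real (1 - a\<^sup>2) * sin (of_real a * z) * sin z = 0"
    by (rule DERIV_unique)
  moreover have "1 - a\<^sup>2 \<noteq> 0" using assms by (simp add: power2_eq_1_iff)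
  moreover have "of_real a * z \<notin> \<real>" using assms
    by (metis Reals_divide Reals_of_real nonzero_mult_div_cancel_left of_real_eq_0_iff less_irrefl)
  ultimately show False using complex_sin_eq_0_imp_real assms(5)
    by (metis mult_eq_0_iff of_real_eq_0_iff)
qed

text \<open>\<open>osc\<close> is real-linear in \<open>(A, B)\<close>, so the difference is
  \<open>osc\<close> at \<open>(A - A', B - B')\<close>, and each exponential is at most
  \<open>exp (\<bar>b\<bar> * R)\<close> for its frequency \<open>b\<close>.\<close>

lemma osc_diff_le:
  assumes "cmod z \<le> R"
  shows "cmod (osc a A B z - osc a A' B' z) \<le>
     2 * \<bar>a - 1\<bar> * exp (\<bar>a + 1\<bar> * R) * cmod (A - A') + 2 * \<bar>a + 1\<bar> * exp (\<bar>a - 1\<bar> * R) * cmod (B - B')"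
proof -
  have e: "cmod (exp (\<i> * of_real b * z)) \<le> exp (\<bar>b\<bar> * R)" "cmod (exp (- (\<i> * of_real b * z))) \<le> exp (\<bar>b\<bar> * R)" for b
  proof -
    have "\<bar>b * Im z\<bar> \<le> \<bar>b\<bar> * R"
      unfolding abs_mult using abs_Im_le_cmod[of z] assms by (intro mult_left_mono) auto
    then show "cmod (exp (\<i> * of_real b * z)) \<le> exp (\<bar>b\<bar> * R)" 
      "cmod (exp (- (\<i> * of_real b * z))) \<le> exp (\<bar>b\<bar> * R)" by (simp_all add: norm_exp)
  qed
  have d: "cmod (D * exp (\<i> * of_real b * z) - cnj D * exp (- (\<i> * of_real b * z))) \<le> 2 * exp (\<bar>b\<bar> * R) * cmod D" for D b
  proof -
    have "cmod (D * exp (\<i> * of_real b * z) - cnj D * exp (- (\<i> * of_real b * z)))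
      \<le> cmod D * cmod (exp (\<i> * of_real b * z)) + cmod D * cmod (exp (- (\<i> * of_real b * z)))"
      by (metis complex_mod_cnj norm_mult norm_triangle_ineq4)
    also have "\<dots> \<le> cmod D * exp (\<bar>b\<bar> * R) + cmod D * exp (\<bar>b\<bar> * R)"
      by (intro add_mono mult_left_mono e) auto
    finally show ?thesis by (simp add: algebra_simps)
  qed
  have "osc a A B z - osc a A' B' z = 
     of_real (a - 1) * ((A - A') * exp (\<i> * of_real (a + 1) * z) - cnj (A - A') * exp (- (\<i> * of_real (a + 1) * z)))
   - of_real (a + 1) * ((B - B') * exp (\<i> * of_real (a - 1) * z) - cnj (B - B') * exp (- (\<i> * of_real (a - 1) * z)))"
    unfolding osc_def complex_cnj_diff by (simp only: algebra_simps)
  also have "cmod \<dots> \<le> \<bar>a - 1\<bar> * (2 * exp (\<bar>a + 1\<bar> * R) * cmod (A - A')) + \<bar>a + 1\<bar> * (2 * exp (\<bar>a - 1\<bar> * R) * cmod (B - B'))"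
    apply (rule order_trans[OF norm_triangle_ineq4])
    apply (rule add_mono)
    subgoal unfolding norm_mult norm_of_real by (intro mult_left_mono d) auto
    subgoal unfolding norm_mult norm_of_real by (intro mult_left_mono d) auto
    done
  finally show ?thesis by (simp add: algebra_simps)
qed

lemma uniform_limit_osc:
  assumes "A \<longlonglongrightarrow> A'" "B \<longlonglongrightarrow> B'" "bounded K"
  shows "uniform_limit K (\<lambda>j. osc a (A j) (B j)) (osc a A' B') sequentially"
proof -
  obtain R where R: "\<And>z. z \<in> K \<Longrightarrow> cmod z \<le> R" using assms(3) by (auto simp: bounded_iff)
  define d where "d j = 2 * \<bar>a - 1\<bar> * exp (\<bar>a + 1\<bar> * R) * cmod (A j - A') + 2 * \<bar>a + 1\<bar> * exp (\<bar>a - 1\<bar> * R) * cmod (B j - B')" for j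
  have "d \<longlonglongrightarrow> 0" unfolding d_def[abs_def]
    by (rule tendsto_eq_intros assms refl | simp)+
  show ?thesis
    unfolding uniform_limit_iff
  proof (intro allI impI)
    fix e :: real assume "e > 0"
    have "eventually (\<lambda>j. d j < e) sequentially" using \<open>d \<longlonglongrightarrow> 0\<close> \<open>e > 0\<close> by (rule order_tendstoD)
    then show "\<forall>\<^sub>F j in sequentially. \<forall>z\<in>K. dist (osc a (A j) (B j) z) (osc a A' B' z) < e"
      by eventually_elim (auto simp: dist_norm d_def intro: le_less_trans[OF osc_diff_le[OF R]])
  qed
qed

text \<open>High in the upper half plane the term with \<open>cnj A\<close> has modulus
  \<open>exp ((a + 1) * Im z)\<close> and beats the other three. Only moduli are used, so
  \<open>Y\<close> is uniform over the torus.\<close>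

lemma osc_lower_bound:
  assumes "a > 1"
  obtains Y where "Y > 0" "\<And>A B z. cmod A = 1 \<Longrightarrow> cmod B = 1 \<Longrightarrow> Im z \<ge> Y \<Longrightarrow>
     cmod (osc a A B z) \<ge> (a - 1) / 2 * exp ((a + 1) * Im z)"
proof -
  have "((\<lambda>y. (a - 1) * (1 - exp (- (2 * (a + 1) * y))) - 2 * (a + 1) * exp (- (2 * y))) \<longlongrightarrow> a - 1) at_top"
  proof -
    have "((\<lambda>y. (b - 2) * (1 - exp (- (2 * b * y))) - 2 * b * exp (- (2 * y))) \<longlongrightarrow> b - 2) at_top"
      if "b > 0" for b :: real using that by real_asymp
    from this[of "a + 1"] show ?thesis using assms by simp
  qed
  then have "eventually (\<lambda>y. (a - 1) * (1 - exp (- (2 * (a + 1) * y))) - 2 * (a + 1) * exp (- (2 * y)) > (a - 1) / 2) at_top"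
    by (rule order_tendstoD) (use assms in auto)
  then obtain Y0 where Y0: "\<And>y. y \<ge> Y0 \<Longrightarrow> (a - 1) * (1 - exp (- (2 * (a + 1) * y))) - 2 * (a + 1) * exp (- (2 * y)) > (a - 1) / 2"
    by (auto simp: eventually_at_top_linorder)
  show ?thesis
  proof (rule that[of "max Y0 1"])
    fix A B z assume AB: "cmod A = 1" "cmod B = 1" and z: "Im z \<ge> max Y0 1"
    define y where "y = Im z"
    have y: "y \<ge> Y0" "y \<ge> 1" using z by (auto simp: y_def)
    have "(a - 1) / 2 * exp ((a + 1) * y) \<le> ((a - 1) * (1 - exp (- (2 * (a + 1) * y))) - 2 * (a + 1) * exp (- (2 * y))) * exp ((a + 1) * y)"
      using Y0[OF y(1)] by (intro mult_right_mono) auto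
    also have "\<dots> = (a - 1) * (exp ((a + 1) * y) - exp (- ((a + 1) * y))) - 2 * (a + 1) * exp ((a - 1) * y)"
      by (simp add: algebra_simps exp_add[symmetric])
    also have "\<dots> \<le> (a - 1) * (exp ((a + 1) * y) - exp (- ((a + 1) * y))) - (a + 1) * (exp (- ((a - 1) * y)) + exp ((a - 1) * y))"
    proof -
      have "exp (- ((a - 1) * y)) \<le> exp ((a - 1) * y)" using y assms by (simp add: algebra_simps)
      then have "(a + 1) * (exp (- ((a - 1) * y)) + exp ((a - 1) * y)) \<le> (a + 1) * (2 * exp ((a - 1) * y))"
        using assms by (intro mult_left_mono) auto
      then show ?thesis by (simp only: mult.assoc mult.left_commute)
    qed
    also have "\<dots> \<le> cmod (osc a A B z)"
    proof -
      have m: "cmod (exp (\<i> * of_real b * z)) = exp (- (b * y))" "cmod (exp (- (\<i> * of_real b * z))) = exp (b * y)" for b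
        by (simp_all add: norm_exp y_def)
      let ?P = "of_real (a - 1) * (A * exp (\<i> * of_real (a + 1) * z) - cnj A * exp (- (\<i> * of_real (a + 1) * z)))"
      let ?Q = "of_real (a + 1) * (B * exp (\<i> * of_real (a - 1) * z) - cnj B * exp (- (\<i> * of_real (a - 1) * z)))"
      have "cmod (cnj A * exp (- (\<i> * of_real (a + 1) * z))) - cmod (A * exp (\<i> * of_real (a + 1) * z))
          \<le> cmod (A * exp (\<i> * of_real (a + 1) * z) - cnj A * exp (- (\<i> * of_real (a + 1) * z)))"
        by (metis norm_minus_commute norm_triangle_ineq2)
      then have "exp ((a + 1) * y) - exp (- ((a + 1) * y)) \<le> cmod (A * exp (\<i> * of_real (a + 1) * z) - cnj A * exp (- (\<i> * of_real (a + 1) * z)))"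
        by (simp only: norm_mult complex_mod_cnj AB m mult_1_left)
      then have "\<bar>a - 1\<bar> * (exp ((a + 1) * y) - exp (- ((a + 1) * y))) \<le> \<bar>a - 1\<bar> * cmod (A * exp (\<i> * of_real (a + 1) * z) - cnj A * exp (- (\<i> * of_real (a + 1) * z)))"
        by (rule mult_left_mono) simp
      then have 1: "(a - 1) * (exp ((a + 1) * y) - exp (- ((a + 1) * y))) \<le> cmod ?P"
        unfolding norm_mult[of "of_real (a - 1)"] norm_of_real using assms by simp
      have "cmod (B * exp (\<i> * of_real (a - 1) * z) - cnj B * exp (- (\<i> * of_real (a - 1) * z)))
         \<le> cmod (B * exp (\<i> * of_real (a - 1) * z)) + cmod (cnj B * exp (- (\<i> * of_real (a - 1) * z)))"
        by (rule norm_triangle_ineq4)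
      then have "cmod (B * exp (\<i> * of_real (a - 1) * z) - cnj B * exp (- (\<i> * of_real (a - 1) * z))) \<le> exp (- ((a - 1) * y)) + exp ((a - 1) * y)"
        by (simp only: norm_mult complex_mod_cnj AB m mult_1_left)
      then have "\<bar>a + 1\<bar> * cmod (B * exp (\<i> * of_real (a - 1) * z) - cnj B * exp (- (\<i> * of_real (a - 1) * z))) \<le> \<bar>a + 1\<bar> * (exp (- ((a - 1) * y)) + exp ((a - 1) * y))"
        by (rule mult_left_mono) simp
      then have 2: "cmod ?Q \<le> (a + 1) * (exp (- ((a - 1) * y)) + exp ((a - 1) * y))"
        unfolding norm_mult[of "of_real (a + 1)"] norm_of_real using assms by simp
      have "cmod ?P - cmod ?Q \<le> cmod (?P - ?Q)" by (rule norm_triangle_ineq2)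
      with 1 2 show ?thesis unfolding osc_def by linarith
    qed
    finally show "cmod (osc a A B z) \<ge> (a - 1) / 2 * exp ((a + 1) * Im z)" by (simp add: y_def)
  qed auto
qed

text \<open>Growth along the imaginary axis. Hurwitz requires this of every limit function, that is,
  for all phases on the torus.\<close>

lemma osc_not_constant_upper_half_plane:
  assumes "a > 1" "cmod A = 1" "cmod B = 1"
  shows "\<not> osc a A B constant_on {z. 0 < Im z}"
proof
  assume "osc a A B constant_on {z. 0 < Im z}"
  then obtain c where c: "\<And>z. 0 < Im z \<Longrightarrow> osc a A B z = c" by (auto simp: constant_on_def)
  obtain Y where Y: "Y > 0" "\<And>A B z. cmod A = 1 \<Longrightarrow> cmod B = 1 \<Longrightarrow> Im z \<ge> Y \<Longrightarrow>
     cmod (osc a A B z) \<ge> (a - 1) / 2 * exp ((a + 1) * Im z)"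
    using osc_lower_bound[OF assms(1)] by blast
  have "eventually (\<lambda>y. (a - 1) / 2 * exp ((a + 1) * y) > cmod c) at_top"
    using assms by real_asymp
  then have "eventually (\<lambda>y. (a - 1) / 2 * exp ((a + 1) * y) > cmod c \<and> y \<ge> Y) at_top"
    using eventually_ge_at_top[of Y] by eventually_elim auto
  then obtain y where y: "(a - 1) / 2 * exp ((a + 1) * y) > cmod c" "y \<ge> Y"
    using eventually_happens trivial_limit_at_top_linorder by blast
  have "osc a A B (\<i> * of_real y) = c" using c[of "\<i> * of_real y"] y Y(1) by simp
  moreover have "cmod (osc a A B (\<i> * of_real y)) \<ge> (a - 1) / 2 * exp ((a + 1) * y)" 
    using Y(2)[of A B "\<i> * of_real y"] y assms by simp
  ultimately show False using y by simp
qed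


text \<open>The strip is not compact, but real parts matter only through the phases. Near-zeros
  \<open>Z j\<close> become values of \<open>osc\<close> at \<open>\<i> * Im (Z j)\<close>, with
  parameters in a compact set; a limit of them is a zero at height \<open>y \<ge> s > 0\<close>,
  hence inside the open half plane, which Hurwitz forbids.\<close>

lemma disp_lower_bound_strip:
  assumes "a > 1" "s > 0" and nz: "\<And>z. 0 < Im z \<Longrightarrow> disp a z \<noteq> 0"
  shows "\<exists>m>0. \<forall>z. s \<le> Im z \<and> Im z \<le> Y \<longrightarrow> m \<le> cmod (disp a z)"
proof (rule ccontr)
  assume "\<not> ?thesis"
  then have "\<exists>z. s \<le> Im z \<and> Im z \<le> Y \<and> cmod (disp a z) < 1 / real (Suc j)" for j
    by (meson linorder_not_le of_nat_0_less_iff zero_less_Suc zero_less_divide_1_iff)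
  then obtain Z where Z: "\<And>j. s \<le> Im (Z j)" "\<And>j. Im (Z j) \<le> Y" "\<And>j. cmod (disp a (Z j)) < 1 / real (Suc j)"
    by metis
  define A where "A j = exp (\<i> * of_real ((a + 1) * Re (Z j)))" for j
  define B where "B j = exp (\<i> * of_real ((a - 1) * Re (Z j)))" for j
  have "compact (sphere (0::complex) 1 \<times> sphere (0::complex) 1 \<times> {s..Y})"
    by (intro compact_Times) auto
  moreover have "\<forall>j. (A j, B j, Im (Z j)) \<in> sphere (0::complex) 1 \<times> sphere (0::complex) 1 \<times> {s..Y}"
    using Z by (auto simp: A_def B_def norm_exp)
  ultimately obtain l r where l: "l \<in> sphere (0::complex) 1 \<times> sphere (0::complex) 1 \<times> {s..Y}" "strict_mono (r :: nat \<Rightarrow> nat)"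
    "((\<lambda>j. (A j, B j, Im (Z j))) \<circ> r) \<longlonglongrightarrow> l"
    by (rule seq_compactE[OF compact_imp_seq_compact])
  obtain A' B' y where l_eq: "l = (A', B', y)" by (cases l) auto
  have norms: "cmod A' = 1" "cmod B' = 1" "y > 0" using l(1) \<open>s > 0\<close> by (auto simp: l_eq)
  have lim: "(\<lambda>j. A (r j)) \<longlonglongrightarrow> A'" "(\<lambda>j. B (r j)) \<longlonglongrightarrow> B'" "(\<lambda>j. Im (Z (r j))) \<longlonglongrightarrow> y"
    using tendsto_fst[OF l(3)] tendsto_fst[OF tendsto_snd[OF l(3)]] tendsto_snd[OF tendsto_snd[OF l(3)]]
    by (simp_all add: l_eq o_def)
  have eq: "osc a (A j) (B j) z = 4 * \<i> * disp a (z + of_real (Re (Z j)))" for j z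
    unfolding A_def B_def by (rule osc_translate)
  have "(\<lambda>j. osc a (A (r j)) (B (r j)) (\<i> * of_real (Im (Z (r j))))) \<longlonglongrightarrow> osc a A' B' (\<i> * of_real y)"
    unfolding osc_def by (intro tendsto_intros lim)
  moreover have "(\<lambda>j. osc a (A (r j)) (B (r j)) (\<i> * of_real (Im (Z (r j))))) \<longlonglongrightarrow> 0"
  proof -
    have *: "\<i> * of_real (Im w) + of_real (Re w) = w" for w by (simp add: complex_eq_iff)
    have "(\<lambda>j. disp a (Z j)) \<longlonglongrightarrow> 0"
      by (rule Lim_null_comparison[OF _ LIMSEQ_inverse_real_of_nat])
         (use Z(3) in \<open>auto simp: inverse_eq_divide intro!: always_eventually less_imp_le\<close>)
    then have "(\<lambda>j. 4 * \<i> * disp a (Z (r j))) \<longlonglongrightarrow> 0"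
      using LIMSEQ_subseq_LIMSEQ[OF _ l(2)] tendsto_mult_right_zero by (fastforce simp: o_def)
    then show ?thesis unfolding eq * .
  qed
  ultimately have "osc a A' B' (\<i> * of_real y) = 0" by (rule LIMSEQ_unique)
  moreover have "osc a A' B' (\<i> * of_real y) \<noteq> 0"
  proof (rule Hurwitz_no_zeros[of "{z. 0 < Im z}" "\<lambda>j. osc a (A (r j)) (B (r j))" "osc a A' B'" "\<i> * of_real y"])
    show "open {z. 0 < Im z}" by (rule open_halfspace_Im_gt)
    show "connected {z. 0 < Im z}" by (intro convex_connected convex_halfspace_Im_gt)
    show "uniform_limit K (\<lambda>j. osc a (A (r j)) (B (r j))) (osc a A' B') sequentially" if "compact K" for K
      by (intro uniform_limit_osc lim compact_imp_bounded that)
    show "\<not> osc a A' B' constant_on {z. 0 < Im z}"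
      by (intro osc_not_constant_upper_half_plane norms assms)
    show "osc a (A (r j)) (B (r j)) z \<noteq> 0" if "z \<in> {z. 0 < Im z}" for j z
      unfolding eq using nz[of "z + of_real (Re (Z (r j)))"] that by simp
  qed (use norms in \<open>auto intro: holomorphic_osc\<close>)
  ultimately show False by simp
qed

lemma disp_lower_bound:
  assumes "a > 1" "s > 0" and nz: "\<And>z. 0 < Im z \<Longrightarrow> disp a z \<noteq> 0"
  shows "\<exists>m>0. \<forall>z. s \<le> Im z \<longrightarrow> m * exp ((a + 1) * Im z) \<le> cmod (disp a z)"
proof -
  obtain Y where Y: "Y > 0" "\<And>A B z. cmod A = 1 \<Longrightarrow> cmod B = 1 \<Longrightarrow> Im z \<ge> Y \<Longrightarrow>
     cmod (osc a A B z) \<ge> (a - 1) / 2 * exp ((a + 1) * Im z)"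
    using osc_lower_bound[OF assms(1)] by blast
  obtain m where m: "m > 0" "\<And>z. s \<le> Im z \<Longrightarrow> Im z \<le> Y \<Longrightarrow> m \<le> cmod (disp a z)"
    using disp_lower_bound_strip[OF assms, of Y] by blast
  \<comment> \<open>The 8 is the 2 of \<open>osc_lower_bound\<close> times the factor 4 between
    \<open>osc a 1 1\<close> and \<open>disp a\<close>; the second entry rewrites the strip bound as
    an exponential bound at the worst height \<open>Y\<close>.\<close>
  define c where "c = min ((a - 1) / 8) (m * exp (- ((a + 1) * Y)))"
  have "c * exp ((a + 1) * Im z) \<le> cmod (disp a z)" if "s \<le> Im z" for z
  proof (cases "Im z \<le> Y")
    case True
    have "c * exp ((a + 1) * Im z) \<le> (m * exp (- ((a + 1) * Y))) * exp ((a + 1) * Y)"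
      using True m(1) assms(1) by (intro mult_mono) (auto simp: c_def)
    also have "\<dots> = m" by (simp add: exp_minus)
    also have "\<dots> \<le> cmod (disp a z)" using m(2) that True .
    finally show ?thesis .
  next
    case False
    have "osc a 1 1 z = 4 * \<i> * disp a z" using osc_translate[of a 0 z] by simp
    then have "(a - 1) / 2 * exp ((a + 1) * Im z) \<le> 4 * cmod (disp a z)" using Y(2)[of 1 1 z] False
      by (simp add: norm_mult)
    moreover have "c * exp ((a + 1) * Im z) \<le> (a - 1) / 8 * exp ((a + 1) * Im z)"
      by (intro mult_right_mono) (simp_all only: c_def min.cobounded1 exp_ge_zero)
    ultimately show ?thesis by linarith
  qed
  moreover have "c > 0" using m(1) assms(1) by (simp add: c_def)
  ultimately show ?thesis by blast
qed

text \<open>Same exponential rate as in \<open>disp_lower_bound\<close>; this match keeps the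
  shifted quotient bounded.\<close>

lemma cmod_disp_le:
  assumes "a > 1"
  shows "cmod (disp a z) \<le> a * exp ((a + 1) * \<bar>Im z\<bar>)"
proof -
  have e: "cmod (exp (\<i> * of_real b * z) - exp (- (\<i> * of_real b * z))) \<le> 2 * exp ((a + 1) * \<bar>Im z\<bar>)" if "b = a + 1 \<or> b = a - 1" for b
  proof -
    have 1: "\<bar>b * Im z\<bar> \<le> (a + 1) * \<bar>Im z\<bar>" unfolding abs_mult using that assms by (intro mult_right_mono) auto
    have "cmod (exp (\<i> * of_real b * z) - exp (- (\<i> * of_real b * z))) \<le> cmod (exp (\<i> * of_real b * z)) + cmod (exp (- (\<i> * of_real b * z)))"
      by (rule norm_triangle_ineq4)
    also have "\<dots> \<le> exp ((a + 1) * \<bar>Im z\<bar>) + exp ((a + 1) * \<bar>Im z\<bar>)"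
      using 1 by (intro add_mono) (auto simp: norm_exp)
    finally show ?thesis by simp
  qed
  have "4 * cmod (disp a z) = cmod (4 * \<i> * disp a z)" by (simp add: norm_mult)
  also have "\<dots> \<le> cmod (of_real (a - 1) * (exp (\<i> * of_real (a + 1) * z) - exp (- (\<i> * of_real (a + 1) * z))))
     + cmod (of_real (a + 1) * (exp (\<i> * of_real (a - 1) * z) - exp (- (\<i> * of_real (a - 1) * z))))"
    unfolding disp_eq_exp by (rule norm_triangle_ineq4)
  also have "\<dots> \<le> (a - 1) * (2 * exp ((a + 1) * \<bar>Im z\<bar>)) + (a + 1) * (2 * exp ((a + 1) * \<bar>Im z\<bar>))"
    unfolding norm_mult norm_of_real using assms by (intro add_mono mult_mono e) auto
  also have "\<dots> = 4 * (a * exp ((a + 1) * \<bar>Im z\<bar>))" by (simp add: algebra_simps)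
  finally show ?thesis by simp
qed

section \<open>Phragmen-Lindeloef and the existence of a non-real zero\<close>

lemma disp_cnj: "disp a (cnj z) = cnj (disp a z)"
proof -
  have "of_real a * cnj z = cnj (of_real a * z)" by simp
  then show ?thesis unfolding disp_def by (simp only: flip: cnj_sin cnj_cos) simp
qed

text \<open>Since \<open>f\<close> is bounded, dividing by the linear factor
  \<open>1 - \<i> * d * w\<close> already gives decay. Its real part is \<open>1 + d * Im w\<close>,
  so it has modulus at least 1 on the closed half plane. The maximum principle on a large half disc
  gives \<open>cmod (h z) \<le> 1\<close>, and then \<open>d\<close> is made small.\<close>

lemma Phragmen_Lindelof_upper_half_plane:
  assumes hol: "f holomorphic_on {z. 0 < Im z}" and cont: "continuous_on {z. 0 \<le> Im z} f"
    and bd: "\<And>z. 0 \<le> Im z \<Longrightarrow> cmod (f z) \<le> M" and re: "\<And>z. Im z = 0 \<Longrightarrow> cmod (f z) \<le> 1"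
    and z: "0 < Im z"
  shows "cmod (f z) \<le> 1"
proof (rule field_le_epsilon)
  fix e :: real assume "e > 0"
  \<comment> \<open>Chosen so that the factor at the given point has modulus at most
    \<open>1 + e\<close>.\<close>
  define d where "d = e / (cmod z + 1)"
  have d: "d > 0" "d * cmod z \<le> e" using \<open>e > 0\<close> by (auto simp: d_def field_simps add_pos_nonneg)
  define h where "h w = f w / (1 - \<i> * of_real d * w)" for w
  have ge1: "1 \<le> cmod (1 - \<i> * of_real d * w)" if "0 \<le> Im w" for w
  proof -
    have "1 \<le> Re (1 - \<i> * of_real d * w)" using that d by simp
    also have "\<dots> \<le> cmod (1 - \<i> * of_real d * w)" by (rule complex_Re_le_cmod)
    finally show ?thesis .
  qed
  then have nz: "1 - \<i> * of_real d * w \<noteq> 0" if "0 \<le> Im w" for w using that by fastforce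
  \<comment> \<open>On the arc the factor has modulus at least
    \<open>d * R - 1 \<ge> \<bar>M\<bar>\<close>, which absorbs the bound on
    \<open>f\<close>.\<close>
  define R where "R = cmod z + (\<bar>M\<bar> + 1) / d"
  have R: "cmod z < R" "\<bar>M\<bar> + 1 \<le> d * R" using d(1) by (auto simp: R_def field_simps)
  define S where "S = {w. 0 < Im w} \<inter> ball 0 R"
  have oS: "open S" unfolding S_def by (intro open_Int open_halfspace_Im_gt open_ball)
  have clS: "closure S \<subseteq> {w. 0 \<le> Im w} \<inter> cball 0 R" 
    by (rule closure_minimal) (auto simp: S_def intro!: closed_Int closed_halfspace_Im_ge)
  have "cmod (h z) \<le> 1"
  proof (rule maximum_modulus_frontier[of h S])
    show "h holomorphic_on interior S" unfolding h_def using nz oS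
      by (intro holomorphic_intros holomorphic_on_subset[OF hol]) (simp_all only: interior_open, auto simp: S_def dest: nz[OF less_imp_le])
    have "continuous_on {w. 0 \<le> Im w} h" unfolding h_def
      by (intro continuous_on_divide cont continuous_intros) (rule ballI, rule nz, simp)
    then show "continuous_on (closure S) h" by (rule continuous_on_subset) (use clS in blast)
    show "bounded S" unfolding S_def by (simp add: bounded_Int)
    show "z \<in> S" using z R by (simp add: S_def)
    fix w assume "w \<in> frontier S"
    then have w: "0 \<le> Im w" "cmod w \<le> R" "w \<notin> S" using clS oS by (auto simp: frontier_def interior_open)
    show "cmod (h w) \<le> 1"
    proof (cases "Im w = 0")
      case True
      then have "cmod (f w) \<le> cmod (1 - \<i> * of_real d * w)" using re[of w] ge1[of w] by auto
      then show ?thesis using nz[OF w(1)] by (simp add: h_def norm_divide divide_simps)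
    next
      case False
      then have "cmod w = R" using w by (auto simp: S_def)
      then have "d * R - 1 \<le> cmod (1 - \<i> * of_real d * w)"
        using norm_triangle_ineq2[of "\<i> * of_real d * w" 1] d(1) by (simp add: norm_mult norm_minus_commute)
      then have "cmod (f w) \<le> cmod (1 - \<i> * of_real d * w)" using bd[OF w(1)] R by linarith
      then show ?thesis using nz[OF w(1)] by (simp add: h_def norm_divide divide_simps)
    qed
  qed
  then have "cmod (f z) \<le> cmod (1 - \<i> * of_real d * z)" using nz[of z] z
    by (simp add: h_def norm_divide divide_simps split: if_splits)
  also have "\<dots> \<le> 1 + d * cmod z"
    using norm_triangle_ineq4[of 1 "\<i> * of_real d * z"] d(1) by (simp add: norm_mult)
  finally show "cmod (f z) \<le> 1 + e" using d by linarith
qed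

text \<open>
  The quotient \<open>disp a (z - \<i> s) / disp a (z + \<i> s)\<close> has modulus 1 on the real line.
\<close>

lemma cmod_disp_mono_vertical:
  assumes "a > 1" "y > 0" and nz: "\<And>z. 0 < Im z \<Longrightarrow> disp a z \<noteq> 0"
  shows "cmod (disp a (of_real x)) \<le> cmod (disp a (of_real x + \<i> * of_real y))"
proof -
  \<comment> \<open>At \<open>x + \<i> s\<close> the quotient has its numerator evaluated at
    \<open>x\<close> and its denominator at \<open>x + 2 \<i> s = x + \<i> y\<close>.\<close>
  define s where "s = y / 2"
  have s: "s > 0" "y = 2 * s" using assms by (auto simp: s_def)
  obtain m where m: "m > 0" "\<And>z. s \<le> Im z \<Longrightarrow> m * exp ((a + 1) * Im z) \<le> cmod (disp a z)"
    using disp_lower_bound[OF assms(1) s(1) nz] by blast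
  define f where "f z = disp a (z - \<i> * of_real s) / disp a (z + \<i> * of_real s)" for z
  have nz': "disp a (z + \<i> * of_real s) \<noteq> 0" if "0 \<le> Im z" for z using that s by (intro nz) auto
  have hol: "(\<lambda>z. disp a (z + c)) holomorphic_on S" for S c
    by (rule holomorphic_on_compose_gen[of "\<lambda>z. z + c" S "disp a" UNIV, unfolded o_def]) (auto intro!: holomorphic_intros)
  have holf: "f holomorphic_on {z. 0 \<le> Im z}"
    unfolding f_def using hol[of "- (\<i> * of_real s)"]
    by (intro holomorphic_on_divide hol) (simp_all add: nz')
  have "cmod (f (of_real x + \<i> * of_real s)) \<le> 1"
  proof (rule Phragmen_Lindelof_upper_half_plane[where M = "a / m" and f = f and z = "of_real x + \<i> * of_real s"])
    show "f holomorphic_on {z. 0 < Im z}" by (rule holomorphic_on_subset[OF holf]) auto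
    show "continuous_on {z. 0 \<le> Im z} f" by (rule holomorphic_on_imp_continuous_on[OF holf])
    fix z :: complex
    show "cmod (f z) \<le> a / m" if "0 \<le> Im z"
    proof -
      \<comment> \<open>The two rates match because
        \<open>\<bar>Im z - s\<bar> \<le> Im (z + \<i> s)\<close>, and that height is at least
        \<open>s\<close>, where the lower bound holds.\<close>
      have "cmod (disp a (z - \<i> * of_real s)) \<le> a * exp ((a + 1) * \<bar>Im z - s\<bar>)"
        using cmod_disp_le[OF assms(1), of "z - \<i> * of_real s"] by simp
      also have "\<dots> \<le> a * exp ((a + 1) * (Im z + s))" using that s assms(1)
        by (intro mult_left_mono iffD2[OF exp_le_cancel_iff]) auto
      also have "\<dots> = (a / m) * (m * exp ((a + 1) * Im (z + \<i> * of_real s)))" using m(1) by simp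
      also have "\<dots> \<le> (a / m) * cmod (disp a (z + \<i> * of_real s))"
        using that s m assms(1) by (intro mult_left_mono m(2)) auto
      finally show ?thesis using nz'[OF that] m(1) by (simp add: f_def norm_divide divide_simps)
    qed
    show "cmod (f z) \<le> 1" if "Im z = 0"
    proof -
      have "z - \<i> * of_real s = cnj (z + \<i> * of_real s)" using that by (simp add: complex_eq_iff)
      then have "cmod (disp a (z - \<i> * of_real s)) = cmod (disp a (z + \<i> * of_real s))"
        by (metis disp_cnj complex_mod_cnj)
      then show ?thesis by (simp add: f_def norm_divide)
    qed
  qed (use s in auto)
  moreover have "disp a (of_real x + \<i> * of_real y) \<noteq> 0" using assms by (intro nz) auto
  ultimately show ?thesis by (simp add: f_def s algebra_simps norm_divide divide_simps split: if_splits)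
qed

text \<open>
  The point \<open>\<pi>\<close> is a critical point of \<open>disp a\<close> on the real line at which \<open>disp a\<close> and its second
  derivative have the same sign, because \<open>sin (a \<pi>) \<noteq> 0\<close>; this is forbidden for a real entire
  function of this type with only real zeros.
\<close>

lemma cmod_disp_less_pi:
  assumes "a > 1" "a \<notin> \<int>"
  shows "\<exists>y>0. cmod (disp a (of_real pi + \<i> * of_real y)) < cmod (disp a (of_real pi))"
proof -
  define d where "d = sin (a * pi)"
  define c where "c = cos (a * pi)"
  have d0: "d \<noteq> 0" unfolding d_def sin_zero_iff_int2 using assms(2) by auto
  have eq: "disp a (of_real pi + \<i> * of_real y) = Complex (d * (cosh y * cosh (a * y) - a * sinh y * sinh (a * y)))
      (c * (cosh y * sinh (a * y) - a * sinh y * cosh (a * y)))" for y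
  proof -
    have 1: "sin (\<i> * of_real t) = \<i> * of_real (sinh t)" "cos (\<i> * of_real t) = of_real (cosh t)" for t
      unfolding sin_i_times cos_i_times by (auto simp: sinh_def cosh_def exp_minus scaleR_conv_of_real simp flip: exp_of_real)
    have 2: "of_real a * (of_real pi + \<i> * of_real y) = of_real (a * pi) + \<i> * of_real (a * y)" by (simp add: distrib_left)
    have 3: "sin (of_real a * (of_real pi + \<i> * of_real y)) = of_real d * of_real (cosh (a * y)) + \<i> * of_real c * of_real (sinh (a * y))"
      "cos (of_real a * (of_real pi + \<i> * of_real y)) = of_real c * of_real (cosh (a * y)) - \<i> * of_real d * of_real (sinh (a * y))"
      unfolding 2 sin_add cos_add 1 sin_of_real cos_of_real d_def c_def by (simp_all add: algebra_simps)
    have 4: "sin (of_real pi + \<i> * of_real y) = - \<i> * of_real (sinh y)" "cos (of_real pi + \<i> * of_real y) = - of_real (cosh y)"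
      unfolding sin_add cos_add 1 sin_of_real cos_of_real by simp_all
    show ?thesis unfolding disp_def 3 4 by (simp add: complex_eq_iff algebra_simps)
  qed
  \<comment> \<open>Difference of the squared moduli at \<open>\<pi> + \<i> y\<close> and at
    \<open>\<pi>\<close>; by \<open>eq\<close> the value at \<open>\<pi>\<close> is
    \<open>d\<close>.\<close>
  define \<phi> where "\<phi> y = d\<^sup>2 * ((cosh y * cosh (a * y) - a * sinh y * sinh (a * y))\<^sup>2 - 1) + c\<^sup>2 * (cosh y * sinh (a * y) - a * sinh y * cosh (a * y))\<^sup>2" for y :: real
  have "((\<lambda>y. \<phi> y / y\<^sup>2) \<longlongrightarrow> - (d\<^sup>2 * (a\<^sup>2 - 1))) (at_right 0)"
  proof -
    have "((\<lambda>y. ((cosh y * cosh (a * y) - a * sinh y * sinh (a * y))\<^sup>2 - 1) / y\<^sup>2) \<longlongrightarrow> - (a\<^sup>2 - 1)) (at_right 0)"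
    proof -
      have c: "((\<lambda>y::real. (cosh (b * y) - 1) / y\<^sup>2) \<longlongrightarrow> b * b / 2) (at_right 0)" if "b > 0" for b
        using that by real_asymp
      \<comment> \<open>Product-to-sum leaves single hyperbolic cosines with known quadratic terms.
        Factoring \<open>X^2 - 1 = (X - 1) (X + 1)\<close>, the first factor over \<open>y^2\<close>
        tends to \<open>- (a^2 - 1) / 2\<close> and the second to 2.\<close>
      have id: "cosh y * cosh (a * y) - a * sinh y * sinh (a * y)
          = (1 - a) / 2 * cosh ((a + 1) * y) + (1 + a) / 2 * cosh ((a - 1) * y)" for y
        by (simp add: distrib_right left_diff_distrib cosh_add cosh_diff) (simp add: field_simps)
      have "((\<lambda>y. ((1 - a) / 2 * ((cosh ((a + 1) * y) - 1) / y\<^sup>2) + (1 + a) / 2 * ((cosh ((a - 1) * y) - 1) / y\<^sup>2))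
            * ((1 - a) / 2 * cosh ((a + 1) * y) + (1 + a) / 2 * cosh ((a - 1) * y) + 1))
         \<longlongrightarrow> ((1 - a) / 2 * ((a + 1) * (a + 1) / 2) + (1 + a) / 2 * ((a - 1) * (a - 1) / 2))
            * ((1 - a) / 2 * cosh ((a + 1) * 0) + (1 + a) / 2 * cosh ((a - 1) * 0) + 1)) (at_right 0)"
        using assms(1) by (intro tendsto_mult tendsto_add c tendsto_const tendsto_cosh tendsto_ident_at) auto
      moreover have "((1 - a) / 2 * ((a + 1) * (a + 1) / 2) + (1 + a) / 2 * ((a - 1) * (a - 1) / 2))
            * ((1 - a) / 2 * cosh ((a + 1) * 0) + (1 + a) / 2 * cosh ((a - 1) * 0) + 1) = - (a\<^sup>2 - 1)"
        by (simp add: field_simps power2_eq_square)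
      moreover have "((1 - a) / 2 * ((C - 1) / y) + (1 + a) / 2 * ((D - 1) / y)) * ((1 - a) / 2 * C + (1 + a) / 2 * D + 1)
          = (((1 - a) / 2 * C + (1 + a) / 2 * D)\<^sup>2 - 1) / y" for C D y :: real
      proof -
        have "(1 - a) / 2 * ((C - 1) / y) + (1 + a) / 2 * ((D - 1) / y) = ((1 - a) / 2 * C + (1 + a) / 2 * D - 1) / y"
          by (simp add: diff_divide_distrib add_divide_distrib algebra_simps)
        then show ?thesis by (simp add: power2_eq_square algebra_simps)
      qed
      ultimately show ?thesis unfolding id by simp
    qed
    \<comment> \<open>Both \<open>sinh (a y) / y\<close> and \<open>a sinh y / y\<close> tend to
      \<open>a\<close>, so the imaginary part is of smaller order than \<open>y\<close>; this is the
      criticality of \<open>\<pi>\<close>.\<close>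
    moreover have "((\<lambda>y. (cosh y * sinh (a * y) - a * sinh y * cosh (a * y))\<^sup>2 / y\<^sup>2) \<longlongrightarrow> 0) (at_right 0)"
    proof -
      have c: "((\<lambda>y::real. sinh (b * y) / y) \<longlongrightarrow> b) (at_right 0)" if "b > 0" for b
        using that by real_asymp
      have "((\<lambda>y. (cosh y * (sinh (a * y) / y) - a * (sinh (1 * y) / y) * cosh (a * y))\<^sup>2)
         \<longlongrightarrow> (cosh 0 * a - a * 1 * cosh (a * 0))\<^sup>2) (at_right 0)"
        using assms(1) by (intro tendsto_power tendsto_diff tendsto_mult c tendsto_const tendsto_cosh tendsto_ident_at) auto
      then show ?thesis by (simp add: power_divide diff_divide_distrib[symmetric])
    qed
    ultimately have "((\<lambda>y. d\<^sup>2 * (((cosh y * cosh (a * y) - a * sinh y * sinh (a * y))\<^sup>2 - 1) / y\<^sup>2) +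
        c\<^sup>2 * ((cosh y * sinh (a * y) - a * sinh y * cosh (a * y))\<^sup>2 / y\<^sup>2)) \<longlongrightarrow> d\<^sup>2 * (- (a\<^sup>2 - 1)) + c\<^sup>2 * 0) (at_right 0)"
      by (intro tendsto_intros)
    moreover have "d\<^sup>2 * (- (a\<^sup>2 - 1)) + c\<^sup>2 * 0 = - (d\<^sup>2 * (a\<^sup>2 - 1))" by (simp add: algebra_simps)
    ultimately show ?thesis unfolding \<phi>_def by (simp add: add_divide_distrib)
  qed
  moreover have "- (d\<^sup>2 * (a\<^sup>2 - 1)) < 0" using d0 assms(1) by (simp add: one_less_power)
  ultimately have "eventually (\<lambda>y. \<phi> y / y\<^sup>2 < 0) (at_right 0)" by (rule order_tendstoD)
  then have "eventually (\<lambda>y. \<phi> y / y\<^sup>2 < 0 \<and> y > 0) (at_right 0)"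
    using eventually_at_right_less[of 0] by eventually_elim auto
  then obtain y where y: "\<phi> y / y\<^sup>2 < 0" "y > 0"
    using eventually_happens trivial_limit_at_right_real by blast
  then have "\<phi> y < 0" by (simp add: divide_less_0_iff)
  then have "(cmod (disp a (of_real pi + \<i> * of_real y)))\<^sup>2 < (cmod (disp a (of_real pi + \<i> * of_real 0)))\<^sup>2"
    unfolding eq cmod_power2 by (simp add: \<phi>_def power_mult_distrib right_diff_distrib[of "d\<^sup>2"])
  then show ?thesis using y(2) power_less_imp_less_base by fastforce
qed

lemma disp_nonreal_zero_gt_1:
  assumes "a > 1" "a \<notin> \<int>"
  shows "\<exists>z. z \<notin> \<real> \<and> disp a z = 0"
proof (rule ccontr)
  assume "\<not> ?thesis"
  then have nz: "disp a z \<noteq> 0" if "0 < Im z" for z using that by (metis complex_is_Real_iff less_irrefl)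
  obtain y where "y > 0" "cmod (disp a (of_real pi + \<i> * of_real y)) < cmod (disp a (of_real pi))"
    using cmod_disp_less_pi[OF assms] by blast
  with cmod_disp_mono_vertical[OF assms(1) _ nz, of y pi] show False by simp
qed

text \<open>For \<open>a < 1\<close> the identity
  \<open>disp a (z / a) = - a * disp (1 / a) z\<close> carries zeros over, and a real scaling keeps
  them non-real. Excluding reciprocals of integers is what makes \<open>1 / a\<close>
  non-integral.\<close>

lemma disp_nonreal_zero:
  assumes "a > 0" "a \<notin> \<int>" "\<And>m :: int. a \<noteq> 1 / of_int m"
  shows "\<exists>z. z \<notin> \<real> \<and> disp a z = 0"
proof (cases "a > 1")
  case True
  then show ?thesis using disp_nonreal_zero_gt_1 assms by blast
next
  case False
  define b where "b = 1 / a"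
  have "a < 1" using False assms(2) by (cases "a = 1") auto
  then have "b > 1" using assms(1) by (simp add: b_def)
  moreover have "b \<notin> \<int>"
  proof
    assume "b \<in> \<int>"
    then obtain m where "b = of_int m" by (auto elim: Ints_cases)
    then have "a = 1 / of_int m" by (metis b_def divide_divide_eq_right div_by_1 mult_1)
    then show False using assms(3) by blast
  qed
  ultimately obtain z where z: "z \<notin> \<real>" "disp b z = 0" using disp_nonreal_zero_gt_1 by blast
  have ab: "of_real a * (of_real b * z) = z" using assms(1) by (simp add: b_def)
  have "disp a (of_real b * z) = - of_real a * disp b z"
    unfolding disp_def ab using assms(1) by (simp add: b_def algebra_simps)
  then have "disp a (of_real b * z) = 0" using z by simp
  moreover have "of_real b * z \<notin> \<real>"
    using z(1) ab by (metis Reals_mult Reals_of_real)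
  ultimately show ?thesis by blast
qed

section \<open>Recurrence of the phases and infinitely many zeros\<close>

lemma exp_recurrence:
  fixes p q :: real
  obtains T :: "nat \<Rightarrow> nat" where "\<And>j. j \<le> T j"
    "(\<lambda>j. exp (\<i> * of_real (p * real (T j)))) \<longlonglongrightarrow> 1" "(\<lambda>j. exp (\<i> * of_real (q * real (T j)))) \<longlonglongrightarrow> 1"
proof -
  define X where "X j = (exp (\<i> * of_real (p * real j)), exp (\<i> * of_real (q * real j)))" for j
  have "compact (sphere (0::complex) 1 \<times> sphere (0::complex) 1)"
    by (intro compact_Times) auto
  moreover have "\<forall>j. X j \<in> sphere (0::complex) 1 \<times> sphere (0::complex) 1"
    by (auto simp: X_def norm_exp)
  ultimately obtain l r where l: "l \<in> sphere (0::complex) 1 \<times> sphere (0::complex) 1" "strict_mono (r :: nat \<Rightarrow> nat)"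
    "(X \<circ> r) \<longlonglongrightarrow> l"
    by (rule seq_compactE[OF compact_imp_seq_compact])
  \<comment> \<open>Phases along a convergent subsequence may have any limit \<open>c\<close> on the
    circle. Taking differences of times divides two sequences with the same limit, so the phases at
    \<open>r (2 * j) - r j\<close> tend to 1; by \<open>grow\<close> these times are at least
    \<open>j\<close>.\<close>
  have key: "(\<lambda>j. exp (\<i> * of_real (b * real (r (2 * j) - r j)))) \<longlonglongrightarrow> 1"
    if "(\<lambda>j. exp (\<i> * of_real (b * real (r j)))) \<longlonglongrightarrow> c" "c \<noteq> 0" for b c
  proof -
    have "strict_mono (\<lambda>j::nat. 2 * j)" by (auto simp: strict_mono_def)
    from LIMSEQ_subseq_LIMSEQ[OF that(1) this]
    have "(\<lambda>j. exp (\<i> * of_real (b * real (r (2 * j)))) / exp (\<i> * of_real (b * real (r j)))) \<longlonglongrightarrow> c / c"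
      by (intro tendsto_divide that) (simp add: o_def)
    moreover have "exp (\<i> * of_real (b * real (r (2 * j)))) / exp (\<i> * of_real (b * real (r j))) = exp (\<i> * of_real (b * real (r (2 * j) - r j)))" for j
    proof -
      have "r j \<le> r (2 * j)" using l(2) by (simp add: strict_mono_less_eq)
      then show ?thesis by (simp add: exp_diff[symmetric] algebra_simps of_nat_diff)
    qed
    ultimately show ?thesis using that(2) by simp
  qed
  have grow: "r j + m \<le> r (j + m)" for j m
  proof (induction m)
    case (Suc m)
    have "r (j + m) < r (j + Suc m)" using l(2) by (auto simp: strict_mono_def)
    then show ?case using Suc by simp
  qed simp
  show ?thesis
  proof (rule that[of "\<lambda>j. r (2 * j) - r j"])
    show "j \<le> r (2 * j) - r j" for j using grow[of j j] by (simp add: mult_2)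
    show "(\<lambda>j. exp (\<i> * of_real (p * real (r (2 * j) - r j)))) \<longlonglongrightarrow> 1"
      using tendsto_fst[OF l(3)] l(1) by (intro key[of p "fst l"]) (auto simp: X_def o_def)
    show "(\<lambda>j. exp (\<i> * of_real (q * real (r (2 * j) - r j)))) \<longlonglongrightarrow> 1"
      using tendsto_snd[OF l(3)] l(1) by (intro key[of q "snd l"]) (auto simp: X_def o_def)
  qed
qed

lemma cmod_sin_le: "cmod (sin z) \<le> exp \<bar>Im z\<bar>"
proof -
  have "cmod (exp (\<i> * z) - exp (- (\<i> * z))) \<le> cmod (exp (\<i> * z)) + cmod (exp (- (\<i> * z)))"
    by (rule norm_triangle_ineq4)
  also have "\<dots> \<le> exp \<bar>Im z\<bar> + exp \<bar>Im z\<bar>" by (intro add_mono) (auto simp: norm_exp)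
  finally show ?thesis by (simp add: sin_exp_eq norm_divide norm_mult)
qed

text \<open>Finitely many solutions would be bounded by some \<open>C\<close>. Discs translated
  beyond \<open>C\<close> then contain none, and Hurwitz transfers this absence to
  \<open>disp a\<close> on the original disc around \<open>k0\<close>, whose centre is a
  zero.\<close>

lemma infinite_nonreal_zeros:
  fixes a \<eta> :: real
  assumes "a > 0" "a \<notin> \<int>" "\<And>m :: int. a \<noteq> 1 / of_int m"
  shows "infinite {k :: complex. k \<notin> \<real> \<and> k * disp a k = of_real \<eta> * sin k * sin (of_real a * k)}"
    (is "infinite ?Z")
proof
  assume fin: "finite ?Z"
  obtain k0 where k0: "k0 \<notin> \<real>" "disp a k0 = 0" using disp_nonreal_zero[OF assms] by blast
  obtain T where T: "\<And>j. j \<le> T j"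
    "(\<lambda>j. exp (\<i> * of_real ((a + 1) * real (T j)))) \<longlonglongrightarrow> 1" "(\<lambda>j. exp (\<i> * of_real ((a - 1) * real (T j)))) \<longlonglongrightarrow> 1"
    using exp_recurrence[of "a + 1" "a - 1"] by metis
  define s where "s = \<bar>Im k0\<bar>"
  have s: "s > 0" using k0(1) by (auto simp: s_def complex_is_Real_iff)
  \<comment> \<open>With radius \<open>\<bar>Im k0\<bar>\<close> the open disc just misses the real
    axis, and real translates of it do too; every solution found there is non-real.\<close>
  define S where "S = ball k0 s"
  have bdS: "cmod z \<le> cmod k0 + s" if "z \<in> S" for z
    using that norm_triangle_ineq2[of z k0] by (simp add: S_def dist_norm norm_minus_commute)
  have nonreal: "Im z \<noteq> 0" if "z \<in> S" for z
    using that abs_Im_le_cmod[of "k0 - z"] by (auto simp: S_def dist_norm s_def)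
  define M where "M = cmod k0 + s"
  have "M > 0" using s by (simp add: M_def add_nonneg_pos)
  obtain C where C: "\<And>z. z \<in> ?Z \<Longrightarrow> cmod z \<le> C" using finite_imp_bounded[OF fin] by (auto simp: bounded_iff)
  \<comment> \<open>Pushes every translate outside the disc of radius \<open>C\<close> and away from
    0, so that the division in \<open>F\<close> is legitimate for all \<open>j\<close>.\<close>
  define N where "N = nat \<lceil>2 * M + \<bar>C\<bar> + 1\<rceil>"
  define X where "X j = real (T (j + N))" for j
  have X: "X j \<ge> real j + 2 * M + \<bar>C\<bar> + 1" for j
  proof -
    have "real N \<ge> 2 * M + \<bar>C\<bar> + 1" unfolding N_def using real_nat_ceiling_ge by blast
    moreover have "X j \<ge> real (j + N)" unfolding X_def using T(1) of_nat_mono by blast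
    ultimately show ?thesis by simp
  qed
  have big: "cmod (z + of_real (X j)) \<ge> real j + M + \<bar>C\<bar> + 1" if "z \<in> S" for z j
  proof -
    have "X j - cmod z \<le> cmod (z + of_real (X j))"
      using norm_triangle_ineq2[of "of_real (X j)" "- z"] X[of j] \<open>M > 0\<close> by (simp add: add.commute)
    then show ?thesis using X[of j] bdS[OF that] by (simp add: M_def)
  qed
  \<comment> \<open>The equation divided by the translated variable, with the factor
    \<open>4 * \<i>\<close> that matches \<open>osc\<close>.\<close>
  define F where "F j z = 4 * \<i> * (disp a (z + of_real (X j))
     - of_real \<eta> * sin (z + of_real (X j)) * sin (of_real a * (z + of_real (X j))) / (z + of_real (X j)))" for j z
  have nz: "z + of_real (X j) \<noteq> 0" if "z \<in> S" for z j
    using big[OF that, of j] \<open>M > 0\<close> by auto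
  have Fnz: "F j z \<noteq> 0" if "z \<in> S" for j z
  proof
    assume "F j z = 0"
    then have "disp a (z + of_real (X j)) = of_real \<eta> * sin (z + of_real (X j)) * sin (of_real a * (z + of_real (X j))) / (z + of_real (X j))"
      by (simp add: F_def)
    then have "(z + of_real (X j)) \<in> ?Z"
      using nz[OF that, of j] nonreal[OF that] by (simp add: complex_is_Real_iff)
    then show False using C big[OF that, of j] \<open>M > 0\<close> by fastforce
  qed
  have "4 * \<i> * disp a k0 \<noteq> 0"
  proof (rule Hurwitz_no_zeros[of S F "\<lambda>z. 4 * \<i> * disp a z" k0])
    show "open S" "connected S" by (auto simp: S_def)
    have hol: "(\<lambda>z. disp a (z + c)) holomorphic_on S" for c
      by (rule holomorphic_on_compose_gen[of "\<lambda>z. z + c" S "disp a" UNIV, unfolded o_def]) (auto intro!: holomorphic_intros)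
    show "F j holomorphic_on S" for j
      unfolding F_def using nz by (intro holomorphic_intros hol) auto
    show "(\<lambda>z. 4 * \<i> * disp a z) holomorphic_on S" by (intro holomorphic_intros)
    show "\<not> (\<lambda>z. 4 * \<i> * disp a z) constant_on S"
    proof
      assume "(\<lambda>z. 4 * \<i> * disp a z) constant_on S"
      then have "disp a constant_on S" unfolding constant_on_def
        by (metis (no_types) complex_i_not_zero mult_cancel_left mult_eq_0_iff zero_neq_numeral)
      moreover have "a \<noteq> 1" using assms(2) by auto
      ultimately show False using disp_not_constant[of a S k0] assms(1) k0(1) s by (auto simp: S_def)
    qed
    show "k0 \<in> S" using s by (simp add: S_def)
    fix K assume K: "compact K" "K \<subseteq> S"
    define A where "A j = exp (\<i> * of_real ((a + 1) * X j))" for j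
    define B where "B j = exp (\<i> * of_real ((a - 1) * X j))" for j
    have lim: "A \<longlonglongrightarrow> 1" "B \<longlonglongrightarrow> 1" unfolding A_def B_def X_def
      using LIMSEQ_ignore_initial_segment[OF T(2), of N] LIMSEQ_ignore_initial_segment[OF T(3), of N] by simp_all
    have 1: "uniform_limit K (\<lambda>j. osc a (A j) (B j)) (osc a 1 1) sequentially"
      by (intro uniform_limit_osc lim compact_imp_bounded K)
    define G where "G j z = 4 * \<i> * (of_real \<eta> * sin (z + of_real (X j)) * sin (of_real a * (z + of_real (X j))) / (z + of_real (X j)))" for j z
    have 2: "uniform_limit K G (\<lambda>z. 0) sequentially"
    proof -
      \<comment> \<open>Real translation leaves imaginary parts unchanged, so the sines stay bounded
        while the denominator grows like \<open>j\<close>.\<close>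
      define b where "b = 4 * \<bar>\<eta>\<bar> * exp M * exp (a * M)"
      have bnd: "cmod (G j z) \<le> b / real (Suc j)" if "z \<in> K" for j z
      proof -
        have z: "z \<in> S" using that K by auto
        have im: "\<bar>Im z\<bar> \<le> M" using abs_Im_le_cmod[of z] bdS[OF z] by (simp add: M_def)
        have "cmod (sin (z + of_real (X j))) \<le> exp M"
          using cmod_sin_le[of "z + of_real (X j)"] im by (simp add: order_trans)
        moreover have "cmod (sin (of_real a * (z + of_real (X j)))) \<le> exp (a * M)"
        proof -
          have "\<bar>Im (of_real a * (z + of_real (X j)))\<bar> \<le> a * M"
            using im assms(1) by (simp add: abs_mult)
          then show ?thesis using cmod_sin_le order_trans exp_le_cancel_iff by blast
        qed
        ultimately have "cmod (4 * \<i> * of_real \<eta> * sin (z + of_real (X j)) * sin (of_real a * (z + of_real (X j)))) \<le> b"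
          unfolding norm_mult b_def by (intro mult_mono) auto
        moreover have "real (Suc j) \<le> cmod (z + of_real (X j))" using big[OF z, of j] \<open>M > 0\<close> by simp
        ultimately have "cmod (4 * \<i> * of_real \<eta> * sin (z + of_real (X j)) * sin (of_real a * (z + of_real (X j)))) / cmod (z + of_real (X j)) \<le> b / real (Suc j)"
          by (intro frac_le) (auto simp: b_def)
        then show ?thesis by (simp add: G_def norm_divide norm_mult mult.assoc)
      qed
      have "(\<lambda>j. b / real (Suc j)) \<longlonglongrightarrow> 0"
        using tendsto_mult_right_zero[OF LIMSEQ_inverse_real_of_nat, of b] by (simp add: divide_inverse)
      show ?thesis unfolding uniform_limit_iff
      proof (intro allI impI)
        fix e :: real assume "e > 0"
        have "eventually (\<lambda>j. b / real (Suc j) < e) sequentially"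
          using \<open>(\<lambda>j. b / real (Suc j)) \<longlonglongrightarrow> 0\<close> \<open>e > 0\<close> by (rule order_tendstoD)
        then show "\<forall>\<^sub>F j in sequentially. \<forall>z\<in>K. dist (G j z) 0 < e"
          by eventually_elim (auto intro: le_less_trans[OF bnd])
      qed
    qed
    have "uniform_limit K (\<lambda>j z. osc a (A j) (B j) z - G j z) (\<lambda>z. osc a 1 1 z - 0) sequentially"
      by (intro uniform_limit_intros 1 2)
    moreover have "osc a (A j) (B j) z - G j z = F j z" for j z
      unfolding A_def B_def osc_translate F_def G_def by (simp only: right_diff_distrib)
    moreover have "osc a 1 1 z = 4 * \<i> * disp a z" for z using osc_translate[of a 0 z] by simp
    ultimately show "uniform_limit K F (\<lambda>z. 4 * \<i> * disp a z) sequentially" by (simp add: fun_eq_iff[symmetric])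
  qed (rule Fnz)
  then show False using k0 by simp
qed

section \<open>Smooth functions\<close>

lemma pd_eqI: "(f has_derivative f') (at x) \<Longrightarrow> pd i f x = f' (axis i 1)"
  unfolding pd_def by (metis frechet_derivative_at)

lemma differentiable_has_derivative:
  "f differentiable (at x) \<Longrightarrow> (f has_derivative frechet_derivative f (at x)) (at x)"
  by (simp add: frechet_derivative_works)

lemma Ck_SucD: "Ck (Suc m) f \<Longrightarrow> f differentiable (at x)"
  by (simp add: differentiable_on_def)

lemma Ck_continuous: "Ck m f \<Longrightarrow> continuous_on UNIV f"
  by (cases m) (auto intro: differentiable_imp_continuous_on)

lemma Ck_Suc_imp_Ck: "Ck (Suc m) f \<Longrightarrow> Ck m f"
proof (induction m arbitrary: f)
  case 0 then show ?case by (metis Ck.simps(1) Ck_continuous)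
next
  case (Suc m) then show ?case by (metis Ck.simps(2))
qed

lemma pd_add:
  assumes "f differentiable (at x)" "g differentiable (at x)"
  shows "pd i (\<lambda>x. f x + g x) x = pd i f x + pd i g x"
  using pd_eqI[OF has_derivative_add[OF assms[THEN differentiable_has_derivative]], of i]
  by (simp add: pd_def)

lemma pd_mult:
  assumes "f differentiable (at x)" "g differentiable (at x)"
  shows "pd i (\<lambda>x. f x * g x) x = f x * pd i g x + pd i f x * g x"
  using pd_eqI[OF has_derivative_mult[OF assms[THEN differentiable_has_derivative]], of i]
  by (simp add: pd_def)

lemma pd_const [simp]: "pd i (\<lambda>x. c) x = 0"
  using pd_eqI[OF has_derivative_const] .

lemma Ck_const [simp]: "Ck m (\<lambda>x. c)"
proof (induction m arbitrary: c)
  case (Suc m)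
  have "pd i (\<lambda>x. c) = (\<lambda>x. 0)" for i :: 'a by (rule ext) simp
  then show ?case using Suc by simp
qed simp

lemma Ck_add: "Ck m f \<Longrightarrow> Ck m g \<Longrightarrow> Ck m (\<lambda>x. f x + g x)"
proof (induction m arbitrary: f g)
  case 0 then show ?case by (simp add: continuous_on_add)
next
  case (Suc m)
  have "pd i (\<lambda>x. f x + g x) = (\<lambda>x. pd i f x + pd i g x)" for i
    by (intro ext pd_add Ck_SucD[OF Suc.prems(1)] Ck_SucD[OF Suc.prems(2)])
  then show ?case using Suc by simp
qed

lemma Ck_mult: "Ck m f \<Longrightarrow> Ck m g \<Longrightarrow> Ck m (\<lambda>x. f x * g x)"
proof (induction m arbitrary: f g)
  case 0 then show ?case by (simp add: continuous_on_mult)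
next
  case (Suc m)
  have "pd i (\<lambda>x. f x * g x) = (\<lambda>x. f x * pd i g x + pd i f x * g x)" for i
    by (intro ext pd_mult Ck_SucD[OF Suc.prems(1)] Ck_SucD[OF Suc.prems(2)])
  moreover have "Ck m f" "Ck m g" using Suc.prems by (auto intro: Ck_Suc_imp_Ck)
  ultimately show ?case using Suc by (simp add: Ck_add)
qed

lemma has_derivative_coord: "((\<lambda>x. complex_of_real (x $ i)) has_derivative (\<lambda>h. of_real (h $ i))) (at x)"
  by (intro bounded_linear_imp_has_derivative bounded_linear_compose[OF bounded_linear_of_real bounded_linear_vec_nth])

lemma pd_coord: "pd j (\<lambda>x. complex_of_real (x $ i)) x = (if i = j then 1 else 0)"
  by (subst pd_eqI[OF has_derivative_coord]) (simp add: axis_def)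

lemma Ck_coord: "Ck m (\<lambda>x. complex_of_real (x $ i))"
proof (cases m)
  case 0 then show ?thesis by (auto intro!: continuous_intros)
next
  case (Suc k)
  have "pd j (\<lambda>x. complex_of_real (x $ i)) = (\<lambda>x. if i = j then 1 else 0)" for j
    by (rule ext) (rule pd_coord)
  then show ?thesis using Suc has_derivative_coord by (auto simp: differentiable_on_def intro: differentiableI)
qed

lemma smooth_const [simp]: "smooth (\<lambda>x. c)"
  and smooth_coord: "smooth (\<lambda>x. complex_of_real (x $ i))"
  and smooth_add: "smooth f \<Longrightarrow> smooth g \<Longrightarrow> smooth (\<lambda>x. f x + g x)"
  and smooth_mult: "smooth f \<Longrightarrow> smooth g \<Longrightarrow> smooth (\<lambda>x. f x * g x)"
  by (auto simp: smooth_def intro: Ck_coord Ck_add Ck_mult)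

lemma smooth_diff: "smooth f \<Longrightarrow> smooth g \<Longrightarrow> smooth (\<lambda>x. f x - g x)"
  using smooth_add[of f "\<lambda>x. - 1 * g x"] smooth_mult[of "\<lambda>_. - 1" g] by simp

lemma smooth_sum: "finite A \<Longrightarrow> (\<And>i. i \<in> A \<Longrightarrow> smooth (f i)) \<Longrightarrow> smooth (\<lambda>x. \<Sum>i\<in>A. f i x)"
  by (induction A rule: finite_induct) (auto intro: smooth_add)

lemma smooth_pd: "smooth f \<Longrightarrow> smooth (pd i f)"
  unfolding smooth_def by (metis Ck.simps(2))

lemma smooth_laplacian: "smooth f \<Longrightarrow> smooth (laplacian f)"
  unfolding laplacian_def[abs_def] by (intro smooth_sum smooth_pd) auto

lemma smooth_differentiable: "smooth f \<Longrightarrow> f differentiable (at x)"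
  unfolding smooth_def using Ck_SucD by blast

lemma smooth_continuous: "smooth f \<Longrightarrow> continuous_on S f"
  unfolding smooth_def using Ck_continuous continuous_on_subset by blast

lemma pd_diff:
  assumes "f differentiable (at x)" "g differentiable (at x)"
  shows "pd i (\<lambda>x. f x - g x) x = pd i f x - pd i g x"
  using pd_eqI[OF has_derivative_diff[OF assms[THEN differentiable_has_derivative]], of i]
  by (simp add: pd_def)

text \<open>Profiles \<open>h\<close> for radial functions \<open>h (x \<bullet> x)\<close>. Using
  the squared norm as variable avoids any singularity at the origin.\<close>

primrec CkR :: "nat \<Rightarrow> (real \<Rightarrow> complex) \<Rightarrow> bool" where
  "CkR 0 h \<longleftrightarrow> continuous_on UNIV h"
| "CkR (Suc m) h \<longleftrightarrow> (\<exists>h'. (\<forall>t. (h has_vector_derivative h' t) (at t)) \<and> CkR m h')"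

lemma CkR_add: "CkR m f \<Longrightarrow> CkR m g \<Longrightarrow> CkR m (\<lambda>x. f x + g x)"
proof (induction m arbitrary: f g)
  case (Suc m)
  then show ?case by (fastforce intro: has_vector_derivative_add)
qed (simp add: continuous_on_add)

lemma CkR_cmult: "CkR m f \<Longrightarrow> CkR m (\<lambda>x. c * f x)"
proof (induction m arbitrary: f)
  case (Suc m)
  then show ?case by (fastforce intro: has_vector_derivative_mult_right)
qed (simp add: continuous_on_mult)

lemma has_derivative_radial:
  fixes x :: "real^'n"
  assumes "(h has_vector_derivative h') (at (x \<bullet> x))"
  shows "((\<lambda>x. h (x \<bullet> x)) has_derivative (\<lambda>y. (2 * (x \<bullet> y)) *\<^sub>R h')) (at x)"
proof -
  have "((\<lambda>x. x \<bullet> x) has_derivative (\<lambda>y. 2 * (x \<bullet> y))) (at x)"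
    by (auto intro!: derivative_eq_intros simp: inner_commute)
  from has_derivative_compose[OF this assms[unfolded has_vector_derivative_def]]
  show ?thesis .
qed

lemma pd_radial:
  fixes x :: "real^'n"
  assumes "(h has_vector_derivative h') (at (x \<bullet> x))"
  shows "pd i (\<lambda>x. h (x \<bullet> x)) x = 2 * of_real (x $ i) * h'"
  using pd_eqI[OF has_derivative_radial[OF assms]] by (simp add: inner_axis scaleR_conv_of_real)

text \<open>A partial derivative is \<open>2 * x $ i\<close> times a radial function with profile
  \<open>h'\<close>, so induction on the order closes up.\<close>

lemma Ck_radial: "CkR m h \<Longrightarrow> Ck m (\<lambda>x::real^'n. h (x \<bullet> x))"
proof (induction m arbitrary: h)
  case 0
  then have "continuous_on UNIV h" by simp
  then have "continuous_on UNIV (\<lambda>x::real^'n. h (x \<bullet> x))"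
    by (rule continuous_on_compose2) (auto intro!: continuous_intros)
  then show ?case by simp
next
  case (Suc m)
  then obtain h' where h': "\<And>t. (h has_vector_derivative h' t) (at t)" "CkR m h'" by auto
  have "pd i (\<lambda>x::real^'n. h (x \<bullet> x)) = (\<lambda>x. 2 * of_real (x $ i) * h' (x \<bullet> x))" for i
    by (intro ext pd_radial h')
  moreover have "(\<lambda>x::real^'n. h (x \<bullet> x)) differentiable (at x)" for x
    using has_derivative_radial[OF h'(1)] differentiableI by blast
  ultimately show ?case using Suc.IH[OF h'(2)]
    by (auto simp: differentiable_on_def intro!: Ck_mult Ck_coord)
qed

lemma smooth_radial: "(\<And>m. CkR m h) \<Longrightarrow> smooth (\<lambda>x::real^'n. h (x \<bullet> x))"
  unfolding smooth_def using Ck_radial by blast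

lemma has_vector_derivative_of_real_holomorphic:
  assumes "H holomorphic_on UNIV"
  shows "((\<lambda>t::real. H (of_real t)) has_vector_derivative deriv H (of_real t)) (at t)"
proof -
  have "(H has_field_derivative deriv H (of_real t)) (at (of_real t))"
    using assms holomorphic_derivI by blast
  then show ?thesis by (rule has_vector_derivative_real_field)
qed

lemma CkR_holomorphic: "H holomorphic_on UNIV \<Longrightarrow> CkR m (\<lambda>t. H (of_real t))"
proof (induction m arbitrary: H)
  case 0
  have "continuous_on UNIV (\<lambda>t::real. H (of_real t))"
    by (rule continuous_on_compose2[OF holomorphic_on_imp_continuous_on[OF 0]]) (auto intro!: continuous_intros)
  then show ?case by simp
next
  case (Suc m)
  then show ?case
    using has_vector_derivative_of_real_holomorphic[of H] holomorphic_deriv[of H UNIV]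
    by (auto intro!: exI[of _ "\<lambda>t. deriv H (of_real t)"])
qed

text \<open>The entire function with \<open>z \<mapsto> sin (k z) / z\<close> as its value at \<open>z\<^sup>2\<close>.\<close>

definition spherical_entire :: "complex \<Rightarrow> complex \<Rightarrow> complex" where
  "spherical_entire k z = (\<Sum>m. (- 1) ^ m * k ^ (2 * m + 1) / fact (2 * m + 1) * z ^ m)"

text \<open>The sine series grouped in pairs: even coefficients vanish, and an odd power of
  \<open>z\<close> is a power of \<open>z^2\<close> times \<open>z\<close>.\<close>

lemma spherical_entire_sums:
  fixes k z :: complex
  shows "(\<lambda>m. ((- 1) ^ m * k ^ (2 * m + 1) / fact (2 * m + 1) * (z\<^sup>2) ^ m) * z) sums sin (k * z)"
proof -
  have "(\<lambda>n. \<Sum>i = n * 2..<n * 2 + 2. sin_coeff i *\<^sub>R (k * z) ^ i) sums sin (k * z)"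
    by (rule sums_group[OF sin_converges]) simp
  moreover have "(\<Sum>i = n * 2..<n * 2 + 2. sin_coeff i *\<^sub>R (k * z) ^ i)
      = ((- 1) ^ n * k ^ (2 * n + 1) / fact (2 * n + 1) * (z\<^sup>2) ^ n) * z" for n
  proof -
    have "{n * 2..<n * 2 + 2} = {2 * n, 2 * n + 1}" by auto
    then show ?thesis
      by (simp add: sin_coeff_def scaleR_conv_of_real power_mult_distrib power_mult[symmetric] mult_ac)
  qed
  ultimately show ?thesis by simp
qed

text \<open>Every argument is a square, so convergence is inherited from the sine series after
  removing the factor \<open>csqrt z\<close>; only \<open>z = 0\<close> is separate.\<close>

lemma spherical_entire_summable:
  fixes k z :: complex
  shows "summable (\<lambda>m. (- 1) ^ m * k ^ (2 * m + 1) / fact (2 * m + 1) * z ^ m)"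
proof (cases "z = 0")
  case False
  have "summable (\<lambda>m. ((- 1) ^ m * k ^ (2 * m + 1) / fact (2 * m + 1) * ((csqrt z)\<^sup>2) ^ m) * csqrt z)"
    using spherical_entire_sums[of k "csqrt z"] by (rule sums_summable)
  then show ?thesis 
    unfolding mult.commute[of _ "csqrt z"] using False by (simp only: summable_cmult_iff power2_csqrt csqrt_eq_0) simp
qed (simp only: summable_zero_power')

lemma spherical_entire_mult: "spherical_entire k (z\<^sup>2) * z = sin (k * z)"
  using sums_unique[OF spherical_entire_sums[of k z]]
  unfolding spherical_entire_def by (subst suminf_mult2[OF spherical_entire_summable]) simp

lemma spherical_entire_holomorphic: "spherical_entire k holomorphic_on UNIV"
proof -
  have "(spherical_entire k has_field_derivative (\<Sum>m. diffs (\<lambda>m. (- 1) ^ m * k ^ (2 * m + 1) / fact (2 * m + 1)) m * z ^ m)) (at z)" for z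
    unfolding spherical_entire_def[abs_def]
    by (rule termdiffs_strong'[where K = "norm z + 1"]) (rule spherical_entire_summable, simp)
  then show ?thesis by (auto simp: holomorphic_on_def field_differentiable_def)
qed

text \<open>Both sides are the derivative of
  \<open>z * spherical_entire k (z^2) = sin (k * z)\<close>.\<close>

lemma spherical_entire_deriv:
  "2 * z\<^sup>2 * deriv (spherical_entire k) (z\<^sup>2) + spherical_entire k (z\<^sup>2) = k * cos (k * z)"
proof -
  have d: "(spherical_entire k has_field_derivative deriv (spherical_entire k) w) (at w)" for w
    using spherical_entire_holomorphic holomorphic_derivI by blast
  have "((\<lambda>z. spherical_entire k (z\<^sup>2) * z) has_field_derivative
      2 * z\<^sup>2 * deriv (spherical_entire k) (z\<^sup>2) + spherical_entire k (z\<^sup>2)) (at z)"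
    by (auto intro!: derivative_eq_intros DERIV_chain2[OF d] simp: power2_eq_square)
  moreover have "((\<lambda>z. sin (k * z)) has_field_derivative k * cos (k * z)) (at z)"
    by (auto intro!: derivative_eq_intros)
  ultimately show ?thesis unfolding spherical_entire_mult by (rule DERIV_unique)
qed

text \<open>The radial Helmholtz equation of dimension 3 in the variable
  \<open>s = \<bar>x\<bar>^2\<close>. Differentiating \<open>spherical_entire_deriv\<close> once
  more yields it multiplied by \<open>z\<close>, hence for \<open>s \<noteq> 0\<close>; the origin
  follows by continuity.\<close>

lemma spherical_entire_ode:
  "4 * s * deriv (deriv (spherical_entire k)) s + 6 * deriv (spherical_entire k) s = - (k\<^sup>2 * spherical_entire k s)"
proof -
  let ?H = "spherical_entire k"
  have h: "?H holomorphic_on UNIV" "deriv ?H holomorphic_on UNIV" "deriv (deriv ?H) holomorphic_on UNIV"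
    by (auto intro!: spherical_entire_holomorphic holomorphic_deriv)
  have d: "(?H has_field_derivative deriv ?H w) (at w)" "(deriv ?H has_field_derivative deriv (deriv ?H) w) (at w)" for w
    using h holomorphic_derivI by blast+
  define F where "F s = 4 * s * deriv (deriv ?H) s + 6 * deriv ?H s + k\<^sup>2 * ?H s" for s
  have "F s = 0" if "s \<in> - {0}" for s
  proof -
    define z where "z = csqrt s"
    have z: "z\<^sup>2 = s" "z \<noteq> 0" using that by (auto simp: z_def)
    have "((\<lambda>z. 2 * z\<^sup>2 * deriv ?H (z\<^sup>2) + ?H (z\<^sup>2)) has_field_derivative
        4 * z * deriv ?H (z\<^sup>2) + 2 * z\<^sup>2 * (deriv (deriv ?H) (z\<^sup>2) * (2 * z)) + deriv ?H (z\<^sup>2) * (2 * z)) (at z)"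
      by (auto intro!: derivative_eq_intros DERIV_chain2[OF d(1)] DERIV_chain2[OF d(2)] simp: power2_eq_square algebra_simps)
    moreover have "((\<lambda>z. k * cos (k * z)) has_field_derivative - (k\<^sup>2 * sin (k * z))) (at z)"
      by (auto intro!: derivative_eq_intros simp: power2_eq_square)
    ultimately have "4 * z * deriv ?H (z\<^sup>2) + 2 * z\<^sup>2 * (deriv (deriv ?H) (z\<^sup>2) * (2 * z)) + deriv ?H (z\<^sup>2) * (2 * z) = - (k\<^sup>2 * sin (k * z))"
      unfolding spherical_entire_deriv by (rule DERIV_unique)
    moreover have "z * F (z\<^sup>2) = 4 * z * deriv ?H (z\<^sup>2) + 2 * z\<^sup>2 * (deriv (deriv ?H) (z\<^sup>2) * (2 * z)) + deriv ?H (z\<^sup>2) * (2 * z) + k\<^sup>2 * (?H (z\<^sup>2) * z)"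
      unfolding F_def by (simp add: algebra_simps)
    ultimately have "z * F (z\<^sup>2) = 0" unfolding spherical_entire_mult by simp
    then show ?thesis using z by simp
  qed
  moreover have "continuous_on (closure (- {0})) F"
    unfolding F_def by (intro continuous_intros continuous_on_subset[OF holomorphic_on_imp_continuous_on[OF h(1)]] 
     continuous_on_subset[OF holomorphic_on_imp_continuous_on[OF h(2)]] continuous_on_subset[OF holomorphic_on_imp_continuous_on[OF h(3)]]) auto
  ultimately have "F s = 0" if "s \<in> closure (- {0})" for s
    using continuous_constant_on_closure[of "- {0}" F 0 s] that by blast
  then have "F s = 0" by (simp add: closure_complement)
  then show ?thesis by (simp add: F_def add_eq_0_iff algebra_simps)
qed

text \<open>This is \<open>sin (k r) / r\<close> with \<open>r = norm x\<close>, the zeroth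
  spherical Bessel function up to scaling, smooth across the origin.\<close>

definition spherical_wave :: "complex \<Rightarrow> real^'n \<Rightarrow> complex" where
  "spherical_wave k x = spherical_entire k (of_real (x \<bullet> x))"

lemma smooth_spherical_wave: "smooth (spherical_wave k)"
  unfolding spherical_wave_def[abs_def]
  by (intro smooth_radial[of "\<lambda>t. spherical_entire k (of_real t)"] CkR_holomorphic spherical_entire_holomorphic)

lemma pd_spherical_wave:
  "pd i (spherical_wave k) x = 2 * of_real (x $ i) * deriv (spherical_entire k) (of_real (x \<bullet> x))"
  unfolding spherical_wave_def[abs_def]
  by (intro pd_radial[of "\<lambda>t. spherical_entire k (of_real t)"] has_vector_derivative_of_real_holomorphic spherical_entire_holomorphic)

lemma laplacian_spherical_wave:
  fixes x :: "real^3"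
  shows "laplacian (spherical_wave k) x = - (k\<^sup>2 * spherical_wave k x)"
proof -
  let ?H = "spherical_entire k"
  have h: "deriv ?H holomorphic_on UNIV" by (auto intro!: spherical_entire_holomorphic holomorphic_deriv)
  have "pd i (pd i (spherical_wave k)) x = 2 * deriv ?H (of_real (x \<bullet> x)) + 4 * (of_real (x $ i))\<^sup>2 * deriv (deriv ?H) (of_real (x \<bullet> x))" for i
  proof -
    have 1: "pd i (spherical_wave k) = (\<lambda>x. 2 * of_real (x $ i) * deriv ?H (of_real (x \<bullet> x)))"
      by (rule ext) (rule pd_spherical_wave)
    have v: "((\<lambda>t. deriv ?H (of_real t)) has_vector_derivative deriv (deriv ?H) (of_real t)) (at t)" for t
      by (intro has_vector_derivative_of_real_holomorphic h)
    have 2: "smooth (\<lambda>x::real^3. 2 * complex_of_real (x $ i))" by (intro smooth_mult smooth_coord) simp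
    have 3: "smooth (\<lambda>x::real^3. deriv ?H (of_real (x \<bullet> x)))"
      by (intro smooth_radial[of "\<lambda>t. deriv ?H (of_real t)"] CkR_holomorphic h)
    have 4: "pd i (\<lambda>x::real^3. 2 * complex_of_real (x $ i)) x = 2"
      using pd_mult[of "\<lambda>_. 2" x "\<lambda>x. complex_of_real (x $ i)" i] smooth_coord[of i, THEN smooth_differentiable]
      by (simp add: pd_coord)
    show ?thesis unfolding 1 pd_mult[OF smooth_differentiable[OF 2] smooth_differentiable[OF 3]] 4 pd_radial[OF v]
      by (simp add: power2_eq_square)
  qed
  \<comment> \<open>Here the dimension enters: the coefficient 6 is twice the number of coordinates,
    as in \<open>spherical_entire_ode\<close>.\<close>
  then have "laplacian (spherical_wave k) x = 6 * deriv ?H (of_real (x \<bullet> x)) + 4 * (\<Sum>i\<in>UNIV. (of_real (x $ i))\<^sup>2) * deriv (deriv ?H) (of_real (x \<bullet> x))"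
    unfolding laplacian_def by (simp add: sum.distrib sum_distrib_left sum_distrib_right)
  also have "(\<Sum>i\<in>UNIV. (complex_of_real (x $ i))\<^sup>2) = of_real (x \<bullet> x)"
    by (simp add: inner_vec_def power2_eq_square)
  also have "6 * deriv ?H (of_real (x \<bullet> x)) + 4 * of_real (x \<bullet> x) * deriv (deriv ?H) (of_real (x \<bullet> x)) = - (k\<^sup>2 * spherical_wave k x)"
    using spherical_entire_ode[of "of_real (x \<bullet> x)" k] by (simp add: spherical_wave_def add.commute)
  finally show ?thesis .
qed

section \<open>Integration by parts on the unit ball\<close>

lemma difference_quotient_tendsto:
  fixes f :: "real \<Rightarrow> complex"
  assumes "(f has_vector_derivative f') (at 0)"
  shows "(\<lambda>j. of_nat (Suc j) * (f (1 / real (Suc j)) - f 0)) \<longlonglongrightarrow> f'"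
proof -
  have "(\<lambda>h. norm (f (0 + h) - f 0 - h *\<^sub>R f') / norm h) \<midarrow>0\<rightarrow> 0"
    using assms unfolding has_vector_derivative_def has_derivative_at by blast
  moreover have "filterlim (\<lambda>j. 1 / real (Suc j)) (at 0) sequentially"
    unfolding filterlim_at using LIMSEQ_inverse_real_of_nat by (auto simp: inverse_eq_divide)
  ultimately have "(\<lambda>j. norm (f (0 + 1 / real (Suc j)) - f 0 - (1 / real (Suc j)) *\<^sub>R f') / norm (1 / real (Suc j))) \<longlonglongrightarrow> 0"
    by (rule filterlim_compose)
  moreover have "norm (f (0 + 1 / real (Suc j)) - f 0 - (1 / real (Suc j)) *\<^sub>R f') / norm (1 / real (Suc j))
      = norm (of_nat (Suc j) * (f (1 / real (Suc j)) - f 0) - f')" for j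
  proof -
    have "of_nat (Suc j) * (f (1 / real (Suc j)) - f 0) - f'
      = of_nat (Suc j) * (f (0 + 1 / real (Suc j)) - f 0 - (1 / real (Suc j)) *\<^sub>R f')"
      by (simp add: scaleR_conv_of_real right_diff_distrib del: of_nat_Suc)
    then show ?thesis by (simp only: norm_mult norm_of_nat) (simp add: field_simps del: of_nat_Suc)
  qed
  ultimately show ?thesis by (simp add: LIM_zero_iff tendsto_norm_zero_iff)
qed

text \<open>The mean value inequality turns the bound \<open>w\<close> on the derivative into a
  bound on all difference quotients, so dominated convergence applies along the sequence of steps
  \<open>1 / Suc j\<close>.\<close>

lemma integral_difference_quotient:
  fixes \<phi> :: "real \<Rightarrow> 'a \<Rightarrow> complex"
  assumes int: "\<And>t. 0 \<le> t \<Longrightarrow> t \<le> 1 \<Longrightarrow> integrable M (\<phi> t)"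
    and der: "\<And>t x. 0 \<le> t \<Longrightarrow> t \<le> 1 \<Longrightarrow> ((\<lambda>t. \<phi> t x) has_vector_derivative \<phi>' t x) (at t)"
    and meas: "\<phi>' 0 \<in> borel_measurable M"
    and w: "integrable M w" "\<And>t x. 0 \<le> t \<Longrightarrow> t \<le> 1 \<Longrightarrow> norm (\<phi>' t x) \<le> w x"
  shows "(\<lambda>j. of_nat (Suc j) * (integral\<^sup>L M (\<phi> (1 / real (Suc j))) - integral\<^sup>L M (\<phi> 0))) \<longlonglongrightarrow> integral\<^sup>L M (\<phi>' 0)"
proof -
  have "(\<lambda>j. integral\<^sup>L M (\<lambda>x. of_nat (Suc j) * (\<phi> (1 / real (Suc j)) x - \<phi> 0 x))) \<longlonglongrightarrow> integral\<^sup>L M (\<phi>' 0)"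
  proof (rule integral_dominated_convergence[where w = w])
    show "(\<lambda>x. of_nat (Suc j) * (\<phi> (1 / real (Suc j)) x - \<phi> 0 x)) \<in> borel_measurable M" for j
      using int[THEN borel_measurable_integrable] by (intro borel_measurable_times borel_measurable_diff) auto
    show "AE x in M. (\<lambda>j. of_nat (Suc j) * (\<phi> (1 / real (Suc j)) x - \<phi> 0 x)) \<longlonglongrightarrow> \<phi>' 0 x"
      by (intro always_eventually allI difference_quotient_tendsto der) auto
    show "AE x in M. norm (of_nat (Suc j) * (\<phi> (1 / real (Suc j)) x - \<phi> 0 x)) \<le> w x" for j
    proof (intro always_eventually allI)
      fix x
      define t where "t = 1 / real (Suc j)"
      have t: "0 < t" "t \<le> 1" "t * real (Suc j) = 1" by (auto simp: t_def)
      have "norm (\<phi> t x - \<phi> 0 x) \<le> w x * norm (t - 0)"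
      proof (rule differentiable_bound[where S = "{0..t}" and f = "\<lambda>t. \<phi> t x" and f' = "\<lambda>t h. h *\<^sub>R \<phi>' t x" and B = "w x" and x = t and y = 0])
        fix s assume s: "s \<in> {0..t}"
        have s01: "0 \<le> s" "s \<le> 1" using s t by simp_all
        show "((\<lambda>t. \<phi> t x) has_derivative (\<lambda>h. h *\<^sub>R \<phi>' s x)) (at s within {0..t})"
          by (rule has_derivative_at_withinI, rule der[OF s01, unfolded has_vector_derivative_def])
        show "onorm (\<lambda>h. h *\<^sub>R \<phi>' s x) \<le> w x"
        proof (rule onorm_bound)
          have wv: "norm (\<phi>' s x) \<le> w x" using w(2)[OF s01] .
          then show "0 \<le> w x" using norm_ge_zero[of "\<phi>' s x"] by linarith
          show "norm (h *\<^sub>R \<phi>' s x) \<le> w x * norm h" for h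
            using mult_right_mono[OF wv norm_ge_zero[of h]] by (simp add: mult.commute)
        qed
      qed (use t in auto)
      then have "norm (\<phi> t x - \<phi> 0 x) * real (Suc j) \<le> (w x * t) * real (Suc j)"
        using t by (intro mult_right_mono) auto
      then have "norm (\<phi> t x - \<phi> 0 x) * real (Suc j) \<le> w x"
        using t(3) by (simp only: mult.assoc mult_1_right)
      then show "norm (of_nat (Suc j) * (\<phi> (1 / real (Suc j)) x - \<phi> 0 x)) \<le> w x"
        by (simp only: norm_mult norm_of_nat t_def mult.commute)
    qed
  qed (use meas w in auto)
  then show ?thesis using int by (simp add: integral_diff)
qed

text \<open>The integral of \<open>\<psi> (x + t *\<^sub>R e)\<close> does not depend on
  \<open>t\<close> by translation invariance, so its derivative at 0 vanishes.\<close>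

lemma integral_pd_eq_0:
  fixes \<psi> :: "real^'n \<Rightarrow> complex"
  assumes C1: "Ck (Suc 0) \<psi>" and supp: "\<And>x. norm x > R \<Longrightarrow> \<psi> x = 0 \<and> pd i \<psi> x = 0"
  shows "integral\<^sup>L lborel (pd i \<psi>) = 0"
proof -
  define e where "e = (axis i 1 :: real^'n)"
  \<comment> \<open>One unit larger than the support, since shifts with \<open>t \<le> 1\<close> are
    to be dominated at once.\<close>
  define S where "S = cball (0::real^'n) (R + 1)"
  have cont: "continuous_on UNIV \<psi>" "continuous_on UNIV (pd i \<psi>)"
    using C1 Ck_continuous by (blast, auto)
  have "compact (pd i \<psi> ` S)" unfolding S_def
    by (intro compact_continuous_image continuous_on_subset[OF cont(2)]) auto
  then obtain C where C: "\<And>x. x \<in> S \<Longrightarrow> norm (pd i \<psi> x) \<le> C"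
    using compact_imp_bounded by (force simp: bounded_iff)
  have ne: "norm e = 1" by (simp add: e_def norm_axis_1)
  have intS: "integrable lborel (\<lambda>x. indicator (cball (0::real^'n) (R + 1)) x *\<^sub>R (\<bar>C\<bar> :: real))"
    by (intro integrable_scaleR_left integrable_real_indicator) (auto simp: emeasure_lborel_cball_finite[unfolded infinity_ennreal_def])
  have bd0: "norm (pd i \<psi> x) \<le> \<bar>C\<bar>" for x
  proof (cases "norm x \<le> R + 1")
    case True then show ?thesis using C[of x] by (auto simp: S_def)
  next
    case False then show ?thesis using supp[of x] by auto
  qed
  have bd: "norm (pd i \<psi> (x + t *\<^sub>R e)) \<le> indicator (cball (0::real^'n) (R + 1)) x *\<^sub>R \<bar>C\<bar>" if "0 \<le> t" "t \<le> 1" for t x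
  proof (cases "norm x \<le> R + 1")
    case True then show ?thesis using bd0 by (simp add: indicator_def)
  next
    case False
    have "norm x - norm (t *\<^sub>R e) \<le> norm (x + t *\<^sub>R e)" using norm_triangle_ineq2[of x "- (t *\<^sub>R e)"] by simp
    then have "norm (x + t *\<^sub>R e) > R" using False that ne by simp
    then show ?thesis using supp by (simp add: indicator_def)
  qed
  have intg: "integrable lborel (\<lambda>x. \<psi> (x + t *\<^sub>R e))" if "0 \<le> t" "t \<le> 1" for t
  proof -
    have "compact (\<psi> ` S)" unfolding S_def
      by (intro compact_continuous_image continuous_on_subset[OF cont(1)]) auto
    then obtain B where B: "\<And>x. x \<in> S \<Longrightarrow> norm (\<psi> x) \<le> B"
      using compact_imp_bounded by (force simp: bounded_iff)
    have "integrable lborel (\<lambda>x. indicator (cball (0::real^'n) (R + 1)) x *\<^sub>R (\<bar>B\<bar> :: real))"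
      by (intro integrable_scaleR_left integrable_real_indicator) (auto simp: emeasure_lborel_cball_finite[unfolded infinity_ennreal_def])
    then have "integrable lborel \<psi>"
    proof (rule Bochner_Integration.integrable_bound)
      show "\<psi> \<in> borel_measurable lborel" using cont(1) by (simp add: borel_measurable_continuous_onI)
      show "AE x in lborel. norm (\<psi> x) \<le> norm (indicator (cball (0::real^'n) (R + 1)) x *\<^sub>R \<bar>B\<bar>)"
      proof (intro always_eventually allI)
        fix x show "norm (\<psi> x) \<le> norm (indicator (cball (0::real^'n) (R + 1)) x *\<^sub>R \<bar>B\<bar>)"
          using B[of x] supp[of x] by (cases "norm x \<le> R + 1") (auto simp: S_def indicator_def)
      qed
    qed
    then have "integrable (distr lborel borel ((+) (t *\<^sub>R e))) \<psi>" by (simp add: lborel_distr_plus)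
    then have "integrable lborel (\<lambda>x. \<psi> (t *\<^sub>R e + x))" by (subst (asm) integrable_distr_eq) (use cont(1) in \<open>auto intro: borel_measurable_continuous_onI\<close>)
    then show ?thesis by (simp add: add.commute)
  qed
  have "(\<lambda>j. of_nat (Suc j) * (integral\<^sup>L lborel (\<lambda>x. \<psi> (x + (1 / real (Suc j)) *\<^sub>R e)) - integral\<^sup>L lborel (\<lambda>x. \<psi> (x + 0 *\<^sub>R e)))) 
     \<longlonglongrightarrow> integral\<^sup>L lborel (\<lambda>x. pd i \<psi> (x + 0 *\<^sub>R e))"
  proof (rule integral_difference_quotient[OF intg _ _ intS bd])
    fix t x
    have "((\<lambda>t. x + t *\<^sub>R e) has_derivative (\<lambda>h. h *\<^sub>R e)) (at t)" by (auto intro!: derivative_eq_intros)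
    from has_derivative_compose[OF this differentiable_has_derivative[OF Ck_SucD[OF C1]]]
    have "((\<lambda>t. \<psi> (x + t *\<^sub>R e)) has_derivative (\<lambda>h. frechet_derivative \<psi> (at (x + t *\<^sub>R e)) (h *\<^sub>R e))) (at t)" .
    moreover have "linear (frechet_derivative \<psi> (at (x + t *\<^sub>R e)))"
      using Ck_SucD[OF C1] by (rule linear_frechet_derivative)
    ultimately show "((\<lambda>t. \<psi> (x + t *\<^sub>R e)) has_vector_derivative pd i \<psi> (x + t *\<^sub>R e)) (at t)"
      unfolding has_vector_derivative_def pd_def e_def by (simp add: linear_scale)
  qed (use cont(2) in \<open>auto intro: borel_measurable_continuous_onI\<close>)
  moreover have "integral\<^sup>L lborel (\<lambda>x. \<psi> (x + c)) = integral\<^sup>L lborel \<psi>" for c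
  proof -
    have "integral\<^sup>L (distr lborel borel ((+) c)) \<psi> = integral\<^sup>L lborel (\<lambda>x. \<psi> (c + x))"
      by (rule integral_distr) (use cont(1) in \<open>auto intro: borel_measurable_continuous_onI\<close>)
    then show ?thesis by (simp add: lborel_distr_plus add.commute)
  qed
  ultimately show ?thesis by (simp add: LIMSEQ_const_iff)
qed

section \<open>Smooth functions as members of the Sobolev spaces\<close>

abbreviation (input) unit_ball :: "(real^'n) set" where "unit_ball \<equiv> ball 0 1"

lemma lebesgue_on_ball_eq_lborel:
  fixes f :: "real^'n \<Rightarrow> complex"
  assumes "f \<in> borel_measurable borel"
  shows "integral\<^sup>L (lebesgue_on unit_ball) f = integral\<^sup>L lborel (\<lambda>x. indicator unit_ball x *\<^sub>R f x)"
  using assms by (subst integral_restrict_space) (auto intro!: integral_completion borel_measurable_scaleR borel_measurable_indicator)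

lemma finite_measure_ball: "finite_measure (lebesgue_on (unit_ball :: (real^'n) set))"
  by (intro finite_measure_lebesgue_on) auto

lemma integrable_on_ballI:
  fixes f :: "real^'n \<Rightarrow> 'b::{banach, second_countable_topology}"
  assumes "f \<in> borel_measurable (lebesgue_on unit_ball)" "\<And>x. norm x < 1 \<Longrightarrow> norm (f x) \<le> C"
  shows "integrable (lebesgue_on unit_ball) f"
proof -
  interpret finite_measure "lebesgue_on (unit_ball :: (real^'n) set)" by (rule finite_measure_ball)
  show ?thesis by (rule integrable_const_bound[of _ C]) (use assms in \<open>auto intro!: AE_I2\<close>)
qed

lemma borel_measurable_on_ball:
  "f \<in> borel_measurable borel \<Longrightarrow> f \<in> borel_measurable (lebesgue_on unit_ball)"
  by (intro measurable_restrict_space1 measurable_completion) auto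

lemma continuous_bounded_on_ball:
  fixes f :: "real^'n \<Rightarrow> 'b::real_normed_vector"
  assumes "continuous_on UNIV f"
  obtains C where "C \<ge> 0" "\<And>x. norm x \<le> 1 \<Longrightarrow> norm (f x) \<le> C"
proof -
  have "compact (f ` cball 0 1)" by (intro compact_continuous_image continuous_on_subset[OF assms]) auto
  then obtain C where C: "\<And>x. norm x \<le> 1 \<Longrightarrow> norm (f x) \<le> C"
    using compact_imp_bounded by (force simp: bounded_iff)
  have "C \<ge> 0" using C[of 0] norm_ge_zero[of "f 0"] by (metis norm_zero order_trans zero_le_one)
  then show ?thesis using C by (rule that)
qed

lemma L2_ballI:
  fixes f :: "real^'n \<Rightarrow> complex"
  assumes "f \<in> borel_measurable (lebesgue_on unit_ball)" "\<And>x. norm x < 1 \<Longrightarrow> norm (f x) \<le> C"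
  shows "f \<in> L2 (lebesgue_on unit_ball)"
proof -
  have "norm ((cmod (f x))\<^sup>2) \<le> C\<^sup>2" if "norm x < 1" for x
    using assms(2)[OF that] by (simp add: power_mono)
  then have "integrable (lebesgue_on unit_ball) (\<lambda>x. (cmod (f x))\<^sup>2)"
    using assms(1) by (intro integrable_on_ballI) auto
  then show ?thesis using assms(1) by (simp add: L2_def)
qed

lemma smooth_borel: "smooth f \<Longrightarrow> f \<in> borel_measurable borel"
  by (intro borel_measurable_continuous_onI smooth_continuous)

lemma smooth_measurable_ball: "smooth f \<Longrightarrow> f \<in> borel_measurable (lebesgue_on unit_ball)"
  by (intro borel_measurable_on_ball smooth_borel)

lemma smooth_bounded:
  assumes "smooth (f :: real^'n \<Rightarrow> complex)"
  obtains C where "C \<ge> 0" "\<And>x. norm x \<le> 1 \<Longrightarrow> norm (f x) \<le> C"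
  using continuous_bounded_on_ball[OF smooth_continuous[OF assms]] by blast

lemma smooth_L2: "smooth f \<Longrightarrow> f \<in> L2 (lebesgue_on unit_ball)"
  by (metis L2_ballI less_imp_le smooth_bounded smooth_measurable_ball)

lemma smooth_integrable: "smooth f \<Longrightarrow> integrable (lebesgue_on unit_ball) f"
  by (metis integrable_on_ballI less_imp_le smooth_bounded smooth_measurable_ball)

lemma compact_closed_subset:
  fixes A :: "'a::t2_space set"
  assumes "compact B" "closed A" "A \<subseteq> B" shows "compact A"
  using compact_Int_closed[OF assms(1,2)] assms(3) by (simp add: inf.absorb2)

lemma pd_outside_support:
  assumes "x \<notin> closure {x. \<phi> x \<noteq> 0}" shows "pd i \<phi> x = 0"
proof -
  have z: "((\<lambda>_. 0) has_derivative (\<lambda>_. 0)) (at x)" by simp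
  have eq: "0 = \<phi> y" if "y \<in> - closure {x. \<phi> x \<noteq> 0}" for y
    using that closure_subset[of "{x. \<phi> x \<noteq> 0}"] by auto
  have "(\<phi> has_derivative (\<lambda>_. 0)) (at x)"
    by (rule has_derivative_transform_within_open[OF z open_Compl[OF closed_closure] _ eq]) (use assms in auto)
  then show ?thesis using pd_eqI[of \<phi> "\<lambda>_. 0" x i] by simp
qed

lemma test_fun_pd:
  assumes "test_fun D \<phi>" shows "test_fun D (pd i \<phi>)"
proof -
  have "closure {x. pd i \<phi> x \<noteq> 0} \<subseteq> closure {x. \<phi> x \<noteq> 0}"
    using pd_outside_support by (intro closure_minimal) auto
  then show ?thesis using assms smooth_pd[of \<phi> i] compact_closed_subset[OF _ closed_closure]
    unfolding test_fun_def by blast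
qed

lemma test_fun_mult:
  assumes "smooth f" "test_fun D \<phi>" shows "test_fun D (\<lambda>x. f x * \<phi> x)"
proof -
  have "closure {x. f x * \<phi> x \<noteq> 0} \<subseteq> closure {x. \<phi> x \<noteq> 0}"
    by (intro closure_mono) auto
  then show ?thesis using assms smooth_mult[of f \<phi>] compact_closed_subset[OF _ closed_closure]
    unfolding test_fun_def by blast
qed

lemma test_fun_smooth: "test_fun D \<phi> \<Longrightarrow> smooth \<phi>" by (simp add: test_fun_def)

lemma integral_pd_test_fun:
  assumes "test_fun unit_ball \<psi>" shows "integral\<^sup>L (lebesgue_on unit_ball) (pd i \<psi>) = 0"
proof -
  have out: "\<psi> x = 0 \<and> pd i \<psi> x = 0" if "\<not> norm x < 1" for x
  proof -
    have "x \<notin> closure {x. \<psi> x \<noteq> 0}" using assms that by (auto simp: test_fun_def)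
    moreover from this have "\<psi> x = 0" using closure_subset[of "{x. \<psi> x \<noteq> 0}"] by auto
    ultimately show ?thesis using pd_outside_support[of x \<psi>] by simp
  qed
  have sm: "smooth \<psi>" using assms by (simp add: test_fun_def)
  have "integral\<^sup>L (lebesgue_on unit_ball) (pd i \<psi>) = integral\<^sup>L lborel (\<lambda>x. indicator unit_ball x *\<^sub>R pd i \<psi> x)"
    by (intro lebesgue_on_ball_eq_lborel smooth_borel smooth_pd sm)
  also have "(\<lambda>x. indicator unit_ball x *\<^sub>R pd i \<psi> x) = pd i \<psi>"
    using out by (auto simp: indicator_def fun_eq_iff)
  also have "integral\<^sup>L lborel (pd i \<psi>) = 0"
    by (rule integral_pd_eq_0[of _ 1]) (use sm out in \<open>auto simp: smooth_def simp del: Ck.simps\<close>)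
  finally show ?thesis .
qed

text \<open>The product rule applied to \<open>f * \<phi>\<close>, which is itself a test function
  and so has a derivative of integral 0.\<close>

lemma weak_pd_smooth:
  assumes "smooth f" shows "weak_pd unit_ball i f (pd i f)"
  unfolding weak_pd_def
proof (intro allI impI)
  fix \<phi> :: "real^'a \<Rightarrow> complex" assume t: "test_fun unit_ball \<phi>"
  note sm = assms test_fun_smooth[OF t]
  have "0 = integral\<^sup>L (lebesgue_on unit_ball) (pd i (\<lambda>x. f x * \<phi> x))"
    using integral_pd_test_fun[OF test_fun_mult[OF assms t]] by simp
  also have "pd i (\<lambda>x. f x * \<phi> x) = (\<lambda>x. f x * pd i \<phi> x + pd i f x * \<phi> x)"
    by (intro ext pd_mult sm[THEN smooth_differentiable])
  also have "integral\<^sup>L (lebesgue_on unit_ball) \<dots> = (\<integral>x. f x * pd i \<phi> x \<partial>lebesgue_on unit_ball) + (\<integral>x. pd i f x * \<phi> x \<partial>lebesgue_on unit_ball)"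
    by (intro Bochner_Integration.integral_add smooth_integrable smooth_mult smooth_pd sm)
  finally show "(\<integral>x. f x * pd i \<phi> x \<partial>lebesgue_on unit_ball) = - (\<integral>x. pd i f x * \<phi> x \<partial>lebesgue_on unit_ball)"
    by (simp add: eq_neg_iff_add_eq_0)
qed

lemma weak_laplacian_smooth:
  assumes "smooth f" shows "weak_laplacian unit_ball f (laplacian f)"
  unfolding weak_laplacian_def
proof (intro allI impI)
  fix \<phi> :: "real^'a \<Rightarrow> complex" assume t: "test_fun unit_ball \<phi>"
  note sm = assms test_fun_smooth[OF t]
  have 1: "(\<integral>x. f x * pd i (pd i \<phi>) x \<partial>lebesgue_on unit_ball) = (\<integral>x. pd i (pd i f) x * \<phi> x \<partial>lebesgue_on unit_ball)" for i
    using weak_pd_smooth[OF sm(1), of i] weak_pd_smooth[OF smooth_pd[OF sm(1)], of i i] t test_fun_pd[OF t, of i]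
    unfolding weak_pd_def by simp
  have "(\<integral>x. f x * laplacian \<phi> x \<partial>lebesgue_on unit_ball) = (\<Sum>i\<in>UNIV. (\<integral>x. f x * pd i (pd i \<phi>) x \<partial>lebesgue_on unit_ball))"
    unfolding laplacian_def sum_distrib_left
    by (intro Bochner_Integration.integral_sum smooth_integrable smooth_mult smooth_pd sm)
  also have "\<dots> = (\<integral>x. laplacian f x * \<phi> x \<partial>lebesgue_on unit_ball)"
    unfolding laplacian_def sum_distrib_right 1
    by (intro Bochner_Integration.integral_sum[symmetric] smooth_integrable smooth_mult smooth_pd sm)
  finally show "(\<integral>x. f x * laplacian \<phi> x \<partial>lebesgue_on unit_ball) = (\<integral>x. laplacian f x * \<phi> x \<partial>lebesgue_on unit_ball)" .
qed

lemma smooth_H1: "smooth f \<Longrightarrow> f \<in> H1 unit_ball"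
  unfolding H1_def using smooth_L2 weak_pd_smooth smooth_pd by blast

lemma smooth_H2: "smooth f \<Longrightarrow> f \<in> H2 unit_ball"
  unfolding H2_def using smooth_L2 weak_pd_smooth smooth_pd smooth_H1 by blast

lemma L2_tendsto_const: "f \<in> L2 M \<Longrightarrow> L2_tendsto M (\<lambda>j. f) f"
  by (simp add: L2_tendsto_def)

lemma H1_tendsto_smooth_const: "smooth f \<Longrightarrow> H1_tendsto unit_ball (\<lambda>j. f) f"
  unfolding H1_tendsto_def using L2_tendsto_const smooth_L2 weak_pd_smooth smooth_pd by blast

section \<open>Cutoff functions\<close>

text \<open>The family is closed under differentiation up to linear combinations.\<close>

definition flat :: "nat \<Rightarrow> real \<Rightarrow> real" where
  "flat m t = (if t > 0 then exp (- (1 / t)) / t ^ m else 0)"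

lemma flat_nonneg: "0 \<le> flat m t" by (simp add: flat_def)

lemma flat_has_real_derivative:
  "(flat m has_real_derivative (flat (m + 2) t - real m * flat (m + 1) t)) (at t)"
proof (cases t "0::real" rule: linorder_cases)
  case less
  have "(flat m has_real_derivative 0) (at t)"
    by (rule has_field_derivative_transform_within_open[where f = "\<lambda>_. 0" and S = "{..<0}"]) (use less in \<open>auto simp: flat_def\<close>)
  then show ?thesis using less by (simp add: flat_def)
next
  case equal
  have "((\<lambda>h. flat m h / h) \<longlongrightarrow> 0) (at_right 0)"
  proof -
    \<comment> \<open>The only delicate point is 0 from the right; with \<open>x = 1 / h\<close> the
      difference quotient is a power against the exponential.\<close>
    have "((\<lambda>x. x ^ Suc m / exp x) \<longlongrightarrow> (0::real)) at_top" by (rule tendsto_power_div_exp_0)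
    then have "((\<lambda>h. inverse h ^ Suc m / exp (inverse h)) \<longlongrightarrow> (0::real)) (at_right 0)"
      by (rule filterlim_compose[OF _ filterlim_inverse_at_top_right])
    then show ?thesis
    proof (rule Lim_transform_eventually)
      show "\<forall>\<^sub>F h in at_right 0. inverse h ^ Suc m / exp (inverse h) = flat m h / h"
        using eventually_at_right_less[of 0]
        by eventually_elim (simp add: flat_def field_simps power_inverse exp_minus inverse_eq_divide)
    qed
  qed
  moreover have "((\<lambda>h. flat m h / h) \<longlongrightarrow> 0) (at_left 0)"
  proof (rule Lim_transform_eventually[OF tendsto_const])
    show "\<forall>\<^sub>F h in at_left 0. 0 = flat m h / h"
      using eventually_at_left_real[of "-1" 0] by (auto simp: flat_def elim!: eventually_mono)
  qed
  ultimately have "((\<lambda>h. flat m h / h) \<longlongrightarrow> 0) (at 0)" by (intro filterlim_split_at)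
  then have "(flat m has_real_derivative 0) (at 0)"
    unfolding has_field_derivative_iff by (simp add: flat_def)
  then show ?thesis using equal by (simp add: flat_def)
next
  case greater
  have "((\<lambda>t. exp (- (1 / t)) / t ^ m) has_real_derivative (flat (m + 2) t - real m * flat (m + 1) t)) (at t)"
  proof -
    have e: "((\<lambda>t. exp (- (1 / t))) has_real_derivative exp (- (1 / t)) / t\<^sup>2) (at t)"
      using greater by (auto intro!: derivative_eq_intros simp: power2_eq_square)
    have "real m * t ^ (m - 1) = real m * t ^ m / t" using greater by (cases m) auto
    then have "(exp (- (1 / t)) / t\<^sup>2 * t ^ m - exp (- (1 / t)) * (real m * t ^ (m - 1))) / (t ^ m * t ^ m)
        = flat (m + 2) t - real m * flat (m + 1) t"
      using greater by (simp only:) (simp add: flat_def field_simps power2_eq_square)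
    moreover have "((\<lambda>t. t ^ m) has_real_derivative real m * t ^ (m - 1)) (at t)" using DERIV_pow[of m t] by simp
    ultimately show ?thesis using DERIV_divide[OF e, of "\<lambda>t. t ^ m" "real m * t ^ (m - 1)"] greater by simp
  qed
  then show ?thesis
    by (rule has_field_derivative_transform_within_open[where S = "{0<..}"]) (use greater in \<open>auto simp: flat_def\<close>)
qed

lemma flat_0_le: "flat 0 t \<le> 1" by (simp add: flat_def)

text \<open>With \<open>u = 1 / t\<close> the two quantities are \<open>u^2 / exp u\<close> and
  \<open>(u + u^2) / exp u\<close>, controlled by the quadratic Taylor bound. The factor
  \<open>t + 1\<close> is \<open>j * (1 - x \<bullet> x)\<close> in the cutoffs below.\<close>

lemma flat_2_bounds: "flat 2 t \<le> 2" "(t + 1) * flat 2 t \<le> 3"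
proof -
  have "flat 2 t \<le> 2 \<and> (t + 1) * flat 2 t \<le> 3"
  proof (cases "t > 0")
    case True
    define u where "u = 1 / t"
    have u: "u > 0" "t * u = 1" using True by (auto simp: u_def)
    have f: "flat 2 t = u\<^sup>2 / exp u" using True by (simp add: flat_def u_def exp_minus power_divide field_simps)
    have e: "1 + u + u\<^sup>2 / 2 \<le> exp u" using u by (intro exp_lower_Taylor_quadratic) auto
    have "u\<^sup>2 / exp u \<le> 2" using e u by (simp add: divide_simps)
    moreover have "(t + 1) * (u\<^sup>2 / exp u) = (u + u\<^sup>2) / exp u" using u by (simp add: algebra_simps power2_eq_square add_divide_distrib)
    moreover have "(u + u\<^sup>2) / exp u \<le> 3" using e u exp_gt_zero[of u] by (simp only: pos_divide_le_eq)
    ultimately show ?thesis unfolding f by simp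
  qed (simp add: flat_def)
  then show "flat 2 t \<le> 2" "(t + 1) * flat 2 t \<le> 3" by auto
qed

lemma flat_0_at_top: "(flat 0 \<longlongrightarrow> 1) at_top"
proof (rule Lim_transform_eventually)
  show "((\<lambda>t::real. exp (- (1 / t))) \<longlongrightarrow> 1) at_top" by real_asymp
  show "\<forall>\<^sub>F t in at_top. exp (- (1 / t)) = flat 0 t"
    using eventually_gt_at_top[of 0] by eventually_elim (simp add: flat_def)
qed

lemma flat_2_at_top: "((\<lambda>t. (t + 1) * flat 2 t) \<longlongrightarrow> 0) at_top"
proof (rule Lim_transform_eventually)
  show "((\<lambda>t::real. (t + 1) * (exp (- (1 / t)) / t ^ 2)) \<longlongrightarrow> 0) at_top" by real_asymp
  show "\<forall>\<^sub>F t in at_top. (t + 1) * (exp (- (1 / t)) / t ^ 2) = (t + 1) * flat 2 t"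
    using eventually_gt_at_top[of 0] by eventually_elim (simp add: flat_def)
qed

lemma continuous_flat: "continuous_on S (flat m)"
  using flat_has_real_derivative DERIV_isCont continuous_at_imp_continuous_on by blast

lemma flat_affine_has_vector_derivative:
  "((\<lambda>t. complex_of_real (flat m (c * (1 - t) - 1))) has_vector_derivative
     of_real (- c) * of_real (flat (m + 2) (c * (1 - t) - 1)) + of_real (c * real m) * of_real (flat (m + 1) (c * (1 - t) - 1))) (at t)"
proof -
  have "((\<lambda>t. c * (1 - t) - 1) has_real_derivative - c) (at t)" by (auto intro!: derivative_eq_intros)
  from DERIV_chain2[OF flat_has_real_derivative this]
  have "((\<lambda>t. flat m (c * (1 - t) - 1)) has_real_derivative
     - c * flat (m + 2) (c * (1 - t) - 1) + c * real m * flat (m + 1) (c * (1 - t) - 1)) (at t)"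
    by (simp add: algebra_simps)
  from has_vector_derivative_of_real[OF this] show ?thesis by simp
qed

lemma CkR_flat_affine: "CkR k (\<lambda>t. complex_of_real (flat m (c * (1 - t) - 1)))"
proof (induction k arbitrary: m)
  case 0
  have "continuous_on UNIV (\<lambda>t::real. flat m (c * (1 - t) - 1))"
    by (rule continuous_on_compose2[OF continuous_flat[of UNIV m]]) (auto intro!: continuous_intros)
  then show ?case by (auto intro!: continuous_intros)
next
  case (Suc k)
  show ?case unfolding CkR.simps(2)
    by (intro exI conjI allI, rule flat_affine_has_vector_derivative) (intro CkR_add CkR_cmult Suc)
qed

text \<open>The shift by 1 makes the cutoff vanish where
  \<open>j * (1 - x \<bullet> x) \<le> 1\<close>, so its support is compact in the open ball; at
  each interior point the argument tends to infinity and the value to 1.\<close>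

definition cutoff :: "nat \<Rightarrow> real^'n \<Rightarrow> complex" where
  "cutoff j x = of_real (flat 0 (real j * (1 - x \<bullet> x) - 1))"

text \<open>The radial derivative of \<open>cutoff j\<close>, up to the factor \<open>- 2 |x|\<close>.\<close>

definition peak :: "nat \<Rightarrow> real^'n \<Rightarrow> real" where
  "peak j x = real j * flat 2 (real j * (1 - x \<bullet> x) - 1)"

lemma smooth_cutoff: "smooth (cutoff j)"
  unfolding cutoff_def[abs_def] by (intro smooth_radial[of "\<lambda>t. complex_of_real (flat 0 (real j * (1 - t) - 1))"] CkR_flat_affine)

lemma pd_cutoff: "pd i (cutoff j) x = - (2 * of_real (x $ i) * of_real (peak j x))"
  unfolding cutoff_def[abs_def] peak_def using pd_radial[OF flat_affine_has_vector_derivative[of 0 "real j" "x \<bullet> x"], of i]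
  by (simp add: numeral_2_eq_2)

lemma inner_self_less_1: "norm (x::real^'n) < 1 \<longleftrightarrow> x \<bullet> x < 1"
  by (simp add: norm_eq_sqrt_inner)

lemma test_fun_cutoff: "test_fun (unit_ball :: (real^'n) set) (cutoff j)"
proof -
  define S where "S = {x::real^'n. real j * (1 - x \<bullet> x) \<ge> 1}"
  have SB: "S \<subseteq> ball 0 1"
  proof
    fix x assume "x \<in> S"
    then have "real j * (1 - x \<bullet> x) > 0" by (simp add: S_def)
    then have "1 - x \<bullet> x > 0" by (simp add: zero_less_mult_iff)
    then show "x \<in> ball 0 1" by (simp add: inner_self_less_1)
  qed
  have "closed S" unfolding S_def by (intro closed_Collect_le continuous_intros)
  then have "compact S" using SB bounded_subset[OF bounded_ball] by (auto simp: compact_eq_bounded_closed)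
  have "closure {x. cutoff j x \<noteq> 0} \<subseteq> S"
    using \<open>closed S\<close> by (intro closure_minimal) (auto simp: S_def cutoff_def flat_def split: if_splits)
  moreover from this have "compact (closure {x::real^'n. cutoff j x \<noteq> 0})"
    by (rule compact_closed_subset[OF \<open>compact S\<close> closed_closure])
  ultimately show ?thesis unfolding test_fun_def using smooth_cutoff SB by (meson order_trans)
qed

lemma test_fun_smooth_cutoff: "smooth f \<Longrightarrow> test_fun unit_ball (\<lambda>x. f x * cutoff j x)"
  by (intro test_fun_mult test_fun_cutoff)

lemma cutoff_le: "cmod (cutoff j x) \<le> 1"
  using flat_nonneg flat_0_le by (simp add: cutoff_def)

lemma cutoff_tendsto:
  assumes "norm x < 1" shows "(\<lambda>j. cutoff j x) \<longlonglongrightarrow> 1"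
proof -
  have "filterlim (\<lambda>j. real j * (1 - x \<bullet> x) - 1) at_top sequentially"
    using assms by (auto simp: inner_self_less_1) real_asymp
  from filterlim_compose[OF flat_0_at_top this] have "(\<lambda>j. flat 0 (real j * (1 - x \<bullet> x) - 1)) \<longlonglongrightarrow> 1" .
  from tendsto_of_real[OF this] show ?thesis by (simp add: cutoff_def)
qed

lemma peak_nonneg: "0 \<le> peak j x" by (simp add: peak_def flat_nonneg)

text \<open>\<open>peak j\<close> is of order \<open>j\<close> in a boundary layer of thickness of
  order \<open>1 / j\<close>, like a smeared surface measure. Against a factor vanishing linearly at
  the sphere it stays bounded and, by \<open>peak_tendsto\<close>, disappears in the limit.\<close>

lemma peak_le: "peak j x * (1 - x \<bullet> x) \<le> 3"
  using flat_2_bounds(2)[of "real j * (1 - x \<bullet> x) - 1"] by (simp add: peak_def algebra_simps)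

lemma peak_tendsto:
  assumes "norm x < 1" shows "(\<lambda>j. peak j x * (1 - x \<bullet> x)) \<longlonglongrightarrow> 0"
proof -
  have "filterlim (\<lambda>j. real j * (1 - x \<bullet> x) - 1) at_top sequentially"
    using assms by (auto simp: inner_self_less_1) real_asymp
  from filterlim_compose[OF flat_2_at_top this] show ?thesis by (simp add: peak_def algebra_simps)
qed

lemma peak_borel [measurable]: "peak j \<in> borel_measurable borel"
proof -
  have "continuous_on UNIV (\<lambda>x::real^'n. flat 2 (real j * (1 - x \<bullet> x) - 1))"
    by (rule continuous_on_compose2[OF continuous_flat[of UNIV 2]]) (auto intro!: continuous_intros)
  then have "continuous_on UNIV (peak j :: real^'n \<Rightarrow> real)"
    unfolding peak_def[abs_def] by (intro continuous_intros)
  then show ?thesis by (rule borel_measurable_continuous_onI)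
qed

lemma peak_mult_tendsto:
  assumes "\<And>x. norm x < 1 \<Longrightarrow> cmod (E x) \<le> C * (1 - x \<bullet> x)" "norm x < 1"
  shows "(\<lambda>j. of_real (peak j x) * E x) \<longlonglongrightarrow> 0"
proof (rule Lim_null_comparison)
  show "(\<lambda>j. C * (peak j x * (1 - x \<bullet> x))) \<longlonglongrightarrow> 0" using tendsto_mult_right_zero[OF peak_tendsto[OF assms(2)]] .
  show "\<forall>\<^sub>F j in sequentially. norm (of_real (peak j x) * E x) \<le> C * (peak j x * (1 - x \<bullet> x))"
    using mult_left_mono[OF assms(1)[OF assms(2)] peak_nonneg[of _ x]]
    by (intro always_eventually) (simp add: norm_mult abs_of_nonneg[OF peak_nonneg] mult_ac)
qed

lemma peak_mult_le:
  assumes "\<And>x. norm x < 1 \<Longrightarrow> cmod (E x) \<le> C * (1 - x \<bullet> x)" "norm x < 1" "C \<ge> 0"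
  shows "cmod (of_real (peak j x) * E x) \<le> 3 * C"
proof -
  have "cmod (of_real (peak j x) * E x) \<le> peak j x * (C * (1 - x \<bullet> x))"
    using mult_left_mono[OF assms(1)[OF assms(2)] peak_nonneg] by (simp add: norm_mult abs_of_nonneg[OF peak_nonneg])
  also have "\<dots> = C * (peak j x * (1 - x \<bullet> x))" by simp
  also have "\<dots> \<le> C * 3" using assms(3) by (intro mult_left_mono peak_le)
  finally show ?thesis by simp
qed

lemma integral_ball_tendsto:
  fixes F :: "nat \<Rightarrow> real^'n \<Rightarrow> 'b::{banach, second_countable_topology}"
  assumes "\<And>j. F j \<in> borel_measurable (lebesgue_on unit_ball)" "f \<in> borel_measurable (lebesgue_on unit_ball)"
    "\<And>j x. norm x < 1 \<Longrightarrow> norm (F j x) \<le> C" "\<And>x. norm x < 1 \<Longrightarrow> (\<lambda>j. F j x) \<longlonglongrightarrow> f x"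
  shows "(\<lambda>j. integral\<^sup>L (lebesgue_on unit_ball) (F j)) \<longlonglongrightarrow> integral\<^sup>L (lebesgue_on unit_ball) f"
proof (rule integral_dominated_convergence[where w = "\<lambda>_. C"])
  interpret finite_measure "lebesgue_on (unit_ball :: (real^'n) set)" by (rule finite_measure_ball)
  show "integrable (lebesgue_on unit_ball) (\<lambda>x::real^'n. C)" by simp
qed (use assms in \<open>auto intro!: AE_I2\<close>)

lemma L2_tendsto_ball:
  fixes F :: "nat \<Rightarrow> real^'n \<Rightarrow> complex"
  assumes m: "\<And>j. F j \<in> borel_measurable (lebesgue_on unit_ball)" "f \<in> borel_measurable (lebesgue_on unit_ball)"
    and bd: "\<And>j x. norm x < 1 \<Longrightarrow> norm (F j x) \<le> C" and lim: "\<And>x. norm x < 1 \<Longrightarrow> (\<lambda>j. F j x) \<longlonglongrightarrow> f x"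
  shows "L2_tendsto (lebesgue_on unit_ball) F f"
proof -
  have bdf: "norm (f x) \<le> C" if "norm x < 1" for x
    using tendsto_norm[OF lim[OF that]] bd[OF that] by (intro LIMSEQ_le_const2) auto
  have "(\<lambda>j. \<integral>x. (cmod (F j x - f x))\<^sup>2 \<partial>lebesgue_on unit_ball) \<longlonglongrightarrow> (\<integral>x. 0 \<partial>lebesgue_on (unit_ball :: (real^'n) set))"
  proof (rule integral_ball_tendsto[where C = "(2 * C)\<^sup>2"])
    fix j and x :: "real^'n" assume x: "norm x < 1"
    have "cmod (F j x - f x) \<le> 2 * C" using norm_triangle_ineq4[of "F j x" "f x"] bd[OF x, of j] bdf[OF x] by simp
    from power_mono[OF this norm_ge_zero, of 2] show "norm ((cmod (F j x - f x))\<^sup>2) \<le> (2 * C)\<^sup>2"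
      by (simp only: real_norm_def abs_of_nonneg zero_le_power2)
  next
    fix x :: "real^'n" assume x: "norm x < 1"
    have "(\<lambda>j. (cmod (F j x - f x))\<^sup>2) \<longlonglongrightarrow> (cmod (f x - f x))\<^sup>2"
      by (intro tendsto_intros lim x)
    then show "(\<lambda>j. (cmod (F j x - f x))\<^sup>2) \<longlonglongrightarrow> 0" by simp
  qed (use m in auto)
  then show ?thesis unfolding L2_tendsto_def using L2_ballI[OF m(1) bd] L2_ballI[OF m(2) bdf] by simp
qed

lemma L2_tendsto_smooth_cutoff:
  assumes "smooth v" shows "L2_tendsto (lebesgue_on unit_ball) (\<lambda>j x. v x * cutoff j x) v"
proof -
  obtain C where C: "C \<ge> 0" "\<And>x. norm x \<le> 1 \<Longrightarrow> norm (v x) \<le> C" using smooth_bounded[OF assms] by blast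
  show ?thesis
  proof (rule L2_tendsto_ball[where C = C])
    show "(\<lambda>x. v x * cutoff j x) \<in> borel_measurable (lebesgue_on unit_ball)" for j
      by (intro smooth_measurable_ball smooth_mult smooth_cutoff assms)
    show "v \<in> borel_measurable (lebesgue_on unit_ball)" by (intro smooth_measurable_ball assms)
    show "norm (v x * cutoff j x) \<le> C" if "norm x < 1" for j x
      unfolding norm_mult using mult_mono[OF C(2) cutoff_le, of x j] that C(1) by simp
    show "(\<lambda>j. v x * cutoff j x) \<longlonglongrightarrow> v x" if "norm x < 1" for x
      using tendsto_mult[OF tendsto_const cutoff_tendsto[OF that], of "v x"] by simp
  qed
qed

text \<open>The approximants are \<open>u * cutoff j\<close>. The critical part of their gradient is
  \<open>- 2 * x $ i * peak j x * u x\<close>, which the linear vanishing of \<open>u\<close> keeps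
  bounded and sends to 0.\<close>

lemma smooth_H10:
  assumes sm: "smooth u" and van: "\<And>x. norm x < 1 \<Longrightarrow> cmod (u x) \<le> C * (1 - x \<bullet> x)" and C: "C \<ge> 0"
  shows "u \<in> H10 unit_ball"
proof -
  have "L2_tendsto (lebesgue_on unit_ball) (\<lambda>j. pd i (\<lambda>x. u x * cutoff j x)) (pd i u)" for i
  proof -
    obtain B where B: "B \<ge> 0" "\<And>x. norm x \<le> 1 \<Longrightarrow> norm (pd i u x) \<le> B" using smooth_bounded[OF smooth_pd[OF sm]] by blast
    have eq: "pd i (\<lambda>x. u x * cutoff j x) = (\<lambda>x. - 2 * of_real (x $ i) * (of_real (peak j x) * u x) + pd i u x * cutoff j x)" for j
      by (rule ext) (simp add: pd_mult[OF smooth_differentiable[OF sm] smooth_differentiable[OF smooth_cutoff]] pd_cutoff)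
    show ?thesis
    proof (rule L2_tendsto_ball[where C = "2 * (3 * C) + B"])
      show "pd i (\<lambda>x. u x * cutoff j x) \<in> borel_measurable (lebesgue_on unit_ball)" for j
        by (intro smooth_measurable_ball smooth_pd smooth_mult smooth_cutoff sm)
      show "pd i u \<in> borel_measurable (lebesgue_on unit_ball)" by (intro smooth_measurable_ball smooth_pd sm)
      fix x :: "real^'a" assume x: "norm x < 1"
      have xi: "\<bar>x $ i\<bar> \<le> 1" using component_le_norm_cart[of x i] x by simp
      show "norm (pd i (\<lambda>x. u x * cutoff j x) x) \<le> 2 * (3 * C) + B" for j
      proof -
        have "norm (pd i (\<lambda>x. u x * cutoff j x) x) \<le> norm (- 2 * of_real (x $ i) * (of_real (peak j x) * u x)) + norm (pd i u x * cutoff j x)"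
          unfolding eq by (rule norm_triangle_ineq)
        also have "\<dots> \<le> (2 * 1) * (3 * C) + B * 1"
        proof (rule add_mono)
          have "norm (- 2 * complex_of_real (x $ i)) \<le> 2 * 1" using xi by (simp add: norm_mult)
          then show "norm (- 2 * of_real (x $ i) * (of_real (peak j x) * u x)) \<le> (2 * 1) * (3 * C)"
            unfolding norm_mult[of "- 2 * complex_of_real (x $ i)"] by (intro mult_mono peak_mult_le[OF van x C]) auto
          show "norm (pd i u x * cutoff j x) \<le> B * 1"
            unfolding norm_mult using x B(1) by (intro mult_mono B(2) cutoff_le) auto
        qed
        finally show ?thesis by simp
      qed
      have "(\<lambda>j. - 2 * of_real (x $ i) * (of_real (peak j x) * u x) + pd i u x * cutoff j x) \<longlonglongrightarrow> - 2 * of_real (x $ i) * 0 + pd i u x * 1"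
        by (intro tendsto_intros peak_mult_tendsto[of u C] van x cutoff_tendsto)
      then show "(\<lambda>j. pd i (\<lambda>x. u x * cutoff j x) x) \<longlonglongrightarrow> pd i u x" unfolding eq by simp
    qed
  qed
  then have "H1_tendsto unit_ball (\<lambda>j x. u x * cutoff j x) u"
    unfolding H1_tendsto_def using L2_tendsto_smooth_cutoff[OF sm] weak_pd_smooth[OF sm] by blast
  then show ?thesis unfolding H10_def using smooth_H1[OF sm] test_fun_smooth_cutoff[OF sm]
    by (auto intro!: exI[of _ "\<lambda>j x. u x * cutoff j x"])
qed

lemma smooth_lipschitz:
  fixes f :: "real^'n \<Rightarrow> complex"
  assumes "smooth f"
  obtains L where "L \<ge> 0" "\<And>x y. norm x \<le> 1 \<Longrightarrow> norm y \<le> 1 \<Longrightarrow> cmod (f x - f y) \<le> L * norm (x - y)"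
proof -
  have "\<exists>C. C \<ge> 0 \<and> (\<forall>x. norm x \<le> 1 \<longrightarrow> norm (pd i f x) \<le> C)" for i
    using smooth_bounded[OF smooth_pd[OF assms, of i]] by metis
  then obtain C where C: "\<And>i. C i \<ge> 0" "\<And>i x. norm x \<le> 1 \<Longrightarrow> norm (pd i f x) \<le> C i" by metis
  define L where "L = sum C UNIV"
  have "cmod (f x - f y) \<le> L * norm (x - y)" if "norm x \<le> 1" "norm y \<le> 1" for x y
  proof (rule differentiable_bound[where S = "cball 0 1" and f = f and f' = "\<lambda>x. frechet_derivative f (at x)" and B = L and x = x and y = y])
    fix z :: "real^'n" assume z: "z \<in> cball 0 1"
    have d: "f differentiable (at z)" by (rule smooth_differentiable[OF assms])
    show "(f has_derivative frechet_derivative f (at z)) (at z within cball 0 1)"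
      by (rule has_derivative_at_withinI[OF differentiable_has_derivative[OF d]])
    show "onorm (frechet_derivative f (at z)) \<le> L"
    proof (rule onorm_bound)
      show "0 \<le> L" unfolding L_def using C(1) by (simp add: sum_nonneg)
      fix h :: "real^'n"
      have lin: "linear (frechet_derivative f (at z))" by (rule linear_frechet_derivative[OF d])
      have "frechet_derivative f (at z) h = frechet_derivative f (at z) (\<Sum>i\<in>UNIV. h $ i *\<^sub>R axis i 1)"
        by (subst basis_expansion[symmetric, of h]) (simp add: scalar_mult_eq_scaleR)
      also have "\<dots> = (\<Sum>i\<in>UNIV. h $ i *\<^sub>R pd i f z)"
        by (simp add: linear_sum[OF lin] linear_scale[OF lin] pd_def)
      also have "norm \<dots> \<le> (\<Sum>i\<in>UNIV. norm h * C i)"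
        using z C component_le_norm_cart by (intro sum_norm_le) (auto intro!: mult_mono)
      also have "\<dots> = L * norm h" by (simp add: L_def sum_distrib_left mult.commute)
      finally show "norm (frechet_derivative f (at z) h) \<le> L * norm h" .
    qed
  qed (use that in auto)
  moreover have "L \<ge> 0" unfolding L_def using C(1) by (simp add: sum_nonneg)
  ultimately show ?thesis using that by blast
qed

section \<open>The divergence theorem\<close>

lemma integral_lborel_scale:
  fixes g :: "real^'n \<Rightarrow> complex"
  assumes "c > 0" "g \<in> borel_measurable borel"
  shows "integral\<^sup>L lborel (\<lambda>x. g (c *\<^sub>R x)) = of_real (1 / c ^ CARD('n)) * integral\<^sup>L lborel g"
proof -
  have [measurable]: "g \<in> borel_measurable borel" by fact
  have "integral\<^sup>L lborel g = integral\<^sup>L (density (distr lborel borel (\<lambda>x. 0 + c *\<^sub>R x)) (\<lambda>_. \<bar>c\<bar> ^ DIM(real^'n))) g"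
    using assms(1) by (subst lborel_affine[of c 0]) auto
  also have "\<dots> = integral\<^sup>L (distr lborel borel (\<lambda>x. 0 + c *\<^sub>R x)) (\<lambda>x. (\<bar>c\<bar> ^ DIM(real^'n)) *\<^sub>R g x)"
    by (subst integral_density) auto
  also have "\<dots> = integral\<^sup>L lborel (\<lambda>x. (\<bar>c\<bar> ^ DIM(real^'n)) *\<^sub>R g (c *\<^sub>R x))"
    by (subst integral_distr) auto
  also have "\<dots> = of_real (c ^ CARD('n)) * integral\<^sup>L lborel (\<lambda>x. g (c *\<^sub>R x))"
    using assms(1) by (simp add: scaleR_conv_of_real)
  finally show ?thesis using assms(1) by (simp add: field_simps)
qed

text \<open>
  This is the derivative at \<open>c = 1\<close> of \<open>\<integral> cutoff j (c x) f x dx\<close>, computed under the integral sign and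
  by the change of variables \<open>c x \<rightarrow> x\<close>. It replaces polar coordinates.
\<close>

lemma integral_peak_scaling:
  fixes f :: "real^'n \<Rightarrow> complex"
  assumes f: "f \<in> borel_measurable borel" and bd: "\<And>x. cmod (f x) \<le> C" and hom: "\<And>c x. c > 0 \<Longrightarrow> f (c *\<^sub>R x) = f x"
  shows "(\<integral>x. of_real (2 * (x \<bullet> x) * peak j x) * f x \<partial>lebesgue_on unit_ball)
    = of_nat CARD('n) * (\<integral>x. cutoff j x * f x \<partial>lebesgue_on unit_ball)"
proof -
  have C0: "C \<ge> 0" using order_trans[OF norm_ge_zero bd] .
  note [measurable] = f
  define J where "J = real j"
  define g where "g x = cutoff j x * f x" for x
  \<comment> \<open>Only the cutoff is dilated, but \<open>f\<close> has degree 0, so this is also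
    \<open>g ((1 + t) *\<^sub>R x)\<close> and the change of variables applies. Since
    \<open>1 + t \<ge> 1\<close>, all supports stay in the unit ball, which gives a common
    dominating function.\<close>
  define \<phi> where "\<phi> t x = complex_of_real (flat 0 (J * (1 - (1 + t)\<^sup>2 * (x \<bullet> x)) - 1)) * f x" for t and x :: "real^'n"
  define \<phi>' where "\<phi>' t x = complex_of_real (flat 2 (J * (1 - (1 + t)\<^sup>2 * (x \<bullet> x)) - 1) * (- (J * (2 * (1 + t) * (x \<bullet> x))))) * f x" for t and x :: "real^'n"
  have cb: "cutoff j \<in> borel_measurable borel" by (intro smooth_borel smooth_cutoff)
  have gm: "g \<in> borel_measurable borel" unfolding g_def using cb by measurable
  have \<phi>_eq: "\<phi> t x = g ((1 + t) *\<^sub>R x)" if "0 \<le> t" for t x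
    using hom[of "1 + t" x] that by (simp add: \<phi>_def g_def cutoff_def J_def power2_eq_square mult.assoc)
  have g_out: "g x = 0" if "\<not> norm x < 1" for x
  proof -
    have "1 - x \<bullet> x \<le> 0" using that by (simp add: inner_self_less_1)
    then have "J * (1 - x \<bullet> x) \<le> 0" by (simp add: J_def mult_nonneg_nonpos)
    then show ?thesis by (simp add: g_def cutoff_def flat_def J_def)
  qed
  have gle: "cmod (g x) \<le> C" for x
    unfolding g_def norm_mult using mult_mono[OF cutoff_le[of j x] bd[of x]] by simp
  have indint: "integrable lborel (\<lambda>x::real^'n. indicator unit_ball x *\<^sub>R (B::real))" for B
    by (intro integrable_scaleR_left integrable_real_indicator) (auto simp: emeasure_lborel_ball_finite[unfolded infinity_ennreal_def])
  have int: "integrable lborel (\<phi> t)" if t: "0 \<le> t" "t \<le> 1" for t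
  proof (rule Bochner_Integration.integrable_bound[OF indint[of C]])
    have "(\<lambda>x. g ((1 + t) *\<^sub>R x)) \<in> borel_measurable borel"
      by (rule measurable_compose[OF _ gm]) simp
    then show "\<phi> t \<in> borel_measurable lborel" unfolding \<phi>_eq[OF t(1), abs_def] by simp
    show "AE x in lborel. norm (\<phi> t x) \<le> norm (indicator unit_ball x *\<^sub>R C)"
    proof (intro always_eventually allI)
      fix x :: "real^'n"
      show "norm (\<phi> t x) \<le> norm (indicator unit_ball x *\<^sub>R C)"
      proof (cases "norm x < 1")
        case True then show ?thesis using gle C0 by (simp add: \<phi>_eq[OF t(1)])
      next
        case False
        then have "1 \<le> (1 + t) * norm x" using t mult_mono[of 1 "1 + t" 1 "norm x"] by simp
        then have "\<not> norm ((1 + t) *\<^sub>R x) < 1" using t by simp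
        then show ?thesis by (simp add: \<phi>_eq[OF t(1)] g_out)
      qed
    qed
  qed
  have "(\<lambda>m. of_nat (Suc m) * (integral\<^sup>L lborel (\<phi> (1 / real (Suc m))) - integral\<^sup>L lborel (\<phi> 0))) \<longlonglongrightarrow> integral\<^sup>L lborel (\<phi>' 0)"
  proof (rule integral_difference_quotient[OF int])
    fix t :: real and x :: "real^'n"
    have "((\<lambda>t. J * (1 - (1 + t)\<^sup>2 * (x \<bullet> x)) - 1) has_real_derivative - (J * (2 * (1 + t) * (x \<bullet> x)))) (at t)"
      by (auto intro!: derivative_eq_intros)
    from has_vector_derivative_mult_left[OF has_vector_derivative_of_real[OF DERIV_chain2[OF flat_has_real_derivative[of 0] this]], of "f x"]
    show "((\<lambda>t. \<phi> t x) has_vector_derivative \<phi>' t x) (at t)"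
      by (simp add: \<phi>_def \<phi>'_def numeral_2_eq_2)
  next
    have "continuous_on UNIV (\<lambda>x::real^'n. flat 2 (J * (1 - (1 + 0)\<^sup>2 * (x \<bullet> x)) - 1))"
      by (rule continuous_on_compose2[OF continuous_flat[of UNIV 2]]) (auto intro!: continuous_intros)
    then have [measurable]: "(\<lambda>x::real^'n. flat 2 (J * (1 - (1 + 0)\<^sup>2 * (x \<bullet> x)) - 1)) \<in> borel_measurable borel"
      by (rule borel_measurable_continuous_onI)
    show "\<phi>' 0 \<in> borel_measurable lborel" unfolding \<phi>'_def by measurable
  next
    show "integrable lborel (\<lambda>x::real^'n. indicator unit_ball x *\<^sub>R (2 * (J * 4) * C))" by (rule indint)
  next
    fix t :: real and x :: "real^'n" assume t: "0 \<le> t" "t \<le> 1"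
    show "norm (\<phi>' t x) \<le> indicator unit_ball x *\<^sub>R (2 * (J * 4) * C)"
    proof (cases "norm x < 1")
      case True
      then have s: "x \<bullet> x \<le> 1" "0 \<le> x \<bullet> x" by (auto simp: inner_self_less_1)
      have "(1 + t) * (x \<bullet> x) \<le> 2 * 1" using t s by (intro mult_mono) auto
      then have "2 * (1 + t) * (x \<bullet> x) \<le> 4" unfolding mult.assoc by linarith
      then have "J * (2 * (1 + t) * (x \<bullet> x)) \<le> J * 4" by (rule mult_left_mono) (simp add: J_def)
      moreover have "0 \<le> J * (2 * (1 + t) * (x \<bullet> x))" using t s by (simp add: J_def)
      ultimately have "\<bar>flat 2 (J * (1 - (1 + t)\<^sup>2 * (x \<bullet> x)) - 1) * (- (J * (2 * (1 + t) * (x \<bullet> x))))\<bar> \<le> 2 * (J * 4)"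
        unfolding abs_mult using flat_2_bounds(1) flat_nonneg by (intro mult_mono) auto
      then have "norm (\<phi>' t x) \<le> 2 * (J * 4) * C"
        unfolding \<phi>'_def norm_mult norm_of_real using bd C0 by (intro mult_mono) (auto simp: J_def)
      then show ?thesis using True by simp
    next
      case False
      then have "1 \<le> x \<bullet> x" by (simp add: inner_self_less_1)
      then have "1 * 1 \<le> (1 + t)\<^sup>2 * (x \<bullet> x)" using t by (intro mult_mono) auto
      then have "J * (1 - (1 + t)\<^sup>2 * (x \<bullet> x)) \<le> 0" by (simp add: J_def mult_nonneg_nonpos)
      then show ?thesis using False by (simp add: \<phi>'_def flat_def)
    qed
  qed
  moreover have "(\<lambda>m. of_nat (Suc m) * (integral\<^sup>L lborel (\<phi> (1 / real (Suc m))) - integral\<^sup>L lborel (\<phi> 0))) \<longlonglongrightarrow> - of_nat CARD('n) * integral\<^sup>L lborel g"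
  proof -
    have I: "integral\<^sup>L lborel (\<phi> t) = of_real (1 / (1 + t) ^ CARD('n)) * integral\<^sup>L lborel g" if "0 \<le> t" for t
    proof -
      have "\<phi> t = (\<lambda>x. g ((1 + t) *\<^sub>R x))" using \<phi>_eq[OF that] by auto
      then show ?thesis using integral_lborel_scale[OF _ gm, of "1 + t"] that by simp
    qed
    \<comment> \<open>The derivative of the Jacobian at \<open>t = 0\<close>; it produces the
      dimension factor of the conclusion.\<close>
    have "((\<lambda>t. 1 / (1 + t) ^ CARD('n)) has_real_derivative - real CARD('n)) (at 0)"
      by (auto intro!: derivative_eq_intros)
    from has_vector_derivative_of_real[OF this]
    have "(\<lambda>m. of_nat (Suc m) * (complex_of_real (1 / (1 + 1 / real (Suc m)) ^ CARD('n)) - complex_of_real (1 / (1 + 0) ^ CARD('n)))) \<longlonglongrightarrow> of_real (- real CARD('n))"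
      by (rule difference_quotient_tendsto)
    from tendsto_mult_right[OF this, of "integral\<^sup>L lborel g"]
    show ?thesis unfolding I[OF order_refl] using I by (simp add: left_diff_distrib mult.assoc del: of_nat_Suc)
  qed
  ultimately have "integral\<^sup>L lborel (\<phi>' 0) = - of_nat CARD('n) * integral\<^sup>L lborel g" by (rule LIMSEQ_unique)
  moreover have "integral\<^sup>L lborel g = (\<integral>x. cutoff j x * f x \<partial>lebesgue_on unit_ball)"
  proof -
    have "(\<integral>x. cutoff j x * f x \<partial>lebesgue_on unit_ball) = integral\<^sup>L lborel (\<lambda>x. indicator unit_ball x *\<^sub>R g x)"
      unfolding g_def[symmetric] by (rule lebesgue_on_ball_eq_lborel[OF gm])
    also have "(\<lambda>x. indicator unit_ball x *\<^sub>R g x) = g"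
      using g_out by (auto simp: indicator_def fun_eq_iff)
    finally show ?thesis by simp
  qed
  moreover have "integral\<^sup>L lborel (\<phi>' 0) = - (\<integral>x. of_real (2 * (x \<bullet> x) * peak j x) * f x \<partial>lebesgue_on unit_ball)"
  proof -
    have m: "(\<lambda>x. of_real (2 * (x \<bullet> x) * peak j x) * f x) \<in> borel_measurable borel" by measurable
    have "(\<integral>x. of_real (2 * (x \<bullet> x) * peak j x) * f x \<partial>lebesgue_on unit_ball) = integral\<^sup>L lborel (\<lambda>x. indicator unit_ball x *\<^sub>R (of_real (2 * (x \<bullet> x) * peak j x) * f x))"
      by (rule lebesgue_on_ball_eq_lborel[OF m])
    also have "(\<lambda>x. indicator unit_ball x *\<^sub>R (of_real (2 * (x \<bullet> x) * peak j x) * f x)) = (\<lambda>x. - \<phi>' 0 x)"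
    proof
      fix x :: "real^'n"
      show "indicator unit_ball x *\<^sub>R (of_real (2 * (x \<bullet> x) * peak j x) * f x) = - \<phi>' 0 x"
      proof (cases "norm x < 1")
        case True
        then show ?thesis by (simp add: \<phi>'_def peak_def J_def)
      next
        case False
        then have "1 - x \<bullet> x \<le> 0" by (simp add: inner_self_less_1)
        then have "J * (1 - x \<bullet> x) \<le> 0" by (simp add: J_def mult_nonneg_nonpos)
        then show ?thesis using False by (simp add: \<phi>'_def flat_def)
      qed
    qed
    finally show ?thesis by simp
  qed
  ultimately show ?thesis by simp
qed

lemma sgn_scaleR_pos: "c > 0 \<Longrightarrow> sgn (c *\<^sub>R x) = sgn (x :: 'a::real_normed_vector)"
  by (simp add: sgn_div_norm)

text \<open>\<open>F * cutoff j\<close> is a test function, so the integral of its derivative is 0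
  and \<open>pd i F\<close> balances the layer term \<open>2 * x $ i * peak j x * F x\<close>. In
  that term \<open>F x * x $ i\<close> is replaced by \<open>(x \<bullet> x) * f x\<close> with
  \<open>f\<close> homogeneous of degree 0. The error \<open>E\<close> vanishes linearly at the
  sphere and drops out; the rest is computed exactly by
  \<open>integral_peak_scaling\<close>.\<close>

lemma divergence_theorem_ball:
  fixes F :: "real^'n \<Rightarrow> complex"
  assumes sm: "smooth F"
  shows "integral\<^sup>L (lebesgue_on unit_ball) (pd i F) =
    of_nat CARD('n) * (\<integral>x. of_real (sgn x $ i) * F (sgn x) \<partial>lebesgue_on unit_ball)"
proof -
  let ?M = "lebesgue_on (unit_ball :: (real^'n) set)"
  define f where "f x = of_real (sgn x $ i) * F (sgn x)" for x :: "real^'n"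
  define E where "E x = F x * of_real (x $ i) - of_real (x \<bullet> x) * f x" for x :: "real^'n"
  obtain B where B: "B \<ge> 0" "\<And>x. norm x \<le> 1 \<Longrightarrow> norm (F x) \<le> B" using smooth_bounded[OF sm] by blast
  obtain L where L: "L \<ge> 0" "\<And>x y. norm x \<le> 1 \<Longrightarrow> norm y \<le> 1 \<Longrightarrow> cmod (F x - F y) \<le> L * norm (x - y)"
    using smooth_lipschitz[OF sm] by blast
  have sgn1: "norm (sgn x) \<le> 1" for x :: "real^'n" by (simp add: norm_sgn)
  have sgni: "\<bar>sgn x $ i\<bar> \<le> 1" for x :: "real^'n" using order_trans[OF component_le_norm_cart sgn1] .
  have fB: "cmod (f x) \<le> B" for x
    unfolding f_def norm_mult norm_of_real using mult_mono[OF sgni B(2)[OF sgn1]] by simp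
  have Fm [measurable]: "F \<in> borel_measurable borel" by (rule smooth_borel[OF sm])
  have sgnm: "(sgn :: real^'n \<Rightarrow> real^'n) \<in> borel_measurable borel" unfolding sgn_div_norm[abs_def] by measurable
  have fm: "f \<in> borel_measurable borel"
    unfolding f_def by (intro borel_measurable_times measurable_compose[OF sgnm Fm] measurable_compose[OF sgnm]) measurable
  have Em: "E \<in> borel_measurable borel" unfolding E_def using fm by measurable
  have EL: "cmod (E x) \<le> (L + B) * (1 - x \<bullet> x)" if x: "norm x < 1" for x
  proof (cases "x = 0")
    case True then show ?thesis using L(1) B(1) by (simp add: E_def)
  next
    case False
    define r y where "r = norm x" and "y = sgn x"
    have r: "0 < r" "r < 1" "x \<bullet> x = r\<^sup>2" using False x by (auto simp: r_def power2_norm_eq_inner)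
    have xy: "x = r *\<^sub>R y" using False by (simp add: r_def y_def sgn_div_norm)
    have "norm y = 1" using False by (simp add: y_def norm_sgn)
    then have d: "norm (x - y) = 1 - r" using r by (subst xy) (simp add: scaleR_left_diff_distrib[of r 1 y, simplified, symmetric])
    \<comment> \<open>Along the ray through \<open>y\<close> the error splits into the variation of
      \<open>F\<close> and the deficit \<open>1 - r\<close>, both of order
      \<open>1 - r\<close>.\<close>
    have "E x = of_real (r * (y $ i)) * ((F x - F y) + of_real (1 - r) * F y)"
    proof -
      have "complex_of_real (x $ i) = of_real (r * y $ i)" by (subst xy) simp
      then show ?thesis unfolding E_def f_def r(3) y_def[symmetric] by (simp add: algebra_simps power2_eq_square)
    qed
    also have "cmod \<dots> \<le> 1 * (L * (1 - r) + (1 - r) * B)"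
    proof -
      have 1: "cmod (of_real (r * (y $ i))) \<le> 1"
        using mult_mono[of r 1 "\<bar>y $ i\<bar>" 1] sgni[of x] r by (simp add: y_def norm_mult)
      have "cmod (F x - F y) \<le> L * (1 - r)" using L(2)[of x y] d x sgn1[of x] by (simp add: y_def)
      moreover have "cmod (of_real (1 - r) * F y) \<le> (1 - r) * B"
        unfolding norm_mult norm_of_real using r B(2)[OF sgn1, of x] by (intro mult_mono) (auto simp: y_def)
      ultimately have "cmod ((F x - F y) + of_real (1 - r) * F y) \<le> L * (1 - r) + (1 - r) * B"
        using norm_triangle_ineq[of "F x - F y" "of_real (1 - r) * F y"] by linarith
      with 1 show ?thesis unfolding norm_mult[of "of_real (r * (y $ i))"] by (intro mult_mono) auto
    qed
    also have "\<dots> = (L + B) * (1 - r)" by (simp add: algebra_simps)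
    also have "\<dots> \<le> (L + B) * (1 - x \<bullet> x)"
    proof -
      have "r\<^sup>2 \<le> r" using r by (simp add: power2_eq_square mult_left_le)
      then show ?thesis unfolding r(3) using L(1) B(1) by (intro mult_left_mono) auto
    qed
    finally show ?thesis .
  qed
  have LB: "L + B \<ge> 0" using L(1) B(1) by simp
  note meas = borel_measurable_on_ball[OF fm] borel_measurable_on_ball[OF Em] smooth_measurable_ball[OF smooth_cutoff]
     smooth_measurable_ball[OF smooth_pd[OF sm]] borel_measurable_on_ball[OF peak_borel]
  obtain B' where B': "B' \<ge> 0" "\<And>x. norm x \<le> 1 \<Longrightarrow> norm (pd i F x) \<le> B'" using smooth_bounded[OF smooth_pd[OF sm]] by blast
  have lim1: "(\<lambda>j. \<integral>x. pd i F x * cutoff j x \<partial>?M) \<longlonglongrightarrow> integral\<^sup>L ?M (pd i F)"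
  proof (rule integral_ball_tendsto[where C = B'])
    show "norm (pd i F x * cutoff j x) \<le> B'" if "norm x < 1" for j x
      unfolding norm_mult using mult_mono[OF B'(2)[of x] cutoff_le[of j x]] that B'(1) by simp
    show "(\<lambda>j. pd i F x * cutoff j x) \<longlonglongrightarrow> pd i F x" if "norm x < 1" for x
      using tendsto_mult[OF tendsto_const cutoff_tendsto[OF that], of "pd i F x"] by simp
  qed (use meas in \<open>auto intro!: borel_measurable_times\<close>)
  have lim2: "(\<lambda>j. \<integral>x. cutoff j x * f x \<partial>?M) \<longlonglongrightarrow> integral\<^sup>L ?M f"
  proof (rule integral_ball_tendsto[where C = B])
    show "norm (cutoff j x * f x) \<le> B" for j x
      unfolding norm_mult using mult_mono[OF cutoff_le[of j x] fB[of x]] by simp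
    show "(\<lambda>j. cutoff j x * f x) \<longlonglongrightarrow> f x" if "norm x < 1" for x
      using tendsto_mult[OF cutoff_tendsto[OF that] tendsto_const, of "f x"] by simp
  qed (use meas in \<open>auto intro!: borel_measurable_times\<close>)
  have pEm: "(\<lambda>x. of_real (peak j x) * E x) \<in> borel_measurable ?M" for j
    using Em by (intro borel_measurable_on_ball) measurable
  have lim3: "(\<lambda>j. \<integral>x. of_real (peak j x) * E x \<partial>?M) \<longlonglongrightarrow> integral\<^sup>L ?M (\<lambda>x. 0)"
  proof (rule integral_ball_tendsto[where C = "3 * (L + B)"])
    show "norm (of_real (peak j x) * E x) \<le> 3 * (L + B)" if "norm x < 1" for j x
      by (rule peak_mult_le[OF EL that LB])
    show "(\<lambda>j. of_real (peak j x) * E x) \<longlonglongrightarrow> 0" if "norm x < 1" for x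
      by (rule peak_mult_tendsto[OF EL that])
  qed (use pEm in auto)
  have id: "(\<integral>x. pd i F x * cutoff j x \<partial>?M) = 2 * (\<integral>x. of_real (peak j x) * E x \<partial>?M) + of_nat CARD('n) * (\<integral>x. cutoff j x * f x \<partial>?M)" for j
  proof -
    have pd: "pd i (\<lambda>x. F x * cutoff j x) = (\<lambda>x. pd i F x * cutoff j x - (2 * (of_real (peak j x) * E x) + of_real (2 * (x \<bullet> x) * peak j x) * f x))"
    proof
      fix x
      have "pd i (\<lambda>x. F x * cutoff j x) x = F x * pd i (cutoff j) x + pd i F x * cutoff j x"
        by (rule pd_mult[OF smooth_differentiable[OF sm] smooth_differentiable[OF smooth_cutoff]])
      then show "pd i (\<lambda>x. F x * cutoff j x) x = pd i F x * cutoff j x - (2 * (of_real (peak j x) * E x) + of_real (2 * (x \<bullet> x) * peak j x) * f x)"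
        by (simp add: pd_cutoff E_def algebra_simps)
    qed
    have i1: "integrable ?M (\<lambda>x. pd i F x * cutoff j x)"
      by (intro smooth_integrable smooth_mult smooth_pd smooth_cutoff sm)
    have i2: "integrable ?M (\<lambda>x. 2 * (of_real (peak j x) * E x))"
      by (intro integrable_mult_right integrable_on_ballI[OF pEm, where C = "3 * (L + B)"] peak_mult_le[OF EL _ LB])
    have i3: "integrable ?M (\<lambda>x. of_real (2 * (x \<bullet> x) * peak j x) * f x)"
    proof -
      \<comment> \<open>Integrability of the layer term by rearranging \<open>pd\<close>, whose
        other terms are already known to be integrable.\<close>
      have "integrable ?M (\<lambda>x. pd i F x * cutoff j x - pd i (\<lambda>x. F x * cutoff j x) x - 2 * (of_real (peak j x) * E x))"
        by (intro Bochner_Integration.integrable_diff i1 i2 smooth_integrable smooth_pd smooth_mult smooth_cutoff sm)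
      then show ?thesis by (simp add: pd)
    qed
    have "0 = integral\<^sup>L ?M (pd i (\<lambda>x. F x * cutoff j x))"
      using integral_pd_test_fun[OF test_fun_smooth_cutoff[OF sm]] by simp
    also have "\<dots> = (\<integral>x. pd i F x * cutoff j x \<partial>?M) - ((\<integral>x. 2 * (of_real (peak j x) * E x) \<partial>?M) + (\<integral>x. of_real (2 * (x \<bullet> x) * peak j x) * f x \<partial>?M))"
      unfolding pd using i1 i2 i3 by (simp only: Bochner_Integration.integral_diff Bochner_Integration.integral_add Bochner_Integration.integrable_add)
    also have "(\<integral>x. of_real (2 * (x \<bullet> x) * peak j x) * f x \<partial>?M) = of_nat CARD('n) * (\<integral>x. cutoff j x * f x \<partial>?M)"
      by (rule integral_peak_scaling[OF fm fB]) (simp add: f_def sgn_scaleR_pos)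
    finally show ?thesis by simp
  qed
  have "(\<lambda>j. \<integral>x. pd i F x * cutoff j x \<partial>?M) \<longlonglongrightarrow> 2 * integral\<^sup>L ?M (\<lambda>x. 0) + of_nat CARD('n) * integral\<^sup>L ?M f"
    unfolding id by (intro tendsto_intros lim2 lim3)
  then have "(\<lambda>j. \<integral>x. pd i F x * cutoff j x \<partial>?M) \<longlonglongrightarrow> of_nat CARD('n) * integral\<^sup>L ?M f" by simp
  from LIMSEQ_unique[OF lim1 this] show ?thesis unfolding f_def .
qed

section \<open>Traces and eigenfunctions\<close>

lemma space_sphere_measure: "space (sphere_measure :: (real^'n) measure) = sphere 0 1"
  by (simp add: sphere_measure_def space_scale_measure space_restrict_space)

lemma sets_sphere_measure: "sets (sphere_measure :: (real^'n) measure) = sets (restrict_space borel (sphere 0 1))"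
  by (simp add: sphere_measure_def)

lemma sgn_measurable_sphere:
  "sgn \<in> lebesgue_on (ball 0 1 - {0}) \<rightarrow>\<^sub>M restrict_space borel (sphere (0::real^'n) 1)"
proof (rule measurable_restrict_space2)
  have "(sgn :: real^'n \<Rightarrow> real^'n) \<in> borel_measurable borel" unfolding sgn_div_norm[abs_def] by measurable
  then show "sgn \<in> lebesgue_on (ball 0 1 - {0}) \<rightarrow>\<^sub>M (borel :: (real^'n) measure)"
    by (intro measurable_restrict_space1 measurable_completion) auto
qed (auto simp: space_restrict_space norm_sgn)

lemma sphere_measure_eq_density:
  "(sphere_measure :: (real^'n) measure) =
     density (distr (lebesgue_on (ball 0 1 - {0})) (restrict_space borel (sphere 0 1)) sgn) (\<lambda>_. ennreal (real CARD('n)))"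
proof (rule measure_eqI)
  fix A assume "A \<in> sets (sphere_measure :: (real^'n) measure)"
  then show "emeasure sphere_measure A = emeasure (density (distr (lebesgue_on (ball 0 1 - {0})) (restrict_space borel (sphere 0 1)) sgn) (\<lambda>_. ennreal (real CARD('n)))) A"
    unfolding sphere_measure_def by (subst emeasure_density_const) (auto simp: ennreal_of_nat_eq_real_of_nat)
qed (simp add: sphere_measure_def)

text \<open>Pulling back along \<open>sgn\<close> is the definition of the cone measure. The origin
  is left out there because \<open>sgn 0 = 0\<close> is off the sphere; being a null set, it can be
  restored.\<close>

lemma integral_sphere_measure:
  fixes h :: "real^'n \<Rightarrow> complex"
  assumes h: "h \<in> borel_measurable borel"
  shows "integral\<^sup>L sphere_measure h = of_nat CARD('n) * (\<integral>x. h (sgn x) \<partial>lebesgue_on unit_ball)"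
proof -
  have hr: "h \<in> borel_measurable (restrict_space borel (sphere 0 1))" by (rule measurable_restrict_space1[OF h])
  have sgnm: "(sgn :: real^'n \<Rightarrow> real^'n) \<in> borel_measurable borel" unfolding sgn_div_norm[abs_def] by measurable
  have hs: "(\<lambda>x. h (sgn x)) \<in> borel_measurable borel" by (rule measurable_compose[OF sgnm h])
  have "integral\<^sup>L sphere_measure h = integral\<^sup>L (distr (lebesgue_on (ball 0 1 - {0})) (restrict_space borel (sphere 0 1)) sgn) (\<lambda>x. real CARD('n) *\<^sub>R h x)"
    unfolding sphere_measure_eq_density using hr by (subst integral_density) auto
  also have "\<dots> = (\<integral>x. real CARD('n) *\<^sub>R h (sgn x) \<partial>lebesgue_on (ball 0 1 - {0}))"
    using hr by (intro integral_distr sgn_measurable_sphere) auto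
  also have "\<dots> = of_nat CARD('n) * (\<integral>x. h (sgn x) \<partial>lebesgue_on (ball 0 1 - {0}))"
    by (simp add: scaleR_conv_of_real)
  also have "(\<integral>x. h (sgn x) \<partial>lebesgue_on (ball 0 1 - {0})) = (\<integral>x. indicator (ball 0 1 - {0}) x *\<^sub>R h (sgn x) \<partial>lebesgue)"
    by (rule integral_restrict_space) auto
  also have "\<dots> = (\<integral>x. indicator (ball 0 1) x *\<^sub>R h (sgn x) \<partial>lebesgue)"
  proof (rule integral_cong_AE)
    have "AE x in lebesgue. (x::real^'n) \<noteq> 0"
      by (rule AE_I'[of "{0}"]) (auto simp: null_sets_completionI)
    then show "AE x in lebesgue. indicator (ball 0 1 - {0}) x *\<^sub>R h (sgn x) = indicator (ball 0 1) x *\<^sub>R h (sgn x)"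
      by eventually_elim (auto simp: indicator_def)
  qed (use hs in \<open>auto intro!: measurable_completion borel_measurable_scaleR borel_measurable_indicator\<close>)
  also have "\<dots> = (\<integral>x. h (sgn x) \<partial>lebesgue_on unit_ball)"
    by (rule integral_restrict_space[symmetric]) auto
  finally show ?thesis .
qed

lemma finite_measure_sphere_measure: "finite_measure (sphere_measure :: (real^'n) measure)"
proof (rule finite_measureI)
  have "emeasure (lebesgue_on (ball 0 1 - {0} :: (real^'n) set)) (sgn -` sphere 0 1 \<inter> space (lebesgue_on (ball 0 1 - {0}))) \<le> emeasure (lebesgue_on (ball 0 1 - {0})) (space (lebesgue_on (ball 0 1 - {0} :: (real^'n) set)))"
    by (rule emeasure_space)
  also have "\<dots> < \<infinity>"
  proof -
    have "(ball 0 1 - {0} :: (real^'n) set) \<in> lmeasurable" by (intro fmeasurable_Diff) auto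
    from finite_measure.emeasure_finite[OF finite_measure_lebesgue_on[OF this]] show ?thesis by (simp add: top.not_eq_extremum)
  qed
  finally have fin: "emeasure (lebesgue_on (ball 0 1 - {0} :: (real^'n) set)) (sgn -` sphere 0 1 \<inter> space (lebesgue_on (ball 0 1 - {0}))) < \<infinity>" .
  have S: "sphere (0::real^'n) 1 \<in> sets (restrict_space borel (sphere 0 1))" by (simp add: sets_restrict_space_iff)
  show "emeasure sphere_measure (space (sphere_measure :: (real^'n) measure)) \<noteq> \<infinity>"
    unfolding space_sphere_measure unfolding sphere_measure_def emeasure_scale_measure emeasure_distr[OF sgn_measurable_sphere S]
    using fin by (auto simp: ennreal_mult_eq_top_iff)
qed

lemma borel_measurable_sphere_measure:
  "f \<in> borel_measurable borel \<Longrightarrow> f \<in> borel_measurable sphere_measure"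
  by (subst measurable_cong_sets[OF sets_sphere_measure refl]) (rule measurable_restrict_space1)

lemma smooth_L2_sphere:
  assumes "smooth (f :: real^'n \<Rightarrow> complex)" shows "f \<in> L2 sphere_measure"
proof -
  interpret finite_measure "sphere_measure :: (real^'n) measure" by (rule finite_measure_sphere_measure)
  obtain C where C: "C \<ge> 0" "\<And>x. norm x \<le> 1 \<Longrightarrow> norm (f x) \<le> C" using smooth_bounded[OF assms] by blast
  have m: "f \<in> borel_measurable sphere_measure" by (intro borel_measurable_sphere_measure smooth_borel assms)
  have "integrable sphere_measure (\<lambda>x. (cmod (f x))\<^sup>2)"
  proof (rule integrable_const_bound[of _ "C\<^sup>2"])
    show "AE x in sphere_measure. norm ((cmod (f x))\<^sup>2) \<le> C\<^sup>2"
      by (rule AE_I2) (use C(2) in \<open>auto simp: space_sphere_measure intro!: power_mono\<close>)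
  qed (use m in auto)
  then show ?thesis using m by (simp add: L2_def)
qed

lemma divergence_theorem_sphere:
  fixes F :: "real^'n \<Rightarrow> complex"
  assumes "smooth F"
  shows "(\<integral>x. of_real (x $ i) * F x \<partial>sphere_measure) = integral\<^sup>L (lebesgue_on unit_ball) (pd i F)"
  unfolding divergence_theorem_ball[OF assms]
  by (rule integral_sphere_measure) (intro smooth_borel smooth_mult smooth_coord assms)

section \<open>Pairings in \<open>L2\<close> and Green's identity\<close>

lemma L2_mult_integrable:
  assumes "f \<in> L2 M" "g \<in> L2 M" shows "integrable M (\<lambda>x. f x * g x)"
proof (rule Bochner_Integration.integrable_bound)
  show "integrable M (\<lambda>x. (cmod (f x))\<^sup>2 + (cmod (g x))\<^sup>2)" using assms by (auto simp: L2_def)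
  show "(\<lambda>x. f x * g x) \<in> borel_measurable M" using assms by (auto simp: L2_def)
  show "AE x in M. norm (f x * g x) \<le> norm ((cmod (f x))\<^sup>2 + (cmod (g x))\<^sup>2)"
  proof (intro always_eventually allI)
    fix x
    have "2 * (cmod (f x) * cmod (g x)) \<le> (cmod (f x))\<^sup>2 + (cmod (g x))\<^sup>2"
      using sum_squares_bound[of "cmod (f x)" "cmod (g x)"] by simp
    moreover have "0 \<le> cmod (f x) * cmod (g x)" by simp
    ultimately have "cmod (f x) * cmod (g x) \<le> (cmod (f x))\<^sup>2 + (cmod (g x))\<^sup>2" by linarith
    then show "norm (f x * g x) \<le> norm ((cmod (f x))\<^sup>2 + (cmod (g x))\<^sup>2)" by (simp add: norm_mult)
  qed
qed

lemma L2_diff: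
  assumes "f \<in> L2 M" "g \<in> L2 M" shows "(\<lambda>x. f x - g x) \<in> L2 M"
proof -
  have "integrable M (\<lambda>x. (cmod (f x - g x))\<^sup>2)"
  proof (rule Bochner_Integration.integrable_bound)
    show "integrable M (\<lambda>x. 2 * (cmod (f x))\<^sup>2 + 2 * (cmod (g x))\<^sup>2)" using assms by (auto simp: L2_def)
    show "AE x in M. norm ((cmod (f x - g x))\<^sup>2) \<le> norm (2 * (cmod (f x))\<^sup>2 + 2 * (cmod (g x))\<^sup>2)"
    proof (intro always_eventually allI)
      fix x
      have "(cmod (f x - g x))\<^sup>2 \<le> (cmod (f x) + cmod (g x))\<^sup>2"
        by (intro power_mono norm_triangle_ineq4) auto
      also have "\<dots> \<le> 2 * (cmod (f x))\<^sup>2 + 2 * (cmod (g x))\<^sup>2"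
        using sum_squares_bound[of "cmod (f x)" "cmod (g x)"] by (simp add: power2_sum)
      finally show "norm ((cmod (f x - g x))\<^sup>2) \<le> norm (2 * (cmod (f x))\<^sup>2 + 2 * (cmod (g x))\<^sup>2)" by simp
    qed
  qed (use assms in \<open>auto simp: L2_def\<close>)
  then show ?thesis using assms by (auto simp: L2_def)
qed

lemma L2_tendsto_pairing:
  assumes F: "L2_tendsto M F f" and g: "g \<in> L2 M"
  shows "(\<lambda>j. \<integral>x. F j x * g x \<partial>M) \<longlonglongrightarrow> (\<integral>x. f x * g x \<partial>M)"
proof (rule LIMSEQ_I)
  fix e :: real assume e: "e > 0"
  have FL: "\<And>j. F j \<in> L2 M" "f \<in> L2 M" and lim: "(\<lambda>j. \<integral>x. (cmod (F j x - f x))\<^sup>2 \<partial>M) \<longlonglongrightarrow> 0"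
    using F by (auto simp: L2_tendsto_def)
  define G where "G = (\<integral>x. (cmod (g x))\<^sup>2 \<partial>M)"
  have G: "G \<ge> 0" by (simp add: G_def)
  \<comment> \<open>Weighted Young inequality with weight \<open>d\<close>: the part containing
    \<open>g\<close> is below \<open>e / 2\<close> for this \<open>d\<close>, and the remaining part
    becomes small as \<open>j\<close> grows.\<close>
  define d where "d = e / (G + 1)"
  have d: "d > 0" "d * G < e" using e G by (auto simp: d_def field_simps)
  have bound: "cmod ((\<integral>x. F j x * g x \<partial>M) - (\<integral>x. f x * g x \<partial>M)) \<le> (1 / d) * (\<integral>x. (cmod (F j x - f x))\<^sup>2 \<partial>M) / 2 + d * G / 2" for j
  proof -
    have D: "(\<lambda>x. F j x - f x) \<in> L2 M" by (intro L2_diff FL)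
    have i1: "integrable M (\<lambda>x. (F j x - f x) * g x)" by (intro L2_mult_integrable D g)
    have i2: "integrable M (\<lambda>x. (1 / d) * (cmod (F j x - f x))\<^sup>2 / 2 + d * (cmod (g x))\<^sup>2 / 2)"
      using D g by (auto simp: L2_def)
    have "(\<integral>x. F j x * g x \<partial>M) - (\<integral>x. f x * g x \<partial>M) = (\<integral>x. (F j x - f x) * g x \<partial>M)"
      by (subst Bochner_Integration.integral_diff[symmetric]) (auto intro: L2_mult_integrable FL g simp: left_diff_distrib)
    also have "cmod \<dots> \<le> (\<integral>x. cmod ((F j x - f x) * g x) \<partial>M)" by (rule integral_norm_bound)
    also have "\<dots> \<le> (\<integral>x. (1 / d) * (cmod (F j x - f x))\<^sup>2 / 2 + d * (cmod (g x))\<^sup>2 / 2 \<partial>M)"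
    proof (rule integral_mono)
      fix x
      define p q where "p = cmod (F j x - f x)" and "q = cmod (g x)"
      have "0 \<le> (p - d * q)\<^sup>2 / d" using d by simp
      also have "\<dots> = (1 / d) * p\<^sup>2 + d * q\<^sup>2 - 2 * p * q" using d by (simp add: power2_eq_square field_simps)
      finally show "cmod ((F j x - f x) * g x) \<le> (1 / d) * (cmod (F j x - f x))\<^sup>2 / 2 + d * (cmod (g x))\<^sup>2 / 2"
        by (simp add: norm_mult p_def q_def)
    qed (use i1 i2 in auto)
    also have "\<dots> = (1 / d) * (\<integral>x. (cmod (F j x - f x))\<^sup>2 \<partial>M) / 2 + d * G / 2"
      unfolding G_def using D g by (subst Bochner_Integration.integral_add) (auto simp: L2_def)
    finally show ?thesis .
  qed
  have "eventually (\<lambda>j. (\<integral>x. (cmod (F j x - f x))\<^sup>2 \<partial>M) < d * e) sequentially"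
    using lim d e by (intro order_tendstoD) auto
  then obtain N where N: "\<And>j. j \<ge> N \<Longrightarrow> (\<integral>x. (cmod (F j x - f x))\<^sup>2 \<partial>M) < d * e"
    by (auto simp: eventually_sequentially)
  show "\<exists>N. \<forall>j\<ge>N. norm ((\<integral>x. F j x * g x \<partial>M) - (\<integral>x. f x * g x \<partial>M)) < e"
  proof (intro exI allI impI)
    fix j assume "j \<ge> N"
    have "(1 / d) * (\<integral>x. (cmod (F j x - f x))\<^sup>2 \<partial>M) < (1 / d) * (d * e)"
      using N[OF \<open>j \<ge> N\<close>] d by (intro mult_strict_left_mono) auto
    then have "(1 / d) * (\<integral>x. (cmod (F j x - f x))\<^sup>2 \<partial>M) < e" using d by simp
    moreover have "c < e" if "c \<le> a / 2 + b / 2" "a < e" "b < e" for a b c :: real using that by linarith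
    ultimately show "norm ((\<integral>x. F j x * g x \<partial>M) - (\<integral>x. f x * g x \<partial>M)) < e"
      using bound[of j] d(2) by blast
  qed
qed

text \<open>\<open>v * cutoff j\<close> are test functions converging to \<open>v\<close> in
  \<open>L2\<close>. So identities known for compact support extend to functions smooth up to the
  boundary; this also serves as uniqueness of weak derivatives.\<close>

lemma L2_test_eq_imp_smooth_eq:
  fixes v :: "real^'n \<Rightarrow> complex"
  assumes "f \<in> L2 (lebesgue_on unit_ball)" "g \<in> L2 (lebesgue_on unit_ball)" "smooth v"
    and eq: "\<And>\<psi>. test_fun unit_ball \<psi> \<Longrightarrow> (\<integral>x. f x * \<psi> x \<partial>lebesgue_on unit_ball) = (\<integral>x. g x * \<psi> x \<partial>lebesgue_on unit_ball)"
  shows "(\<integral>x. f x * v x \<partial>lebesgue_on unit_ball) = (\<integral>x. g x * v x \<partial>lebesgue_on unit_ball)"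
proof -
  note p = L2_tendsto_pairing[OF L2_tendsto_smooth_cutoff[OF assms(3)]]
  have "(\<lambda>j. \<integral>x. (v x * cutoff j x) * f x \<partial>lebesgue_on unit_ball) = (\<lambda>j. \<integral>x. (v x * cutoff j x) * g x \<partial>lebesgue_on unit_ball)"
    using eq[OF test_fun_smooth_cutoff[OF assms(3)]] by (simp add: mult.commute)
  from LIMSEQ_unique[OF p[OF assms(1)] p[OF assms(2), folded this]] show ?thesis by (simp add: mult.commute)
qed

text \<open>Green's second identity. Traces exist only as limits, so each integration by parts is
  done on smooth approximants and passed to the limit by pairing with the fixed smooth
  \<open>v\<close> or its derivatives. The outer normal of the unit sphere is the position
  vector.\<close>

lemma has_weak_trace_smooth:
  fixes v :: "real^'n \<Rightarrow> complex"
  assumes sm: "smooth v"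
  shows "has_weak_trace unit_ball sphere_measure (\<lambda>x. x) v v"
  unfolding has_weak_trace_def
proof (intro conjI bexI[of _ "laplacian v"] ballI allI impI)
  let ?M = "lebesgue_on (unit_ball :: (real^'n) set)"
  show "v \<in> L2 ?M" "laplacian v \<in> L2 ?M" by (intro smooth_L2 smooth_laplacian sm)+
  show "v \<in> L2 sphere_measure" by (rule smooth_L2_sphere[OF sm])
  show "weak_laplacian unit_ball v (laplacian v)" by (rule weak_laplacian_smooth[OF sm])
  fix \<phi> q h
  assume \<phi>: "\<phi> \<in> H2 unit_ball \<inter> H10 unit_ball" and q: "q \<in> L2 ?M"
    and A: "weak_laplacian unit_ball \<phi> q \<and> has_normal_derivative unit_ball sphere_measure (\<lambda>x. x) \<phi> h"
  have \<phi>L2: "\<phi> \<in> L2 ?M" using \<phi> by (simp add: H2_def)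
  obtain G T where GT: "\<And>i. weak_pd unit_ball i \<phi> (G i)" "\<And>i. has_trace unit_ball sphere_measure (G i) (T i)"
    and hT: "AE x in sphere_measure. h x = (\<Sum>i\<in>UNIV. of_real (x $ i) * T i x)" and hL2: "h \<in> L2 sphere_measure"
    using A unfolding has_normal_derivative_def by blast
  have "\<forall>i. \<exists>F. (\<forall>j. smooth (F j)) \<and> H1_tendsto unit_ball F (G i) \<and> L2_tendsto sphere_measure F (T i)"
    using GT(2) unfolding has_trace_def by blast
  then obtain F where F: "\<And>i j. smooth (F i j)" "\<And>i. H1_tendsto unit_ball (F i) (G i)" "\<And>i. L2_tendsto sphere_measure (F i) (T i)"
    by metis
  have FG: "L2_tendsto ?M (F i) (G i)" for i using F(2)[of i] unfolding H1_tendsto_def by blast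
  have "\<forall>i. \<exists>g. weak_pd unit_ball i (G i) g \<and> L2_tendsto ?M (\<lambda>j. pd i (F i j)) g"
    using F(2) unfolding H1_tendsto_def by blast
  then obtain K where K: "\<And>i. weak_pd unit_ball i (G i) (K i)" "\<And>i. L2_tendsto ?M (\<lambda>j. pd i (F i j)) (K i)" by metis
  have GL2: "G i \<in> L2 ?M" for i using FG unfolding L2_tendsto_def by blast
  have KL2: "K i \<in> L2 ?M" for i using K(2) unfolding L2_tendsto_def by blast
  have TL2: "T i \<in> L2 sphere_measure" for i using F(3) unfolding L2_tendsto_def by blast
  have smi: "smooth (\<lambda>x. of_real (x $ i) * v x)" for i by (intro smooth_mult smooth_coord sm)
  \<comment> \<open>Divergence theorem for \<open>F i j * v\<close>. One sequence converges to
    \<open>G i\<close> in the ball, together with its gradient, and to \<open>T i\<close> on the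
    sphere, which is exactly what \<open>has_trace\<close> provides.\<close>
  have a: "(\<integral>x. T i x * (of_real (x $ i) * v x) \<partial>sphere_measure) = (\<integral>x. K i x * v x \<partial>?M) + (\<integral>x. G i x * pd i v x \<partial>?M)" for i
  proof -
    have "(\<lambda>j. \<integral>x. F i j x * (of_real (x $ i) * v x) \<partial>sphere_measure) \<longlonglongrightarrow> (\<integral>x. T i x * (of_real (x $ i) * v x) \<partial>sphere_measure)"
      by (rule L2_tendsto_pairing[OF F(3) smooth_L2_sphere[OF smi]])
    moreover have "(\<integral>x. F i j x * (of_real (x $ i) * v x) \<partial>sphere_measure) = (\<integral>x. pd i (F i j) x * v x \<partial>?M) + (\<integral>x. F i j x * pd i v x \<partial>?M)" for j
    proof -
      have "(\<integral>x. F i j x * (of_real (x $ i) * v x) \<partial>sphere_measure) = (\<integral>x. of_real (x $ i) * (F i j x * v x) \<partial>sphere_measure)"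
        by (simp add: mult_ac)
      also have "\<dots> = integral\<^sup>L ?M (pd i (\<lambda>x. F i j x * v x))"
        by (rule divergence_theorem_sphere) (intro smooth_mult F sm)
      also have "pd i (\<lambda>x. F i j x * v x) = (\<lambda>x. F i j x * pd i v x + pd i (F i j) x * v x)"
        by (intro ext pd_mult smooth_differentiable F sm)
      also have "integral\<^sup>L ?M \<dots> = (\<integral>x. F i j x * pd i v x \<partial>?M) + (\<integral>x. pd i (F i j) x * v x \<partial>?M)"
        by (intro Bochner_Integration.integral_add smooth_integrable smooth_mult smooth_pd F sm)
      finally show ?thesis by simp
    qed
    moreover have "(\<lambda>j. (\<integral>x. pd i (F i j) x * v x \<partial>?M) + (\<integral>x. F i j x * pd i v x \<partial>?M)) \<longlonglongrightarrow> (\<integral>x. K i x * v x \<partial>?M) + (\<integral>x. G i x * pd i v x \<partial>?M)"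
      by (intro tendsto_add L2_tendsto_pairing K FG smooth_L2 smooth_pd sm)
    ultimately show ?thesis using LIMSEQ_unique by fastforce
  qed
  \<comment> \<open>The sum of the pure second weak derivatives is the weak Laplacian: both agree on
    test functions, and the density argument carries this over to \<open>v\<close>.\<close>
  have b: "(\<Sum>i\<in>UNIV. \<integral>x. K i x * v x \<partial>?M) = (\<integral>x. q x * v x \<partial>?M)"
  proof -
    have Kint: "integrable ?M (\<lambda>x. K i x * \<psi> x)" if "smooth \<psi>" for i \<psi>
      by (intro L2_mult_integrable KL2 smooth_L2 that)
    have KS: "(\<lambda>x. \<Sum>i\<in>UNIV. K i x) \<in> L2 ?M"
    proof -
      have "(\<lambda>x. \<Sum>i\<in>I. K i x) \<in> L2 ?M" if "finite I" for I
        using that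
      proof (induction I rule: finite_induct)
        case empty then show ?case using smooth_L2[OF smooth_const[of 0]] by simp
      next
        case (insert k I)
        have "(\<lambda>x. 0 - (\<Sum>i\<in>I. K i x)) \<in> L2 ?M" using smooth_L2[OF smooth_const[of 0]] insert.IH by (rule L2_diff)
        from L2_diff[OF KL2[of k] this] show ?case using insert.hyps by simp
      qed
      then show ?thesis by simp
    qed
    have "(\<integral>x. (\<Sum>i\<in>UNIV. K i x) * v x \<partial>?M) = (\<integral>x. q x * v x \<partial>?M)"
    proof (rule L2_test_eq_imp_smooth_eq[OF KS q sm])
      fix \<psi> :: "real^'n \<Rightarrow> complex" assume t: "test_fun unit_ball \<psi>"
      have ps: "smooth \<psi>" by (rule test_fun_smooth[OF t])
      have "(\<integral>x. q x * \<psi> x \<partial>?M) = (\<integral>x. \<phi> x * laplacian \<psi> x \<partial>?M)"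
        using A t unfolding weak_laplacian_def by simp
      also have "\<dots> = (\<Sum>i\<in>UNIV. \<integral>x. \<phi> x * pd i (pd i \<psi>) x \<partial>?M)"
        unfolding laplacian_def sum_distrib_left
        by (intro Bochner_Integration.integral_sum L2_mult_integrable \<phi>L2 smooth_L2 smooth_pd ps)
      also have "\<dots> = (\<Sum>i\<in>UNIV. \<integral>x. K i x * \<psi> x \<partial>?M)"
      proof (rule sum.cong[OF refl])
        fix i
        show "(\<integral>x. \<phi> x * pd i (pd i \<psi>) x \<partial>?M) = (\<integral>x. K i x * \<psi> x \<partial>?M)"
          using GT(1)[of i] K(1)[of i] t test_fun_pd[OF t, of i] unfolding weak_pd_def by simp
      qed
      also have "\<dots> = (\<integral>x. (\<Sum>i\<in>UNIV. K i x) * \<psi> x \<partial>?M)"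
        unfolding sum_distrib_right by (intro Bochner_Integration.integral_sum[symmetric] Kint ps)
      finally show "(\<integral>x. (\<Sum>i\<in>UNIV. K i x) * \<psi> x \<partial>?M) = (\<integral>x. q x * \<psi> x \<partial>?M)" by simp
    qed
    moreover have "(\<integral>x. (\<Sum>i\<in>UNIV. K i x) * v x \<partial>?M) = (\<Sum>i\<in>UNIV. \<integral>x. K i x * v x \<partial>?M)"
      unfolding sum_distrib_right by (intro Bochner_Integration.integral_sum Kint sm)
    ultimately show ?thesis by simp
  qed
  obtain P where P: "\<And>j. test_fun unit_ball (P j)" "H1_tendsto unit_ball P \<phi>" using \<phi> unfolding H10_def by blast
  \<comment> \<open>Here \<open>H10\<close> enters: the approximants \<open>P j\<close> have compact
    support, so no boundary term appears. Their limiting derivative \<open>g\<close> need not be the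
    function \<open>G i\<close>, but \<open>l0\<close> shows that both pair equally with
    \<open>pd i v\<close>.\<close>
  have c: "(\<integral>x. G i x * pd i v x \<partial>?M) = - (\<integral>x. \<phi> x * pd i (pd i v) x \<partial>?M)" for i
  proof -
    obtain g where g: "weak_pd unit_ball i \<phi> g" "L2_tendsto ?M (\<lambda>j. pd i (P j)) g"
      using P(2) unfolding H1_tendsto_def by blast
    have P\<phi>: "L2_tendsto ?M P \<phi>" using P(2) unfolding H1_tendsto_def by blast
    have gL2: "g \<in> L2 ?M" using g(2) unfolding L2_tendsto_def by blast
    have l0: "(\<integral>x. G i x * pd i v x \<partial>?M) = (\<integral>x. g x * pd i v x \<partial>?M)"
    proof (rule L2_test_eq_imp_smooth_eq[OF GL2 gL2 smooth_pd[OF sm]])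
      fix \<psi> :: "real^'n \<Rightarrow> complex" assume t: "test_fun unit_ball \<psi>"
      show "(\<integral>x. G i x * \<psi> x \<partial>?M) = (\<integral>x. g x * \<psi> x \<partial>?M)"
        using g(1) GT(1)[of i] t unfolding weak_pd_def by simp
    qed
    have l1: "(\<lambda>j. \<integral>x. pd i (P j) x * pd i v x \<partial>?M) \<longlonglongrightarrow> (\<integral>x. g x * pd i v x \<partial>?M)"
      by (intro L2_tendsto_pairing g smooth_L2 smooth_pd sm)
    have l2: "(\<lambda>j. - (\<integral>x. P j x * pd i (pd i v) x \<partial>?M)) \<longlonglongrightarrow> - (\<integral>x. \<phi> x * pd i (pd i v) x \<partial>?M)"
      by (intro tendsto_minus L2_tendsto_pairing P\<phi> smooth_L2 smooth_pd sm)
    have eq: "(\<integral>x. pd i (P j) x * pd i v x \<partial>?M) = - (\<integral>x. P j x * pd i (pd i v) x \<partial>?M)" for j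
    proof -
      have "(\<integral>x. pd i v x * pd i (P j) x \<partial>?M) = - (\<integral>x. pd i (pd i v) x * P j x \<partial>?M)"
        using weak_pd_smooth[OF smooth_pd[OF sm], of i i] P(1)[of j] unfolding weak_pd_def by blast
      then show ?thesis by (simp only: mult.commute)
    qed
    show ?thesis unfolding l0 by (rule LIMSEQ_unique[OF l1[unfolded eq] l2])
  qed
  have "(\<integral>x. v x * h x \<partial>sphere_measure) = (\<integral>x. (\<Sum>i\<in>UNIV. T i x * (of_real (x $ i) * v x)) \<partial>sphere_measure)"
  proof (rule integral_cong_AE)
    show "AE x in sphere_measure. v x * h x = (\<Sum>i\<in>UNIV. T i x * (of_real (x $ i) * v x))"
      using hT by eventually_elim (simp add: sum_distrib_left mult_ac)
    show "(\<lambda>x. v x * h x) \<in> borel_measurable sphere_measure"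
      by (intro borel_measurable_integrable L2_mult_integrable hL2 smooth_L2_sphere sm)
    show "(\<lambda>x. \<Sum>i\<in>UNIV. T i x * (of_real (x $ i) * v x)) \<in> borel_measurable sphere_measure"
      by (intro borel_measurable_sum borel_measurable_integrable L2_mult_integrable TL2 smooth_L2_sphere smi)
  qed
  also have "\<dots> = (\<Sum>i\<in>UNIV. \<integral>x. T i x * (of_real (x $ i) * v x) \<partial>sphere_measure)"
    by (intro Bochner_Integration.integral_sum L2_mult_integrable TL2 smooth_L2_sphere smi)
  also have "\<dots> = (\<integral>x. q x * v x \<partial>?M) - (\<Sum>i\<in>UNIV. \<integral>x. \<phi> x * pd i (pd i v) x \<partial>?M)"
    unfolding a c sum.distrib b sum_negf by simp
  also have "(\<Sum>i\<in>UNIV. \<integral>x. \<phi> x * pd i (pd i v) x \<partial>?M) = (\<integral>x. \<phi> x * laplacian v x \<partial>?M)"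
    unfolding laplacian_def sum_distrib_left
    by (intro Bochner_Integration.integral_sum[symmetric] L2_mult_integrable \<phi>L2 smooth_L2 smooth_pd sm)
  also have "(\<integral>x. q x * v x \<partial>?M) - (\<integral>x. \<phi> x * laplacian v x \<partial>?M) = (\<integral>x. v x * q x - \<phi> x * laplacian v x \<partial>?M)"
    by (subst Bochner_Integration.integral_diff[symmetric])
       (auto intro!: L2_mult_integrable q \<phi>L2 smooth_L2 smooth_laplacian sm simp: mult.commute)
  finally show "(\<integral>x. v x * h x \<partial>sphere_measure) = (\<integral>x. v x * q x - \<phi> x * laplacian v x \<partial>?M)" .
qed


section \<open>Boundary conditions for smooth functions\<close>

lemma has_trace_smooth: "smooth f \<Longrightarrow> has_trace unit_ball sphere_measure f f"
  unfolding has_trace_def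
  by (intro exI[of _ "\<lambda>j. f"] conjI allI H1_tendsto_smooth_const L2_tendsto_const smooth_L2_sphere)

lemma has_trace_smooth_zero:
  assumes "smooth f" "\<And>x. norm x = 1 \<Longrightarrow> f x = 0"
  shows "has_trace unit_ball sphere_measure f (\<lambda>x. 0)"
proof -
  have "L2_tendsto sphere_measure (\<lambda>j. f) (\<lambda>x. 0)"
    unfolding L2_tendsto_def
  proof (intro conjI allI)
    have "(\<integral>x. (cmod (f x - 0))\<^sup>2 \<partial>sphere_measure) = (\<integral>x. 0 \<partial>(sphere_measure :: (real^'a) measure))"
      by (rule Bochner_Integration.integral_cong) (auto simp: space_sphere_measure assms(2))
    then show "(\<lambda>j::nat. \<integral>x. (cmod (f x - 0))\<^sup>2 \<partial>sphere_measure) \<longlonglongrightarrow> 0" by simp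
  qed (intro smooth_L2_sphere assms smooth_const)+
  then show ?thesis unfolding has_trace_def
    by (intro exI[of _ "\<lambda>j. f"] conjI allI H1_tendsto_smooth_const assms)
qed

lemma has_normal_derivative_smooth:
  assumes "smooth u" "smooth g" "\<And>x. norm x = 1 \<Longrightarrow> g x = (\<Sum>i\<in>UNIV. of_real (x $ i) * pd i u x)"
  shows "has_normal_derivative unit_ball sphere_measure (\<lambda>x. x) u g"
  unfolding has_normal_derivative_def
proof (intro conjI exI[of _ "\<lambda>i. pd i u"] allI)
  show "g \<in> L2 sphere_measure" by (rule smooth_L2_sphere[OF assms(2)])
  show "weak_pd unit_ball i u (pd i u)" for i by (rule weak_pd_smooth[OF assms(1)])
  show "has_trace unit_ball sphere_measure (pd i u) (pd i u)" for i by (intro has_trace_smooth smooth_pd assms)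
  show "AE x in sphere_measure. g x = (\<Sum>i\<in>UNIV. of_real (x $ i) * pd i u x)"
    by (rule AE_I2) (simp add: space_sphere_measure assms(3))
qed

text \<open>The Lipschitz bound against a nearest boundary point gives vanishing of order
  \<open>1 - norm x\<close>, and \<open>1 - norm x \<le> 1 - x \<bullet> x\<close> inside the
  ball.\<close>

lemma smooth_vanishing_H10:
  fixes u :: "real^'n \<Rightarrow> complex"
  assumes sm: "smooth u" and van: "\<And>x. norm x = 1 \<Longrightarrow> u x = 0"
  shows "u \<in> H10 unit_ball"
proof -
  obtain L where L: "L \<ge> 0" "\<And>x y. norm x \<le> 1 \<Longrightarrow> norm y \<le> 1 \<Longrightarrow> cmod (u x - u y) \<le> L * norm (x - y)"
    using smooth_lipschitz[OF sm] by blast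
  have "cmod (u x) \<le> L * (1 - x \<bullet> x)" if x: "norm x < 1" for x
  proof -
    have "\<exists>y. norm y = 1 \<and> norm (x - y) = 1 - norm x"
    proof (cases "x = 0")
      case True
      \<comment> \<open>At the centre \<open>sgn x\<close> is 0, so an arbitrary unit vector takes
        its place.\<close>
      then show ?thesis by (intro exI[of _ "axis undefined 1"]) (simp add: norm_axis_1)
    next
      case False
      have "x - sgn x = (norm x - 1) *\<^sub>R sgn x" using False by (simp add: sgn_div_norm algebra_simps)
      then have "norm (x - sgn x) = 1 - norm x" using False x by (simp add: norm_sgn)
      then show ?thesis using False by (intro exI[of _ "sgn x"]) (simp add: norm_sgn)
    qed
    then obtain y where y: "norm y = 1" "norm (x - y) = 1 - norm x" by blast
    have "cmod (u x) \<le> L * (1 - norm x)" using L(2)[of x y] x y van[of y] by simp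
    also have "\<dots> \<le> L * (1 - x \<bullet> x)"
    proof -
      have "x \<bullet> x \<le> norm x" using x unfolding power2_norm_eq_inner[symmetric] by (simp add: power2_eq_square mult_left_le)
      then show ?thesis using L(1) by (intro mult_left_mono) auto
    qed
    finally show ?thesis .
  qed
  then show ?thesis using smooth_H10[OF sm _ L(1)] by blast
qed

text \<open>A continuous function that is nonzero at the centre is nonzero on an open set, which is
  not negligible. It reduces nontriviality of the pair to the value \<open>v 0\<close>.\<close>

lemma AE_ball_zero_imp_zero:
  fixes f :: "real^'n \<Rightarrow> complex"
  assumes "continuous_on UNIV f" "AE x in lebesgue_on unit_ball. f x = 0"
  shows "f 0 = 0"
proof (rule ccontr)
  assume "f 0 \<noteq> 0"
  define U where "U = unit_ball \<inter> {x. f x \<noteq> 0}"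
  have op: "open U" unfolding U_def using assms(1) by (intro open_Int open_ball open_Collect_neq) auto
  have "AE x in lebesgue. x \<in> unit_ball \<longrightarrow> f x = 0"
    using assms(2) by (subst (asm) AE_restrict_space_iff) auto
  then have "AE x in lebesgue. x \<notin> U" by eventually_elim (auto simp: U_def)
  moreover have "{x \<in> space lebesgue. \<not> x \<notin> U} = U" by auto
  ultimately have "U \<in> null_sets lebesgue"
    using op by (simp add: AE_iff_null)
  then have "negligible U" by (simp add: negligible_iff_null_sets)
  moreover have "0 \<in> U" using \<open>f 0 \<noteq> 0\<close> by (simp add: U_def)
  ultimately show False using open_not_negligible op by blast
qed

section \<open>The eigenfunctions\<close>

lemma spherical_entire_values:
  "spherical_entire k 1 = sin k" "spherical_entire k 0 = k"
  "2 * deriv (spherical_entire k) 1 = k * cos k - sin k"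
  using spherical_entire_mult[of k 1] spherical_entire_deriv[of 0 k] spherical_entire_deriv[of 1 k]
  by (auto simp: algebra_simps)

text \<open>Everything is smooth up to the boundary, so each weak condition is the classical one.
  Agreement on the sphere is built into the amplitudes, and the flux condition is
  \<open>zero\<close>.\<close>

lemma transmission_eigenvalue_unit_ball:
  fixes n \<eta> :: real and k :: complex
  defines "a \<equiv> sqrt n"
  assumes n: "n > 0" and k: "k \<notin> \<real>"
    and zero: "k * (of_real a * sin k * cos (of_real a * k) - cos k * sin (of_real a * k)) = of_real \<eta> * sin k * sin (of_real a * k)"
  shows "transmission_eigenvalue (ball (0 :: real^3) 1) sphere_measure (\<lambda>x. x) n \<eta> k"
proof -
  have a: "a > 0" "a\<^sup>2 = n" using n by (auto simp: a_def)
  define c where "c = of_real a * k"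
  define w :: "real^3 \<Rightarrow> complex" where "w x = sin k * spherical_wave c x" for x
  define v :: "real^3 \<Rightarrow> complex" where "v x = sin c * spherical_wave k x" for x
  define u where "u x = w x - v x" for x
  have smw: "smooth w" and smv: "smooth v" unfolding w_def[abs_def] v_def[abs_def]
    by (intro smooth_mult smooth_const smooth_spherical_wave)+
  have smu: "smooth u" unfolding u_def[abs_def] by (intro smooth_diff smw smv)
  have smev: "smooth (\<lambda>x. of_real \<eta> * v x)" by (intro smooth_mult smooth_const smv)
  have lap_scaled: "weak_laplacian unit_ball (\<lambda>x::real^3. b * spherical_wave m x) (\<lambda>x. - (m\<^sup>2 * (b * spherical_wave m x)))" for b m
  proof -
    have sw: "smooth (spherical_wave m :: real^3 \<Rightarrow> complex)" by (rule smooth_spherical_wave)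
    have p: "pd i (\<lambda>x. b * f x) = (\<lambda>x. b * pd i f x)" if "smooth f" for i and f :: "real^3 \<Rightarrow> complex"
      using pd_mult[OF smooth_differentiable[OF smooth_const] smooth_differentiable[OF that], of i b] by (simp add: fun_eq_iff)
    have "laplacian (\<lambda>x::real^3. b * spherical_wave m x) = (\<lambda>x. - (m\<^sup>2 * (b * spherical_wave m x)))"
    proof
      fix x :: "real^3"
      have "laplacian (\<lambda>x::real^3. b * spherical_wave m x) x = b * laplacian (spherical_wave m) x"
        unfolding laplacian_def by (simp add: p[OF sw] p[OF smooth_pd[OF sw]] sum_distrib_left)
      then show "laplacian (\<lambda>x::real^3. b * spherical_wave m x) x = - (m\<^sup>2 * (b * spherical_wave m x))"
        by (simp add: laplacian_spherical_wave)
    qed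
    then show ?thesis using weak_laplacian_smooth[of "\<lambda>x::real^3. b * spherical_wave m x"]
      by (simp add: smooth_mult sw)
  qed
  have sphere: "spherical_wave m x = sin m" if "norm x = 1" for m and x :: "real^3"
    using that by (simp add: spherical_wave_def spherical_entire_values flip: power2_norm_eq_inner)
  have u0: "u x = 0" if "norm x = 1" for x by (simp add: u_def w_def v_def sphere[OF that])
  have nd: "of_real \<eta> * v x = (\<Sum>i\<in>UNIV. of_real (x $ i) * pd i u x)" if x: "norm x = 1" for x
  proof -
    have xx: "x \<bullet> x = 1" using x by (simp flip: power2_norm_eq_inner)
    have p: "pd i (\<lambda>x. b * spherical_wave m x) x = of_real (x $ i) * (b * (m * cos m - sin m))" for i b m
      using pd_mult[OF smooth_differentiable[OF smooth_const] smooth_differentiable[OF smooth_spherical_wave], of i b m x]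
      by (simp add: pd_spherical_wave xx mult_ac flip: spherical_entire_values(3))
    have "pd i u x = of_real (x $ i) * (sin k * (c * cos c - sin c) - sin c * (k * cos k - sin k))" for i
      unfolding u_def[abs_def] pd_diff[OF smooth_differentiable[OF smw] smooth_differentiable[OF smv]]
      unfolding w_def[abs_def] v_def[abs_def] p by (simp add: algebra_simps)
    then have "(\<Sum>i\<in>UNIV. of_real (x $ i) * pd i u x) = (\<Sum>i\<in>UNIV. of_real (x $ i * x $ i)) * (sin k * (c * cos c - sin c) - sin c * (k * cos k - sin k))"
      by (simp add: sum_distrib_right mult.assoc)
    also have "(\<Sum>i\<in>UNIV. complex_of_real (x $ i * x $ i)) = of_real (x \<bullet> x)" by (simp add: inner_vec_def)
    \<comment> \<open>The products \<open>sin k * sin c\<close> from the two radial derivatives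
      cancel here, leaving \<open>k * disp a k\<close>.\<close>
    also have "of_real (x \<bullet> x) * (sin k * (c * cos c - sin c) - sin c * (k * cos k - sin k)) = k * (of_real a * sin k * cos c - cos k * sin c)"
      unfolding xx by (simp add: c_def algebra_simps)
    also have "\<dots> = of_real \<eta> * sin k * sin c" using zero unfolding c_def .
    also have "\<dots> = of_real \<eta> * v x" by (simp add: v_def sphere[OF x])
    finally show ?thesis by simp
  qed
  have nontriv: "\<not> (AE x in lebesgue_on unit_ball. w x = 0 \<and> v x = 0)"
  proof
    assume "AE x in lebesgue_on unit_ball. w x = 0 \<and> v x = 0"
    then have "AE x in lebesgue_on unit_ball. v x = 0" by eventually_elim simp
    then have "v 0 = 0" by (rule AE_ball_zero_imp_zero[OF smooth_continuous[OF smv]])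
    then have "sin c * k = 0" by (simp add: v_def spherical_wave_def spherical_entire_values)
    moreover have "k \<noteq> 0" using k by auto
    \<comment> \<open>The sine has only real zeros and \<open>c\<close> is a nonzero real multiple
      of the non-real \<open>k\<close>, so \<open>v 0 = sin c * k\<close> is nonzero.\<close>
    moreover have "sin c \<noteq> 0"
    proof
      assume "sin c = 0"
      then have "c \<in> \<real>" by (auto simp: sin_eq_0)
      then have "of_real (inverse a) * c \<in> \<real>" by (intro Reals_mult) auto
      then show False using k a(1) by (simp add: c_def mult.assoc[symmetric] flip: of_real_mult)
    qed
    ultimately show False by simp
  qed
  show ?thesis unfolding transmission_eigenvalue_def
  proof (rule bexI[of _ w], rule bexI[of _ v], intro conjI exI[of _ "\<lambda>x. of_real \<eta> * v x"])
    show "w \<in> L2 (lebesgue_on unit_ball)" "v \<in> L2 (lebesgue_on unit_ball)" by (intro smooth_L2 smw smv)+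
    show "\<not> (AE x in lebesgue_on unit_ball. w x = 0 \<and> v x = 0)" by (rule nontriv)
    show "(\<lambda>x. w x - v x) \<in> H2 unit_ball \<inter> H10 unit_ball"
      unfolding u_def[symmetric] using smooth_H2[OF smu] smooth_vanishing_H10[OF smu u0] by simp
    show "weak_laplacian unit_ball w (\<lambda>x. - (k\<^sup>2 * of_real n * w x))"
      using lap_scaled[of "sin k" c] unfolding w_def[abs_def] c_def a(2)[symmetric]
      by (simp add: power_mult_distrib mult_ac)
    show "weak_laplacian unit_ball v (\<lambda>x. - (k\<^sup>2 * v x))"
      using lap_scaled[of "sin c" k] unfolding v_def[abs_def] .
    show "has_trace unit_ball sphere_measure (\<lambda>x. w x - v x) (\<lambda>x. 0)"
      unfolding u_def[symmetric] by (rule has_trace_smooth_zero[OF smu u0])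
    show "has_normal_derivative unit_ball sphere_measure (\<lambda>x. x) (\<lambda>x. w x - v x) (\<lambda>x. of_real \<eta> * v x)"
      unfolding u_def[symmetric] by (rule has_normal_derivative_smooth[OF smu smev nd])
    show "has_weak_trace unit_ball sphere_measure (\<lambda>x. x) (\<lambda>x. of_real \<eta> * v x) (\<lambda>x. of_real \<eta> * v x)"
      by (rule has_weak_trace_smooth[OF smev])
  qed
qed

theorem theorem4p1:
  fixes n :: real
  assumes "n > 0"
    and "sqrt n \<notin> \<int>"
    and "\<And>m :: int. sqrt n \<noteq> 1 / of_int m"
  shows "\<exists>\<eta>\<^sub>0 > 0. \<forall>\<eta> :: real. 0 < \<eta> \<and> \<eta> < \<eta>\<^sub>0 \<longrightarrow>
    infinite {k :: complex. k \<notin> \<real> \<and>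
      transmission_eigenvalue (ball (0 :: real^3) 1) sphere_measure (\<lambda>x. x) n \<eta> k}"
proof (intro exI[of _ 1] conjI allI impI)
  fix \<eta> :: real
  have "sqrt n > 0" using assms(1) by simp
  then have "infinite {k :: complex. k \<notin> \<real> \<and> k * disp (sqrt n) k = of_real \<eta> * sin k * sin (of_real (sqrt n) * k)}"
    using assms(2,3) by (rule infinite_nonreal_zeros)
  moreover have "{k :: complex. k \<notin> \<real> \<and> k * disp (sqrt n) k = of_real \<eta> * sin k * sin (of_real (sqrt n) * k)}
    \<subseteq> {k. k \<notin> \<real> \<and> transmission_eigenvalue (ball (0 :: real^3) 1) sphere_measure (\<lambda>x. x) n \<eta> k}"
    using transmission_eigenvalue_unit_ball[OF assms(1)] by (auto simp: disp_def)
  ultimately show "infinite {k :: complex. k \<notin> \<real> \<and>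
      transmission_eigenvalue (ball (0 :: real^3) 1) sphere_measure (\<lambda>x. x) n \<eta> k}"
    using finite_subset by blast
qed simp

end
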